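(* Let $\mathcal M$ be a von Neumann factor acting on a separable Hilbert space $H$ with a separating and cyclic unit vector $x_0$. Then both correspondences $\phi\mapsto \mathrm C_\phi\in\mathcal B(H)$ and $\phi\mapsto \mathrm D_\phi\in\mathcal T(H)$ are injective on the space $\mathbb{CB}^\sigma_\varepsilon(\mathcal M)$; the range of $\phi\mapsto \mathrm C_\phi$ is weakly dense in $\mathcal B(H)$ and the range of $\phi\mapsto\mathrm D_\phi$ is norm dense in $\mathcal T(H)$ (with respect to the trace norm).
   Context: Inner products $(\cdot|\cdot)$ are linear in the first variable. $\mathcal B(H)$ denotes the bounded operators and $\mathcal T(H)=\mathcal B(H)_*$ the trace class operators on $H$, paired by $\langle A,B\rangle=\operatorname{Tr}(AB)$. For $x,y\in H$, $x\boxtimes y$ is the operator $z\mapsto (z|y)x$. A map is normal if it is continuous for the $\sigma$-weak topologies. For a normal linear map $\Phi:\mathcal B(H)\to\mathcal B(H)$, its predual map $\Phi_*:\mathcal T(H)\to\mathcal T(H)$ is defined by $\langle A,\Phi_*(B)\rangle=\langle\Phi(A),B\rangle$. Let $\mathcal M'$ be the commutant of $\mathcal M$ and $\mathrm{alg}(\mathcal M',\mathcal M)$ the algebra generated by $\mathcal M$ and $\mathcal M'$, i.e. the linear span of products $A'B$ with $A'\in\mathcal M'$, $B\in\mathcal M$; it is weakly dense in $\mathcal B(H)$ and is $*$-isomorphic to the algebraic tensor product $\mathcal M'\otimes\mathcal M$. For a linear map $\phi:\mathcal M\to\mathcal M$, define the (well-defined) linear map $\tilde\phi$ on $\mathrm{alg}(\mathcal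 M',\mathcal M)$ by $\tilde\phi(\sum_i A_i'B_i)=\sum_i A_i'\phi(B_i)$. $\mathbb{CB}^\sigma_\varepsilon(\mathcal M)$ is the space of linear maps $\phi:\mathcal M\to\mathcal M$ such that $\tilde\phi$ extends to a normal map on $\mathcal B(H)$, the extension still being denoted $\tilde\phi$ (such $\phi$ are automatically normal and completely bounded). With $E_0=x_0\boxtimes x_0$ the projection onto $\mathbb C x_0$, for $\phi\in\mathbb{CB}^\sigma_\varepsilon(\mathcal M)$ put $\mathrm C_\phi=\tilde\phi(E_0)\in\mathcal B(H)$ and $\mathrm D_\phi=\tilde\phi_*(E_0)\in\mathcal T(H)$. *)

theory Defs
  imports "HOL-Analysis.Analysis"
begin

section \<open>Complex Hilbert spaces\<close>

class complex_vector = real_vector +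
  fixes scaleC :: "complex \<Rightarrow> 'a \<Rightarrow> 'a"  (infixr \<open>*\<^sub>C\<close> 75)
  assumes scaleC_add_right: "c *\<^sub>C (x + y) = c *\<^sub>C x + c *\<^sub>C y"
    and scaleC_add_left: "(c + d) *\<^sub>C x = c *\<^sub>C x + d *\<^sub>C x"
    and scaleC_scaleC [simp]: "c *\<^sub>C d *\<^sub>C x = (c * d) *\<^sub>C x"
    and scaleC_one [simp]: "1 *\<^sub>C x = x"
    and scaleR_scaleC: "r *\<^sub>R x = complex_of_real r *\<^sub>C x"

global_interpretation cvs: vector_space "scaleC :: complex \<Rightarrow> 'a::complex_vector \<Rightarrow> 'a"
  by unfold_locales (simp_all add: scaleC_add_right scaleC_add_left)

abbreviation clinear :: "('a::complex_vector \<Rightarrow> 'b::complex_vector) \<Rightarrow> bool" where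
  "clinear \<equiv> Vector_Spaces.linear scaleC scaleC"

lemma clinearI:
  assumes "\<And>x y. f (x + y) = f x + f y" and "\<And>c x. f (c *\<^sub>C x) = c *\<^sub>C f x"
  shows "clinear f"
  by unfold_locales (simp_all add: assms)

lemma clinear_add: "clinear f \<Longrightarrow> f (x + y) = f x + f y"
  and clinear_scaleC: "clinear f \<Longrightarrow> f (c *\<^sub>C x) = c *\<^sub>C f x"
  by (simp_all add: Vector_Spaces.linear_def module_hom_def module_hom_axioms_def)

text \<open>The inner product is linear in the first variable. The last axiom contains positive
  definiteness, since \<^term>\<open>norm\<close> is the norm of a normed space.\<close>

class complex_hilbert = complex_vector + banach +
  fixes cinner :: "'a \<Rightarrow> 'a \<Rightarrow> complex"
  assumes cinner_commute: "cinner x y = cnj (cinner y x)"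
    and cinner_add_left: "cinner (x + y) z = cinner x z + cinner y z"
    and cinner_scaleC_left: "cinner (c *\<^sub>C x) y = c * cinner x y"
    and cinner_self: "cinner x x = complex_of_real ((norm x)\<^sup>2)"

instantiation complex :: complex_hilbert
begin
definition scaleC_complex :: "complex \<Rightarrow> complex \<Rightarrow> complex" where
  "scaleC_complex c z = c * z"
definition cinner_complex :: "complex \<Rightarrow> complex \<Rightarrow> complex" where
  "cinner_complex z w = z * cnj w"
instance
  by standard (simp_all add: scaleC_complex_def cinner_complex_def algebra_simps
      scaleR_conv_of_real complex_norm_square del: of_real_power)
end

lemma cinner_add_right: "cinner x (y + z) = cinner x y + cinner x (z::'a::complex_hilbert)"
  by (metis cinner_add_left cinner_commute complex_cnj_add)

lemma cinner_scaleC_right: "cinner x (c *\<^sub>C y) = cnj c * cinner x (y::'a::complex_hilbert)"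
  by (metis cinner_commute cinner_scaleC_left complex_cnj_mult)

lemma cinner_zero_right [simp]: "cinner x (0::'a::complex_hilbert) = 0"
  using cinner_add_right[of x 0 0] by simp

lemma norm_scaleC: "norm (c *\<^sub>C x) = cmod c * norm (x::'a::complex_hilbert)"
proof -
  have "complex_of_real ((norm (c *\<^sub>C x))\<^sup>2) = complex_of_real ((cmod c * norm x)\<^sup>2)"
    unfolding power_mult_distrib of_real_mult complex_norm_square[of c] cinner_self[symmetric, where 'a = 'a]
    by (simp add: cinner_scaleC_left cinner_scaleC_right)
  then have "(norm (c *\<^sub>C x))\<^sup>2 = (cmod c * norm x)\<^sup>2"
    by (simp only: of_real_eq_iff)
  then show ?thesis
    by (simp add: power2_eq_iff_nonneg)
qed

lemma cinner_Cauchy_Schwarz: "cmod (cinner x y) \<le> norm x * norm (y::'a::complex_hilbert)"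
proof (cases "y = 0")
  case False
  define c where "c = cinner x y"
  define s where "s = (norm y)\<^sup>2"
  have s: "s > 0" using False by (simp add: s_def)
  define u where "u = of_real s *\<^sub>C x + (- c) *\<^sub>C y"
  have yx: "cinner y x = cnj c" unfolding c_def by (rule cinner_commute)
  have expand: "cinner (a *\<^sub>C x + d *\<^sub>C y) (a *\<^sub>C x + d *\<^sub>C y)
      = a * cnj a * cinner x x + a * cnj d * c + d * cnj a * cnj c + d * cnj d * cinner y y" for a d
    by (simp add: cinner_add_left cinner_add_right cinner_scaleC_left cinner_scaleC_right yx
        c_def[symmetric] algebra_simps)
  have "complex_of_real ((norm u)\<^sup>2)
      = of_real s * of_real s * of_real ((norm x)\<^sup>2) - of_real s * (c * cnj c)"
    unfolding cinner_self[symmetric, where 'a = 'a] u_def expand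
    by (simp add: cinner_self[of y] s_def[symmetric] algebra_simps del: of_real_power)
  also have "\<dots> = complex_of_real (s * (s * (norm x)\<^sup>2 - (cmod c)\<^sup>2))"
    by (simp add: complex_norm_square[symmetric] algebra_simps)
  finally have "(norm u)\<^sup>2 = s * (s * (norm x)\<^sup>2 - (cmod c)\<^sup>2)"
    by (simp only: of_real_eq_iff)
  then have "0 \<le> s * (s * (norm x)\<^sup>2 - (cmod c)\<^sup>2)"
    by (metis zero_le_power2)
  then have "(cmod c)\<^sup>2 \<le> (norm x * norm y)\<^sup>2"
    using s by (simp add: zero_le_mult_iff s_def power_mult_distrib mult.commute)
  then show ?thesis
    unfolding c_def by (rule power2_le_imp_le) simp
qed simp


section \<open>Bounded operators\<close>

typedef (overloaded) 'a bop = "{f :: 'a::complex_hilbert \<Rightarrow> 'a. bounded_linear f \<and> clinear f}"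
  morphisms bop_apply Bop
  by (rule exI[of _ "\<lambda>x. x"]) (auto intro!: clinearI)

setup_lifting type_definition_bop

lemma bop_eqI: "(\<And>x. bop_apply A x = bop_apply B x) \<Longrightarrow> A = B"
  by transfer auto

text \<open>The product of operators is composition. The type is not an instance of
  \<^class>\<open>ring_1\<close>, because \<open>0 = 1\<close> on the zero space.\<close>

instantiation bop :: (complex_hilbert) "{complex_vector, ring, monoid_mult}"
begin

lift_definition zero_bop :: "'a bop" is "\<lambda>x. 0"
  by (auto intro!: clinearI simp: cvs.scale_zero_right)

lift_definition one_bop :: "'a bop" is "\<lambda>x. x"
  by (auto intro!: clinearI)

lift_definition plus_bop :: "'a bop \<Rightarrow> 'a bop \<Rightarrow> 'a bop" is "\<lambda>f g x. f x + g x"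
  by (auto intro!: clinearI bounded_linear_add simp: clinear_add clinear_scaleC scaleC_add_right)

lift_definition uminus_bop :: "'a bop \<Rightarrow> 'a bop" is "\<lambda>f x. - f x"
  by (auto intro!: clinearI bounded_linear_minus
      simp: clinear_add clinear_scaleC cvs.scale_minus_right)

lift_definition minus_bop :: "'a bop \<Rightarrow> 'a bop \<Rightarrow> 'a bop" is "\<lambda>f g x. f x - g x"
  by (auto intro!: clinearI bounded_linear_sub
      simp: clinear_add clinear_scaleC cvs.scale_right_diff_distrib)

lift_definition times_bop :: "'a bop \<Rightarrow> 'a bop \<Rightarrow> 'a bop" is "\<lambda>f g x. f (g x)"
  by (auto intro!: clinearI intro: bounded_linear_compose simp: clinear_add clinear_scaleC)

lift_definition scaleC_bop :: "complex \<Rightarrow> 'a bop \<Rightarrow> 'a bop" is "\<lambda>c f x. c *\<^sub>C f x"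
proof (intro conjI clinearI)
  fix c :: complex and f :: "'a \<Rightarrow> 'a"
  assume f: "bounded_linear f \<and> clinear f"
  show "bounded_linear (\<lambda>x. c *\<^sub>C f x)"
  proof (rule bounded_linear_intro)
    show "norm (c *\<^sub>C f x) \<le> norm x * (cmod c * onorm f)" for x
      using mult_left_mono[OF onorm[of f x] norm_ge_zero[of c]] f
      by (simp add: norm_scaleC algebra_simps)
  qed (use f in \<open>simp_all add: clinear_add clinear_scaleC scaleC_add_right scaleR_scaleC mult.commute\<close>)
qed (simp_all add: clinear_add clinear_scaleC scaleC_add_right mult.commute)

definition scaleR_bop :: "real \<Rightarrow> 'a bop \<Rightarrow> 'a bop" where
  "scaleR_bop r A = complex_of_real r *\<^sub>C A"

instance
proof
  fix A B C :: "'a bop" and c d :: complex and r s :: real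
  show "A + B + C = A + (B + C)" by transfer (simp add: algebra_simps)
  show "A + B = B + A" by transfer (simp add: algebra_simps)
  show "0 + A = A" by transfer simp
  show "- A + A = 0" by transfer simp
  show "A - B = A + - B" by transfer simp
  show "A * B * C = A * (B * C)" by transfer simp
  show "(A + B) * C = A * C + B * C" by transfer simp
  show "A * (B + C) = A * B + A * C" by transfer (simp add: clinear_add)
  show "1 * A = A" "A * 1 = A" by (transfer, simp)+
  show "c *\<^sub>C (A + B) = c *\<^sub>C A + c *\<^sub>C B" by transfer (simp add: scaleC_add_right)
  show "(c + d) *\<^sub>C A = c *\<^sub>C A + d *\<^sub>C A" by transfer (simp add: scaleC_add_left)
  show "c *\<^sub>C d *\<^sub>C A = (c * d) *\<^sub>C A" by transfer simp
  show "1 *\<^sub>C A = A" by transfer simp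
  show "r *\<^sub>R A = complex_of_real r *\<^sub>C A" by (rule scaleR_bop_def)
  show "r *\<^sub>R (A + B) = r *\<^sub>R A + r *\<^sub>R B"
    unfolding scaleR_bop_def by transfer (simp add: scaleC_add_right)
  show "(r + s) *\<^sub>R A = r *\<^sub>R A + s *\<^sub>R A"
    unfolding scaleR_bop_def by transfer (simp add: scaleC_add_left)
  show "r *\<^sub>R s *\<^sub>R A = (r * s) *\<^sub>R A"
    unfolding scaleR_bop_def by transfer simp
  show "1 *\<^sub>R A = A"
    unfolding scaleR_bop_def by transfer simp
qed

end

text \<open>The operator \<open>x \<boxtimes> y\<close>.\<close>

lift_definition rank_one :: "'a::complex_hilbert \<Rightarrow> 'a \<Rightarrow> 'a bop" is "\<lambda>x y z. cinner z y *\<^sub>C x"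
proof (intro conjI clinearI)
  fix x y :: 'a
  show "bounded_linear (\<lambda>z. cinner z y *\<^sub>C x)"
  proof (rule bounded_linear_intro)
    show "norm (cinner z y *\<^sub>C x) \<le> norm z * (norm y * norm x)" for z
      using mult_right_mono[OF cinner_Cauchy_Schwarz[of z y] norm_ge_zero[of x]]
      by (simp add: norm_scaleC mult.assoc)
  qed (simp_all add: cinner_add_left cinner_scaleC_left scaleC_add_left scaleR_scaleC)
qed (simp_all add: cinner_add_left cinner_scaleC_left scaleC_add_left)

definition adj :: "'a::complex_hilbert bop \<Rightarrow> 'a bop" where
  "adj A = (THE B. \<forall>x y. cinner (bop_apply A x) y = cinner x (bop_apply B y))"

definition positive_op :: "'a::complex_hilbert bop \<Rightarrow> bool" where
  "positive_op A \<longleftrightarrow> (\<forall>x. cinner (bop_apply A x) x \<in> \<real>\<^sub>\<ge>\<^sub>0)"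

definition abs_op :: "'a::complex_hilbert bop \<Rightarrow> 'a bop" where
  "abs_op A = (THE P. positive_op P \<and> P * P = adj A * A)"


section \<open>Trace class operators\<close>

definition is_onb :: "'a::complex_hilbert set \<Rightarrow> bool" where
  "is_onb E \<longleftrightarrow> (\<forall>e\<in>E. \<forall>f\<in>E. cinner e f = (if e = f then 1 else 0))
     \<and> (\<forall>x. (\<forall>e\<in>E. cinner x e = 0) \<longrightarrow> x = 0)"

definition trace_class :: "'a::complex_hilbert bop set" where
  "trace_class = {T. \<exists>E. is_onb E \<and> (\<lambda>e. cinner (bop_apply (abs_op T) e) e) summable_on E}"

text \<open>On trace class operators the sum does not depend on the chosen basis.\<close>

definition trace :: "'a::complex_hilbert bop \<Rightarrow> complex" where
  "trace T = (\<Sum>\<^sub>\<infinity>e\<in>(SOME E. is_onb E). cinner (bop_apply T e) e)"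

definition trace_norm :: "'a::complex_hilbert bop \<Rightarrow> real" where
  "trace_norm T = Re (trace (abs_op T))"


section \<open>Topologies and normal maps\<close>

definition weak_operator_topology :: "'a::complex_hilbert bop topology" where
  "weak_operator_topology =
     topology_generated_by {{A. cinner (bop_apply A x) y \<in> U} | x y U. open U}"

definition sigma_weak_topology :: "'a::complex_hilbert bop topology" where
  "sigma_weak_topology =
     topology_generated_by {{A. trace (A * T) \<in> U} | T U. T \<in> trace_class \<and> open U}"

definition normal_map :: "('a::complex_hilbert bop \<Rightarrow> 'a bop) \<Rightarrow> bool" where
  "normal_map \<Phi> \<longleftrightarrow> clinear \<Phi> \<and> continuous_map sigma_weak_topology sigma_weak_topology \<Phi>"

text \<open>The predual map \<open>\<Phi>\<^sub>*\<close> of a normal map.\<close>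

definition predual_map :: "('a::complex_hilbert bop \<Rightarrow> 'a bop) \<Rightarrow> 'a bop \<Rightarrow> 'a bop" where
  "predual_map \<Phi> T = (THE S. S \<in> trace_class \<and> (\<forall>A. trace (A * S) = trace (\<Phi> A * T)))"


section \<open>Von Neumann algebras\<close>

definition commutant :: "'a::complex_hilbert bop set \<Rightarrow> 'a bop set" where
  "commutant M = {A. \<forall>B\<in>M. A * B = B * A}"

text \<open>That \<open>M\<close> is a unital subalgebra follows from \<open>M = M''\<close>.\<close>

definition von_neumann_algebra :: "'a::complex_hilbert bop set \<Rightarrow> bool" where
  "von_neumann_algebra M \<longleftrightarrow> (\<forall>A\<in>M. adj A \<in> M) \<and> commutant (commutant M) = M"

definition vn_factor :: "'a::complex_hilbert bop set \<Rightarrow> bool" where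
  "vn_factor M \<longleftrightarrow> von_neumann_algebra M \<and> M \<inter> commutant M = range (\<lambda>c. c *\<^sub>C 1)"

definition cyclic_vector :: "'a::complex_hilbert bop set \<Rightarrow> 'a \<Rightarrow> bool" where
  "cyclic_vector M x \<longleftrightarrow> closure ((\<lambda>A. bop_apply A x) ` M) = UNIV"

definition separating_vector :: "'a::complex_hilbert bop set \<Rightarrow> 'a \<Rightarrow> bool" where
  "separating_vector M x \<longleftrightarrow> (\<forall>A\<in>M. bop_apply A x = 0 \<longrightarrow> A = 0)"


section \<open>The space of maps with a normal extension\<close>

text \<open>Linear maps \<open>M \<rightarrow> M\<close> are represented by extensional functions, so that they are determined
  by their values on \<open>M\<close>.\<close>

definition linear_maps_on :: "'a::complex_hilbert bop set \<Rightarrow> ('a bop \<Rightarrow> 'a bop) set" where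
  "linear_maps_on M = {\<phi> \<in> M \<rightarrow>\<^sub>E M.
     (\<forall>A\<in>M. \<forall>B\<in>M. \<phi> (A + B) = \<phi> A + \<phi> B) \<and> (\<forall>c. \<forall>A\<in>M. \<phi> (c *\<^sub>C A) = c *\<^sub>C \<phi> A)}"

text \<open>The graph of \<open>\<Sum>\<^sub>i A'\<^sub>i B\<^sub>i \<mapsto> \<Sum>\<^sub>i A'\<^sub>i \<phi>(B\<^sub>i)\<close>, whose domain is the algebra generated by \<open>M\<close> and
  its commutant. It is single-valued when \<open>M\<close> is a factor, and in any case when some function
  extends it.\<close>

definition tilde_graph ::
  "'a::complex_hilbert bop set \<Rightarrow> ('a bop \<Rightarrow> 'a bop) \<Rightarrow> ('a bop \<times> 'a bop) set" where
  "tilde_graph M \<phi> = {(\<Sum>i<n. A' i * B i, \<Sum>i<n. A' i * \<phi> (B i)) | (n::nat) A' B.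
     \<forall>i<n. A' i \<in> commutant M \<and> B i \<in> M}"

definition normal_extension ::
  "'a::complex_hilbert bop set \<Rightarrow> ('a bop \<Rightarrow> 'a bop) \<Rightarrow> ('a bop \<Rightarrow> 'a bop) \<Rightarrow> bool" where
  "normal_extension M \<phi> \<Phi> \<longleftrightarrow> normal_map \<Phi> \<and> (\<forall>(X, Y)\<in>tilde_graph M \<phi>. \<Phi> X = Y)"

definition CB_sigma :: "'a::complex_hilbert bop set \<Rightarrow> ('a bop \<Rightarrow> 'a bop) set" where
  "CB_sigma M = {\<phi> \<in> linear_maps_on M. \<exists>\<Phi>. normal_extension M \<phi> \<Phi>}"

text \<open>The extension is unique because the algebra generated by a factor and its commutant is
  sigma-weakly dense.\<close>

definition tilde :: "'a::complex_hilbert bop set \<Rightarrow> ('a bop \<Rightarrow> 'a bop) \<Rightarrow> 'a bop \<Rightarrow> 'a bop" where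
  "tilde M \<phi> = (THE \<Phi>. normal_extension M \<phi> \<Phi>)"

definition C_op :: "'a::complex_hilbert bop set \<Rightarrow> 'a \<Rightarrow> ('a bop \<Rightarrow> 'a bop) \<Rightarrow> 'a bop" where
  "C_op M x\<^sub>0 \<phi> = tilde M \<phi> (rank_one x\<^sub>0 x\<^sub>0)"

definition D_op :: "'a::complex_hilbert bop set \<Rightarrow> 'a \<Rightarrow> ('a bop \<Rightarrow> 'a bop) \<Rightarrow> 'a bop" where
  "D_op M x\<^sub>0 \<phi> = predual_map (tilde M \<phi>) (rank_one x\<^sub>0 x\<^sub>0)"

end

theory Submission
  imports Defs "HOL-Computational_Algebra.Formal_Power_Series"
begin

text \<open>
Injectivity rests on two facts about an extension \<open>\<Phi>\<close> of \<open>\<phi>\<close>. It is a bimodule map over the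
commutant, \<open>\<Phi>(A X B) = A \<Phi>(X) B\<close> for \<open>A, B\<close> in the commutant of \<open>M\<close> (\<open>tilde_bimodule\<close>), and the
orbit of \<open>x\<^sub>0\<close> under the commutant is dense, because \<open>x\<^sub>0\<close> separates \<open>M\<close>
(\<open>cyclic_for_commutant\<close>). So the value of \<open>\<Phi>\<close> at \<open>E\<^sub>0 = x\<^sub>0 \<boxtimes> x\<^sub>0\<close> determines its values at all
\<open>A E\<^sub>0 B = A x\<^sub>0 \<boxtimes> B* x\<^sub>0\<close>; tested against a trace class operator \<open>T\<close>, these are the values of the
sesquilinear form of \<open>\<Phi>\<^sub>*(T)\<close> on a dense set of vectors, and so \<open>\<Phi>\<close> is determined. Dually,
\<open>D\<^sub>\<phi>\<close> encodes the functional \<open>X \<mapsto> (\<Phi>(X) x\<^sub>0 | x\<^sub>0)\<close>, and inserting \<open>B* X A\<close> gives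
\<open>(\<Phi>(X) A x\<^sub>0 | B x\<^sub>0)\<close>, hence \<open>\<Phi>(X)\<close>.

For density it suffices to look at the maps \<open>B \<mapsto> \<Sum>\<^sub>i C\<^sub>i B D\<^sub>i\<close> with \<open>C\<^sub>i, D\<^sub>i\<close> in \<open>M\<close>. They send
\<open>E\<^sub>0\<close> to \<open>\<Sum>\<^sub>i C\<^sub>i x\<^sub>0 \<boxtimes> D\<^sub>i* x\<^sub>0\<close>, and their preduals send it to \<open>\<Sum>\<^sub>i D\<^sub>i x\<^sub>0 \<boxtimes> C\<^sub>i* x\<^sub>0\<close>
(\<open>elementary_map\<close>). As \<open>x\<^sub>0\<close> is cyclic for \<open>M\<close>, such sums approximate every trace class operator
in trace norm (\<open>finite_rank_approximation\<close>).

The extension \<open>\<Phi>\<close> is well defined because the products \<open>A' B\<close> span a \<open>\<sigma>\<close>-weakly dense subspace.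
In dual form: a trace class operator whose functional vanishes on a self-adjoint semigroup with
trivial commutant is zero (\<open>trace_vanishes_of_irreducible\<close>). The proof is von Neumann's
amplification argument in the Hilbert space of square-summable families.

Trace class operators are handled throughout by expansions \<open>T = \<Sum>\<^sub>i x\<^sub>i \<boxtimes> y\<^sub>i\<close> with square-summable
\<open>x\<close> and \<open>y\<close>. Such an expansion yields the trace as \<open>\<Sum>\<^sub>i (x\<^sub>i | y\<^sub>i)\<close>, independently of the
orthonormal basis, makes sums and products of operators trivial to treat, and bounds the trace norm
by \<open>\<Sum>\<^sub>i \<parallel>x\<^sub>i\<parallel> \<parallel>y\<^sub>i\<parallel>\<close>. Normality is exploited through the existence of a predual
(\<open>normal_map_iff_predual\<close>).
\<close>

section \<open>Riesz representation on a subspace\<close>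

lemma cinner_zero_left [simp]: "cinner 0 (x::'a::complex_hilbert) = 0"
  by (metis cinner_commute cinner_zero_right complex_cnj_zero)

lemma cinner_minus_left [simp]: "cinner (- x) (y::'a::complex_hilbert) = - cinner x y"
  by (metis add.left_inverse cinner_add_left cinner_zero_left minus_unique add.commute)

lemma cinner_minus_right [simp]: "cinner x (- y::'a::complex_hilbert) = - cinner x y"
  by (metis cinner_commute cinner_minus_left complex_cnj_minus)

lemma cinner_diff_left: "cinner (x - y) (z::'a::complex_hilbert) = cinner x z - cinner y z"
  using cinner_add_left[of x "- y" z] by simp

lemma cinner_diff_right: "cinner x (y - z::'a::complex_hilbert) = cinner x y - cinner x z"
  using cinner_add_right[of x y "- z"] by simp

lemma cinner_scaleR_left: "cinner (r *\<^sub>R x) (y::'a::complex_hilbert) = of_real r * cinner x y"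
  by (simp add: scaleR_scaleC cinner_scaleC_left)

lemma cinner_scaleR_right: "cinner x (r *\<^sub>R y::'a::complex_hilbert) = of_real r * cinner x y"
  by (simp add: scaleR_scaleC cinner_scaleC_right)

lemma cinner_sum_left: "cinner (\<Sum>i\<in>I. f i) (y::'a::complex_hilbert) = (\<Sum>i\<in>I. cinner (f i) y)"
  by (induction I rule: infinite_finite_induct) (simp_all add: cinner_add_left)

lemma cinner_eq_zero_iff [simp]: "cinner x x = 0 \<longleftrightarrow> x = (0::'a::complex_hilbert)"
  by (simp add: cinner_self)

lemma cinner_ext_left: "(\<And>y. cinner x y = cinner x' y) \<Longrightarrow> x = (x'::'a::complex_hilbert)"
  by (metis cinner_diff_left cinner_eq_zero_iff eq_iff_diff_eq_0)

lemma cinner_ext_right: "(\<And>x. cinner x y = cinner x y') \<Longrightarrow> y = (y'::'a::complex_hilbert)"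
  by (metis cinner_diff_right cinner_eq_zero_iff eq_iff_diff_eq_0)

lemma bounded_linear_cinner_left: "bounded_linear (\<lambda>x::'a::complex_hilbert. cinner x y)"
  by (rule bounded_linear_intro[where K = "norm y"])
    (simp_all add: cinner_add_left cinner_scaleR_left cinner_Cauchy_Schwarz scaleR_conv_of_real)

lemma bounded_linear_cinner_right: "bounded_linear (\<lambda>y::'a::complex_hilbert. cinner x y)"
  by (rule bounded_linear_intro[where K = "norm x"])
    (simp_all add: cinner_add_right cinner_scaleR_right scaleR_conv_of_real
      cinner_Cauchy_Schwarz[of x, unfolded mult.commute[of "norm x"]])

lemmas tendsto_cinner_left = bounded_linear.tendsto[OF bounded_linear_cinner_left]
lemmas tendsto_cinner_right = bounded_linear.tendsto[OF bounded_linear_cinner_right]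

lemma Re_cinner_commute: "Re (cinner x y) = Re (cinner y (x::'a::complex_hilbert))"
  by (subst cinner_commute) simp

lemma Re_cinner_self: "Re (cinner x x) = (norm (x::'a::complex_hilbert))\<^sup>2"
  by (simp add: cinner_self)

lemma norm_add_square:
  "(norm (x + y))\<^sup>2 = (norm x)\<^sup>2 + 2 * Re (cinner x y) + (norm (y::'a::complex_hilbert))\<^sup>2"
  unfolding Re_cinner_self[symmetric]
  by (simp add: cinner_add_left cinner_add_right Re_cinner_commute[of y x])

lemma norm_diff_square:
  "(norm (x - y))\<^sup>2 = (norm x)\<^sup>2 - 2 * Re (cinner x y) + (norm (y::'a::complex_hilbert))\<^sup>2"
  using norm_add_square[of x "- y"] by simp

lemma real_quadratic_le_imp_zero:
  fixes b c :: real
  assumes "\<And>t. t * b \<le> t\<^sup>2 * c"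
  shows "b = 0"
proof (rule ccontr)
  assume "b \<noteq> 0"
  define d where "d = \<bar>c\<bar> + 1"
  have d: "d > 0" by (simp add: d_def)
  have "b / d * b \<le> (b / d)\<^sup>2 * c" by (rule assms)
  also have "\<dots> < (b / d)\<^sup>2 * d"
    using \<open>b \<noteq> 0\<close> d by (intro mult_strict_left_mono) (auto simp: d_def)
  also have "\<dots> = b / d * b" using d by (simp add: power2_eq_square)
  finally show False by simp
qed

lemma cvs_subspace_closed:
  assumes "cvs.subspace L"
  shows "0 \<in> L" "x \<in> L \<Longrightarrow> y \<in> L \<Longrightarrow> x + y \<in> L" "x \<in> L \<Longrightarrow> c *\<^sub>C x \<in> L"
  using assms by (auto simp: cvs.subspace_def)

text \<open>The vector \<open>z\<close> is found as the limit of a maximizing sequence of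
\<open>l \<mapsto> 2 Re (g l) - \<parallel>l\<parallel>\<^sup>2 = \<parallel>z\<parallel>\<^sup>2 - \<parallel>l - z\<parallel>\<^sup>2\<close> on \<open>L\<close>; by the parallelogram identity such a sequence
is Cauchy. Since \<open>L\<close> need not be closed, the one statement yields adjoints (\<open>L\<close> the whole space),
orthogonal projections (\<open>g = (\<cdot>|x)\<close>) and left factorizations (\<open>L\<close> the range of an operator).\<close>

lemma riesz_on_subspace:
  fixes L :: "'a::complex_hilbert set" and g :: "'a \<Rightarrow> complex"
  assumes L: "cvs.subspace L"
    and add: "\<And>l k. l \<in> L \<Longrightarrow> k \<in> L \<Longrightarrow> g (l + k) = g l + g k"
    and scale: "\<And>c l. l \<in> L \<Longrightarrow> g (c *\<^sub>C l) = c * g l"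
    and bound: "\<And>l. l \<in> L \<Longrightarrow> cmod (g l) \<le> b * norm l"
  shows "\<exists>z\<in>closure L. norm z \<le> \<bar>b\<bar> \<and> (\<forall>l\<in>L. g l = cinner l z)"
proof -
  note L0 = cvs_subspace_closed[OF L]
  define q where "q l = 2 * Re (g l) - (norm l)\<^sup>2" for l
  have q_le: "q l \<le> b\<^sup>2" if "l \<in> L" for l
  proof -
    have "Re (g l) \<le> b * norm l"
      using bound[OF that] complex_Re_le_cmod[of "g l"] by linarith
    moreover have "0 \<le> (b - norm l)\<^sup>2" by simp
    ultimately show ?thesis by (simp add: q_def power2_diff)
  qed
  define m where "m = (SUP l\<in>L. q l)"
  have bdd: "bdd_above (q ` L)" using q_le by (auto intro!: bdd_aboveI)
  have q_m: "q l \<le> m" if "l \<in> L" for l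
    unfolding m_def by (rule cSUP_upper[OF that bdd])
  have "\<exists>l\<in>L. m - inverse (real (Suc n)) < q l" for n
    unfolding m_def by (rule less_cSUP_iff[THEN iffD1, OF _ bdd]) (use L0(1) in auto)
  then obtain l where lL: "\<And>n. l n \<in> L" and l: "\<And>n. m - inverse (real (Suc n)) < q (l n)"
    by metis
  \<comment> \<open>Evaluate \<open>q\<close> at the midpoint of \<open>x\<close> and \<open>y\<close> and use the parallelogram identity.\<close>
  have midpoint: "(norm (x - y))\<^sup>2 \<le> 2 * (m - q x) + 2 * (m - q y)" if x: "x \<in> L" and y: "y \<in> L" for x y
  proof -
    have half: "(1/2) *\<^sub>R (x + y) = (1/2::complex) *\<^sub>C (x + y)"
      by (simp add: scaleR_scaleC)
    have "(1/2) *\<^sub>R (x + y) \<in> L"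
      unfolding half by (intro L0 x y)
    then have "q ((1/2) *\<^sub>R (x + y)) \<le> m" by (rule q_m)
    moreover have "Re (g ((1/2) *\<^sub>R (x + y))) = (Re (g x) + Re (g y)) / 2"
      unfolding half using L0(2)[OF x y] by (simp add: scale add x y)
    moreover have "(norm ((1/2) *\<^sub>R (x + y)))\<^sup>2 = (norm (x + y))\<^sup>2 / 4"
      by (simp add: power_divide)
    moreover have "(norm (x + y))\<^sup>2 = 2 * (norm x)\<^sup>2 + 2 * (norm y)\<^sup>2 - (norm (x - y))\<^sup>2"
      by (simp add: norm_add_square norm_diff_square)
    ultimately show ?thesis by (simp add: q_def field_simps)
  qed
  have "Cauchy l"
  proof (rule metric_CauchyI)
    fix e :: real assume e: "e > 0"
    obtain N where N: "inverse (real (Suc N)) < e\<^sup>2 / 4"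
      using reals_Archimedean[of "e\<^sup>2 / 4"] e by auto
    have near: "m - e\<^sup>2 / 4 < q (l k)" if "k \<ge> N" for k
    proof -
      have "inverse (real (Suc k)) \<le> inverse (real (Suc N))"
        using that by (simp add: field_simps)
      with l[of k] N show ?thesis by linarith
    qed
    have "dist (l i) (l j) < e" if "i \<ge> N" "j \<ge> N" for i j
    proof (rule power2_less_imp_less)
      show "(dist (l i) (l j))\<^sup>2 < e\<^sup>2"
        unfolding dist_norm
        using midpoint[OF lL lL, of i j] near[OF that(1)] near[OF that(2)] by argo
    qed (use e in simp)
    then show "\<exists>N. \<forall>i\<ge>N. \<forall>j\<ge>N. dist (l i) (l j) < e" by blast
  qed
  then obtain z where z: "l \<longlonglongrightarrow> z"
    using Cauchy_convergent convergent_def by blast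
  have zL: "z \<in> closure L"
    using lL z closure_sequential by blast
  \<comment> \<open>First-order condition: \<open>t \<mapsto> q (z + t k)\<close> is maximal at \<open>t = 0\<close>, up to an error along the sequence.\<close>
  have re: "Re (g k) = Re (cinner k z)" if k: "k \<in> L" for k
  proof -
    have "t * (2 * (Re (g k) - Re (cinner k z))) \<le> t\<^sup>2 * (norm k)\<^sup>2" for t
    proof (rule tendsto_lowerbound[of "\<lambda>n. t\<^sup>2 * (norm k)\<^sup>2 + inverse (real (Suc n)) - 
          t * (2 * (Re (g k) - Re (cinner k (l n)))) + t * (2 * (Re (g k) - Re (cinner k z)))" _ sequentially])
      show "(\<lambda>n. t\<^sup>2 * (norm k)\<^sup>2 + inverse (real (Suc n)) - 
          t * (2 * (Re (g k) - Re (cinner k (l n)))) + t * (2 * (Re (g k) - Re (cinner k z))))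
          \<longlonglongrightarrow> t\<^sup>2 * (norm k)\<^sup>2"
        by (rule tendsto_eq_intros LIMSEQ_inverse_real_of_nat tendsto_cinner_right z refl)+ simp
      have "t * (2 * (Re (g k) - Re (cinner k (l n)))) \<le> t\<^sup>2 * (norm k)\<^sup>2 + inverse (real (Suc n))" for n
      proof -
        have tk: "of_real t *\<^sub>C k \<in> L" by (intro L0 k)
        have "q (l n + of_real t *\<^sub>C k) \<le> m"
          by (intro q_m L0(2) lL tk)
        moreover have "q (l n + of_real t *\<^sub>C k) = q (l n) + t * (2 * (Re (g k) - Re (cinner k (l n))))
            - t\<^sup>2 * (norm k)\<^sup>2"
          by (simp add: q_def add[OF lL tk] scale[OF k] norm_add_square cinner_scaleC_right
              norm_scaleC power_mult_distrib Re_cinner_commute[of "l n"] algebra_simps)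
        ultimately show ?thesis using l[of n] by linarith
      qed
      then show "\<forall>\<^sub>F n in sequentially. t * (2 * (Re (g k) - Re (cinner k z)))
        \<le> t\<^sup>2 * (norm k)\<^sup>2 + inverse (real (Suc n)) - t * (2 * (Re (g k) - Re (cinner k (l n))))
          + t * (2 * (Re (g k) - Re (cinner k z)))"
        by (intro always_eventually allI) (simp add: algebra_simps)
    qed simp
    from real_quadratic_le_imp_zero[OF this] show ?thesis by simp
  qed
  have eq: "g k = cinner k z" if k: "k \<in> L" for k
  proof (rule complex_eqI)
    \<comment> \<open>The imaginary part of \<open>g k\<close> is minus the real part of \<open>g (\<i> k)\<close>.\<close>
    have "Re (g (\<i> *\<^sub>C k)) = Re (cinner (\<i> *\<^sub>C k) z)" by (intro re L0 k)
    then show "Im (g k) = Im (cinner k z)" by (simp add: scale[OF k] cinner_scaleC_left)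
  qed (rule re[OF k])
  have "(\<lambda>n. cmod (cinner (l n) z)) \<longlonglongrightarrow> cmod (cinner z z)"
    by (intro tendsto_norm tendsto_cinner_left z)
  moreover have "(\<lambda>n. \<bar>b\<bar> * norm (l n)) \<longlonglongrightarrow> \<bar>b\<bar> * norm z"
    by (intro tendsto_intros z)
  moreover have "cmod (cinner (l n) z) \<le> \<bar>b\<bar> * norm (l n)" for n
  proof -
    have "b * norm (l n) \<le> \<bar>b\<bar> * norm (l n)" by (intro mult_right_mono) auto
    then show ?thesis using bound[OF lL, of n] by (simp add: eq[OF lL])
  qed
  ultimately have "cmod (cinner z z) \<le> \<bar>b\<bar> * norm z"
    by (intro LIMSEQ_le) auto
  then have "norm z * norm z \<le> \<bar>b\<bar> * norm z"
    by (simp add: cinner_self power2_eq_square norm_mult)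
  then have "norm z \<le> \<bar>b\<bar>" by (cases "norm z = 0") simp_all
  with zL eq show ?thesis by blast
qed

lemma orthogonal_closure:
  fixes z :: "'a::complex_hilbert"
  assumes "\<And>l. l \<in> L \<Longrightarrow> cinner l z = 0" and "x \<in> closure L"
  shows "cinner x z = 0"
proof -
  obtain l where l: "\<And>n. l n \<in> L" "l \<longlonglongrightarrow> x" using assms(2) closure_sequential by blast
  have "(\<lambda>n. cinner (l n) z) \<longlonglongrightarrow> cinner x z" by (intro tendsto_cinner_left l)
  then show ?thesis using assms(1)[OF l(1)] by (simp add: LIMSEQ_const_iff)
qed

lemma closure_cvs_subspace:
  fixes L :: "'a::complex_hilbert set"
  assumes "cvs.subspace L"
  shows "cvs.subspace (closure L)"
  unfolding cvs.subspace_def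
proof (intro conjI ballI allI)
  note L = cvs_subspace_closed[OF assms]
  show "0 \<in> closure L" using L(1) closure_subset by blast
  fix x assume "x \<in> closure L"
  then obtain l where l: "\<And>n. l n \<in> L" "l \<longlonglongrightarrow> x" using closure_sequential by blast
  {
    fix y assume "y \<in> closure L"
    then obtain k where k: "\<And>n. k n \<in> L" "k \<longlonglongrightarrow> y" using closure_sequential by blast
    show "x + y \<in> closure L"
      unfolding closure_sequential
      by (intro exI[of _ "\<lambda>n. l n + k n"] conjI allI tendsto_intros L l k)
  }
  fix c
  have "bounded_linear (\<lambda>x::'a. c *\<^sub>C x)"
    by (rule bounded_linear_intro[where K = "cmod c"])
      (simp_all add: scaleC_add_right scaleR_scaleC norm_scaleC mult.commute)
  then have "(\<lambda>n. c *\<^sub>C l n) \<longlonglongrightarrow> c *\<^sub>C x" using l(2) by (rule bounded_linear.tendsto)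
  then show "c *\<^sub>C x \<in> closure L"
    unfolding closure_sequential
    by (intro exI[of _ "\<lambda>n. c *\<^sub>C l n"] conjI allI L l)
qed

lemma eq_in_closureI:
  fixes u v :: "'a::complex_hilbert"
  assumes L: "cvs.subspace L" and u: "u \<in> closure L" and v: "v \<in> closure L"
    and eq: "\<And>l. l \<in> L \<Longrightarrow> cinner l u = cinner l v"
  shows "u = v"
proof -
  note cL = cvs_subspace_closed[OF closure_cvs_subspace[OF L]]
  have "u - v \<in> closure L"
    using cL(2)[OF u cL(3)[OF v, of "-1"]] by (simp add: cvs.scale_minus_left)
  moreover have "cinner l (u - v) = 0" if "l \<in> L" for l
    by (simp add: eq[OF that] cinner_diff_right)
  ultimately have "cinner (u - v) (u - v) = 0"
    by (rule orthogonal_closure[rotated])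
  then show ?thesis by simp
qed

section \<open>Adjoints, projections and left factorization\<close>

lemma bop_add [simp]: "bop_apply A (x + y) = bop_apply A x + bop_apply A y"
  and bop_scaleC [simp]: "bop_apply A (c *\<^sub>C x) = c *\<^sub>C bop_apply A x"
  using bop_apply[of A] by (auto simp: clinear_add clinear_scaleC)

lemma bop_bounded_linear: "bounded_linear (bop_apply A)"
  using bop_apply[of A] by auto

lemma bop_zero [simp]: "bop_apply A 0 = 0"
  and bop_diff [simp]: "bop_apply A (x - y) = bop_apply A x - bop_apply A y"
  and bop_scaleR [simp]: "bop_apply A (r *\<^sub>R x) = r *\<^sub>R bop_apply A x"
proof -
  interpret bounded_linear "bop_apply A" by (rule bop_bounded_linear)
  show "bop_apply A 0 = 0" by (rule zero)
  show "bop_apply A (x - y) = bop_apply A x - bop_apply A y" by (rule diff)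
  show "bop_apply A (r *\<^sub>R x) = r *\<^sub>R bop_apply A x" by (rule scaleR)
qed

lemma bop_bound:
  obtains c where "c > 0" "\<And>x. norm (bop_apply A x) \<le> c * norm x"
  using bounded_linear.pos_bounded[OF bop_bounded_linear[of A]] by (metis mult.commute)

lemma apply_zero_op [simp]: "bop_apply 0 x = 0"
  and apply_one_op [simp]: "bop_apply 1 x = x"
  and apply_add_op [simp]: "bop_apply (A + B) x = bop_apply A x + bop_apply B x"
  and apply_diff_op [simp]: "bop_apply (A - B) x = bop_apply A x - bop_apply B x"
  and apply_scaleC_op [simp]: "bop_apply (c *\<^sub>C A) x = c *\<^sub>C bop_apply A x"
  and apply_times_op [simp]: "bop_apply (A * B) x = bop_apply A (bop_apply B x)"
  by (transfer, simp)+

lemma apply_rank_one [simp]: "bop_apply (rank_one x y) z = cinner z y *\<^sub>C x"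
  by transfer simp

lemma apply_sum_op: "bop_apply (\<Sum>i\<in>I. f i) x = (\<Sum>i\<in>I. bop_apply (f i) x)"
  by (induction I rule: infinite_finite_induct) simp_all

lemma bop_construct:
  assumes "\<And>x y. f (x + y) = f x + f y" and "\<And>c x. f (c *\<^sub>C x) = c *\<^sub>C f x"
    and "\<And>x. norm (f x) \<le> b * norm x"
  obtains A where "bop_apply A = f"
proof -
  have "bounded_linear f"
    by (rule bounded_linear_intro[where K = b]) (simp_all add: assms scaleR_scaleC mult.commute[of _ b])
  moreover have "clinear f" by (rule clinearI) (fact assms)+
  ultimately have "bop_apply (Bop f) = f" by (intro Bop_inverse) auto
  then show thesis by (rule that)
qed

lemma bop_eqI_cinner:
  "(\<And>x y. cinner (bop_apply A x) y = cinner (bop_apply B x) y) \<Longrightarrow> A = B"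
  by (rule bop_eqI, rule cinner_ext_left)

text \<open>The closure of \<open>L\<close> contains only one representing vector, so that the vectors representing a
sesquilinear form depend linearly on the second argument.\<close>

lemma riesz_operator:
  fixes L :: "'a::complex_hilbert set" and g :: "'a \<Rightarrow> 'a \<Rightarrow> complex"
  assumes L: "cvs.subspace L"
    and add: "\<And>l k y. l \<in> L \<Longrightarrow> k \<in> L \<Longrightarrow> g (l + k) y = g l y + g k y"
    and scale: "\<And>c l y. l \<in> L \<Longrightarrow> g (c *\<^sub>C l) y = c * g l y"
    and add2: "\<And>l y z. l \<in> L \<Longrightarrow> g l (y + z) = g l y + g l z"
    and scale2: "\<And>c l y. l \<in> L \<Longrightarrow> g l (c *\<^sub>C y) = cnj c * g l y"
    and bound: "\<And>l y. l \<in> L \<Longrightarrow> cmod (g l y) \<le> b * norm l * norm y"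
  obtains Z where "\<And>l y. l \<in> L \<Longrightarrow> cinner l (bop_apply Z y) = g l y"
    "\<And>y. bop_apply Z y \<in> closure L" "\<And>y. norm (bop_apply Z y) \<le> \<bar>b\<bar> * norm y"
proof -
  have "\<exists>z\<in>closure L. norm z \<le> \<bar>b * norm y\<bar> \<and> (\<forall>l\<in>L. g l y = cinner l z)" for y
  proof (rule riesz_on_subspace[OF L])
    show "cmod (g l y) \<le> b * norm y * norm l" if "l \<in> L" for l
      using bound[OF that, of y] by (simp only: ac_simps)
  qed (simp_all add: add scale)
  then obtain z where z: "\<And>y. z y \<in> closure L" "\<And>y. norm (z y) \<le> \<bar>b\<bar> * norm y"
    "\<And>l y. l \<in> L \<Longrightarrow> g l y = cinner l (z y)"
    by (metis abs_mult abs_norm_cancel)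
  note cL = cvs_subspace_closed[OF closure_cvs_subspace[OF L]]
  note uniq = eq_in_closureI[OF L]
  obtain Z where Z: "bop_apply Z = z"
  proof (rule bop_construct[of z "\<bar>b\<bar>"])
    show "z (x + y) = z x + z y" for x y
      by (rule uniq) (simp_all add: z(1) cL cinner_add_right z(3)[symmetric] add2)
    show "z (c *\<^sub>C x) = c *\<^sub>C z x" for c x
      by (rule uniq) (simp_all add: z(1) cL cinner_scaleC_right z(3)[symmetric] scale2)
  qed (use z(2) in auto)
  show thesis by (rule that[of Z]) (simp_all add: Z z)
qed

lemma cvs_subspace_UNIV: "cvs.subspace UNIV"
  by (simp add: cvs.subspace_def)

lemma adj_eq: "cinner (bop_apply A x) y = cinner x (bop_apply (adj A) y)"
proof -
  obtain c where c: "c > 0" "\<And>x. norm (bop_apply A x) \<le> c * norm x" using bop_bound[of A] by blast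
  have "cmod (cinner (bop_apply A x) y) \<le> c * norm x * norm y" for x y
    using cinner_Cauchy_Schwarz[of "bop_apply A x" y] mult_right_mono[OF c(2) norm_ge_zero[of y], of x]
    by linarith
  note bnd = this
  obtain Z where Z: "\<And>x y. cinner x (bop_apply Z y) = cinner (bop_apply A x) y"
    by (rule riesz_operator[OF cvs_subspace_UNIV, of "\<lambda>x y. cinner (bop_apply A x) y" c])
      (use bnd in \<open>auto simp: cinner_add_left cinner_add_right cinner_scaleC_left cinner_scaleC_right\<close>)
  have "adj A = Z"
    unfolding adj_def
  proof (rule the_equality)
    fix B assume "\<forall>x y. cinner (bop_apply A x) y = cinner x (bop_apply B y)"
    then show "B = Z" by - (rule bop_eqI, rule cinner_ext_right, simp add: Z)
  qed (simp add: Z)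
  then show ?thesis by (simp add: Z)
qed

lemma adj_eq': "cinner (bop_apply (adj A) x) y = cinner x (bop_apply A y)"
  by (metis adj_eq cinner_commute)

lemma adj_unique:
  assumes "\<And>x y. cinner (bop_apply A x) y = cinner x (bop_apply B y)"
  shows "adj A = B"
  by (rule bop_eqI, rule cinner_ext_right) (metis adj_eq assms)

lemma adj_adj [simp]: "adj (adj A) = A"
  by (rule adj_unique) (rule adj_eq')

lemma adj_times: "adj (A * B) = adj B * adj A"
  by (rule adj_unique) (simp add: adj_eq)

lemma adj_bound:
  assumes "\<And>x. norm (bop_apply A x) \<le> c * norm x"
  shows "norm (bop_apply (adj A) x) \<le> c * norm x"
proof -
  let ?y = "bop_apply (adj A) x"
  have "(norm ?y)\<^sup>2 = cmod (cinner (bop_apply A ?y) x)"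
    by (simp add: adj_eq cinner_self del: of_real_power)
  also have "\<dots> \<le> (c * norm ?y) * norm x"
    by (rule order_trans[OF cinner_Cauchy_Schwarz mult_right_mono[OF assms norm_ge_zero]])
  finally have "norm ?y * norm ?y \<le> (c * norm x) * norm ?y" by (simp add: power2_eq_square ac_simps)
  moreover have "0 \<le> c * norm x" using assms[of x] norm_ge_zero[of "bop_apply A x"] by linarith
  ultimately show ?thesis by (cases "norm ?y = 0") simp_all
qed

text \<open>The projection commutes with every \<open>A\<close> for which \<open>L\<close> is reducing: \<open>P A x\<close> and \<open>A P x\<close> lie in the
closure of \<open>L\<close> and have the same inner products with \<open>L\<close>. This puts projections onto invariant
subspaces into commutants.\<close>

lemma orthogonal_projection:
  fixes L :: "'a::complex_hilbert set"
  assumes L: "cvs.subspace L"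
  obtains P where "\<And>x. bop_apply P x \<in> closure L" "\<And>x. x \<in> closure L \<Longrightarrow> bop_apply P x = x"
    "\<And>l x. l \<in> L \<Longrightarrow> cinner l (bop_apply P x) = cinner l x"
    "\<And>A. (\<And>l. l \<in> L \<Longrightarrow> bop_apply A l \<in> L) \<Longrightarrow> (\<And>l. l \<in> L \<Longrightarrow> bop_apply (adj A) l \<in> L) \<Longrightarrow> P * A = A * P"
proof -
  obtain P where P: "\<And>l y. l \<in> L \<Longrightarrow> cinner l (bop_apply P y) = cinner l y"
    "\<And>y. bop_apply P y \<in> closure L"
    by (rule riesz_operator[OF L, of cinner 1])
      (auto simp: cinner_add_left cinner_add_right cinner_scaleC_left cinner_scaleC_right cinner_Cauchy_Schwarz)
  note cL = cvs_subspace_closed[OF closure_cvs_subspace[OF L]]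
  note uniq = eq_in_closureI[OF L]
  have fix_cl: "bop_apply P x = x" if "x \<in> closure L" for x
    by (rule uniq) (simp_all add: P that)
  have "P * A = A * P" if A: "\<And>l. l \<in> L \<Longrightarrow> bop_apply A l \<in> L" "\<And>l. l \<in> L \<Longrightarrow> bop_apply (adj A) l \<in> L" for A
  proof (rule bop_eqI)
    fix x
    have "bop_apply A ` closure L \<subseteq> closure L"
      by (rule image_closure_subset)
        (use A closure_subset in \<open>auto intro: bounded_linear.continuous_on[OF bop_bounded_linear]\<close>)
    then have [simp]: "bop_apply A (bop_apply P x) \<in> closure L" using P(2) by blast
    show "bop_apply (P * A) x = bop_apply (A * P) x"
    proof (rule uniq[rotated 2])
      fix l assume l: "l \<in> L"
      have "cinner l (bop_apply A (bop_apply P x)) = cinner (bop_apply (adj A) l) (bop_apply P x)"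
        by (simp add: adj_eq')
      also have "\<dots> = cinner l (bop_apply A x)"
        by (subst P(1)[OF A(2)[OF l]]) (rule adj_eq')
      finally show "cinner l (bop_apply (P * A) x) = cinner l (bop_apply (A * P) x)"
        by (simp add: P(1) l)
    qed (simp_all add: P)
  qed
  with P fix_cl show thesis by (intro that) auto
qed

text \<open>Douglas' lemma: the assignment \<open>A x \<mapsto> B x\<close> is well defined and contractive on the range of \<open>A\<close>, and
Riesz representation on that range extends it (in the form of its adjoint) to the whole space.\<close>

lemma douglas_factorization:
  fixes A B :: "'a::complex_hilbert bop"
  assumes "\<And>x. norm (bop_apply B x) \<le> norm (bop_apply A x)"
  obtains V where "V * A = B" "\<And>x. norm (bop_apply V x) \<le> norm x"
proof -
  \<comment> \<open>Any choice of preimages works: \<open>B\<close> does not separate points that \<open>A\<close> identifies.\<close>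
  define s where "s l = (SOME x. bop_apply A x = l)" for l
  have s: "bop_apply A (s (bop_apply A x)) = bop_apply A x" for x
    unfolding s_def by (rule someI) (rule refl)
  define h where "h l = bop_apply B (s l)" for l
  have h: "h (bop_apply A x) = bop_apply B x" for x
  proof -
    have "norm (bop_apply B (s (bop_apply A x) - x)) \<le> norm (bop_apply A (s (bop_apply A x) - x))"
      by (rule assms)
    then show ?thesis by (simp add: s h_def)
  qed
  have L: "cvs.subspace (range (bop_apply A))"
    unfolding cvs.subspace_def by (metis (no_types, lifting) bop_add bop_scaleC bop_zero rangeE rangeI)
  obtain Z where Z: "\<And>l y. l \<in> range (bop_apply A) \<Longrightarrow> cinner l (bop_apply Z y) = cinner (h l) y"
    "\<And>y. norm (bop_apply Z y) \<le> \<bar>1\<bar> * norm y"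
  proof (rule riesz_operator[OF L, of "\<lambda>l y. cinner (h l) y" 1])
    show "cinner (h (l + k)) y = cinner (h l) y + cinner (h k) y"
      if "l \<in> range (bop_apply A)" "k \<in> range (bop_apply A)" for l k y
      using that by (auto simp: bop_add[symmetric] h cinner_add_left simp del: bop_add) (simp add: cinner_add_left)
    show "cinner (h (c *\<^sub>C l)) y = c * cinner (h l) y" if "l \<in> range (bop_apply A)" for c l y
      using that by (auto simp: bop_scaleC[symmetric] h simp del: bop_scaleC) (simp add: cinner_scaleC_left)
    show "cmod (cinner (h l) y) \<le> 1 * norm l * norm y" if "l \<in> range (bop_apply A)" for l y
      using that assms by (auto simp: h intro!: order_trans[OF cinner_Cauchy_Schwarz] mult_right_mono)
  qed (auto simp: cinner_add_right cinner_scaleC_right)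
  have "adj Z * A = B"
    by (rule bop_eqI_cinner) (simp add: adj_eq' Z(1) h)
  moreover have "norm (bop_apply (adj Z) x) \<le> norm x" for x
    using adj_bound[of Z 1 x] Z(2) by simp
  ultimately show thesis by (rule that)
qed

section \<open>Square roots and absolute values of operators\<close>

lemma positive_op_iff:
  "positive_op A \<longleftrightarrow> (\<forall>x. Re (cinner (bop_apply A x) x) \<ge> 0 \<and> Im (cinner (bop_apply A x) x) = 0)"
  by (auto simp: positive_op_def complex_nonneg_Reals_iff)

lemma positive_op_self_adjoint:
  assumes "positive_op A"
  shows "cinner (bop_apply A x) y = cinner x (bop_apply A y)"
proof -
  have im: "Im (cinner (bop_apply A z) z) = 0" for z
    using assms by (simp add: positive_op_iff)
  have "cinner (bop_apply A x) y = cnj (cinner (bop_apply A y) x)"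
  proof (rule complex_eqI)
    show "Re (cinner (bop_apply A x) y) = Re (cnj (cinner (bop_apply A y) x))"
      using im[of "x + \<i> *\<^sub>C y"] im[of x] im[of y]
      by (simp add: cinner_add_left cinner_add_right cinner_scaleC_left cinner_scaleC_right)
    show "Im (cinner (bop_apply A x) y) = Im (cnj (cinner (bop_apply A y) x))"
      using im[of "x + y"] im[of x] im[of y]
      by (simp add: cinner_add_left cinner_add_right)
  qed
  then show ?thesis by (metis cinner_commute)
qed

lemma positive_op_adj: "positive_op A \<Longrightarrow> adj A = A"
  by (rule adj_unique) (rule positive_op_self_adjoint)

text \<open>For \<open>c = 1\<close> this says \<open>A\<^sup>2 \<le> A\<close> when \<open>0 \<le> A \<le> 1\<close>. It follows by testing positivity of \<open>A\<close> on the
vector \<open>x - A x / c\<close>.\<close>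

lemma positive_op_norm_square_le:
  assumes A: "positive_op A" and c: "c > 0" and bound: "\<And>x. norm (bop_apply A x) \<le> c * norm x"
  shows "(norm (bop_apply A x))\<^sup>2 \<le> c * Re (cinner (bop_apply A x) x)"
proof -
  let ?y = "bop_apply A x"
  define t where "t = 1 / c"
  have sa: "cinner (bop_apply A ?y) x = cinner ?y ?y"
    by (rule positive_op_self_adjoint[OF A])
  have "0 \<le> Re (cinner (bop_apply A (x - of_real t *\<^sub>C ?y)) (x - of_real t *\<^sub>C ?y))"
    using A unfolding positive_op_iff by blast
  also have "\<dots> = Re (cinner ?y x) - 2 * t * (norm ?y)\<^sup>2 + t\<^sup>2 * Re (cinner (bop_apply A ?y) ?y)"
    by (simp add: cinner_diff_left cinner_diff_right cinner_scaleC_left cinner_scaleC_right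
        sa Re_cinner_self power2_eq_square algebra_simps)
  also have "Re (cinner (bop_apply A ?y) ?y) \<le> c * norm ?y * norm ?y"
    using complex_Re_le_cmod cinner_Cauchy_Schwarz mult_right_mono[OF bound norm_ge_zero]
    by (meson order_trans)
  finally have "0 \<le> Re (cinner ?y x) - 2 * t * (norm ?y)\<^sup>2 + t\<^sup>2 * (c * norm ?y * norm ?y)"
    by (simp add: mult_left_mono)
  also have "t\<^sup>2 * (c * norm ?y * norm ?y) = t * (norm ?y)\<^sup>2"
    using c by (simp add: t_def power2_eq_square)
  finally show ?thesis using c by (simp add: t_def field_simps)
qed

lemma bop_infsum:
  assumes "f summable_on I"
  shows "(\<Sum>\<^sub>\<infinity>i\<in>I. bop_apply A (f i)) = bop_apply A (\<Sum>\<^sub>\<infinity>i\<in>I. f i)"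
  using has_sum_bounded_linear[OF bop_bounded_linear has_sum_infsum[OF assms]] by (rule infsumI)

text \<open>The coefficients of the binomial series \<open>sqrt (1 - t) = \<Sum>\<^sub>n sqrt_coeff n t\<^sup>n\<close>. All but the first are
nonpositive and the partial sums at \<open>t = 1\<close> stay nonnegative, so that the series converges absolutely
for contractions.\<close>

definition sqrt_coeff :: "nat \<Rightarrow> real" where
  "sqrt_coeff n = (-1) ^ n * ((1/2) gchoose n)"

lemma sqrt_coeff_0: "sqrt_coeff 0 = 1"
  by (simp add: sqrt_coeff_def)

lemma sqrt_coeff_partial_sums:
  "(\<Sum>k\<le>n. sqrt_coeff k) \<ge> 0" "sqrt_coeff (Suc n) \<le> 0"
proof -
  \<comment> \<open>\<open>b\<close> collects the coefficients of \<open>(1 - t) powr (-1/2)\<close>; they are the partial sums at \<open>t = 1\<close>.\<close>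
  define b :: "nat \<Rightarrow> real" where "b n = (-1) ^ n * ((-1/2) gchoose n)" for n
  have S: "(\<Sum>k\<le>n. sqrt_coeff k) = b n" for n
    using gbinomial_sum_lower_neg[of "1/2::real" n] by (simp add: sqrt_coeff_def b_def mult.commute)
  have rec: "b (Suc n) = (1/2 + real n) / (real n + 1) * b n" for n
  proof -
    have "(real n + 1) * ((-1/2) gchoose Suc n) = - (1/2 + real n) * ((-1/2) gchoose n)"
      using gbinomial_mult_1[of "-1/2::real" n] by (simp add: algebra_simps)
    note absorb = this
    have "(real n + 1) * b (Suc n) = - ((-1) ^ n) * ((real n + 1) * ((-1/2) gchoose Suc n))"
      by (simp add: b_def)
    also have "\<dots> = (1/2 + real n) * b n"
      unfolding absorb by (simp add: b_def algebra_simps)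
    finally show ?thesis by (simp add: field_simps)
  qed
  have pos: "b n \<ge> 0" for n
    by (induction n) (simp_all add: rec, simp add: b_def)
  show "(\<Sum>k\<le>n. sqrt_coeff k) \<ge> 0" by (simp add: S pos)
  have "sqrt_coeff (Suc n) = b (Suc n) - b n"
    using S[of "Suc n"] S[of n] by simp
  also have "\<dots> = - (1/2) / (real n + 1) * b n"
    by (simp add: rec field_simps)
  also have "\<dots> \<le> 0" using pos[of n] by (simp add: field_simps)
  finally show "sqrt_coeff (Suc n) \<le> 0" .
qed

lemma sqrt_coeff_abs_sum: "(\<Sum>k\<le>n. \<bar>sqrt_coeff k\<bar>) \<le> 2"
proof -
  have "(\<Sum>k\<le>n. \<bar>sqrt_coeff k\<bar>) = 2 - (\<Sum>k\<le>n. sqrt_coeff k)"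
    by (induction n) (use sqrt_coeff_partial_sums(2) in \<open>auto simp: sqrt_coeff_0\<close>)
  then show ?thesis using sqrt_coeff_partial_sums(1)[of n] by linarith
qed

lemma sqrt_coeff_abs_summable: "(\<lambda>n. \<bar>sqrt_coeff n\<bar>) summable_on UNIV"
proof -
  have "(\<Sum>k\<in>F. \<bar>sqrt_coeff k\<bar>) \<le> 2" if F: "finite F" for F
  proof -
    obtain n where "F \<subseteq> {..n}" using finite_nat_set_iff_bounded_le[THEN iffD1, OF F] by auto
    then have "(\<Sum>k\<in>F. \<bar>sqrt_coeff k\<bar>) \<le> (\<Sum>k\<le>n. \<bar>sqrt_coeff k\<bar>)"
      by (intro sum_mono2) auto
    then show ?thesis using sqrt_coeff_abs_sum[of n] by linarith
  qed
  then show ?thesis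
    by (intro nonneg_bdd_above_summable_on bdd_aboveI[where M = 2]) auto
qed

lemma sqrt_coeff_sum_nonneg: "(\<Sum>\<^sub>\<infinity>n. sqrt_coeff n) \<ge> 0"
proof -
  have "sqrt_coeff summable_on UNIV"
    by (rule abs_summable_summable) (simp add: sqrt_coeff_abs_summable)
  then have "sqrt_coeff sums (\<Sum>\<^sub>\<infinity>n. sqrt_coeff n)"
    by (intro has_sum_imp_sums has_sum_infsum)
  then have "(\<lambda>n. \<Sum>k\<le>n. sqrt_coeff k) \<longlonglongrightarrow> (\<Sum>\<^sub>\<infinity>n. sqrt_coeff n)"
    by (simp add: sums_def_le)
  then show ?thesis
    by (rule LIMSEQ_le_const) (use sqrt_coeff_partial_sums(1) in auto)
qed

lemma sqrt_coeff_convolution: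
  "(\<Sum>i\<le>k. sqrt_coeff i * sqrt_coeff (k - i)) = (if k = 0 then 1 else if k = 1 then -1 else 0)"
proof -
  have "(\<Sum>i\<le>k. sqrt_coeff i * sqrt_coeff (k - i))
      = (\<Sum>i\<in>{0..k}. (-1) ^ k * (((1/2) gchoose i) * ((1/2) gchoose (k - i))))"
    unfolding atMost_atLeast0
  proof (rule sum.cong)
    fix i assume "i \<in> {0..k}"
    then have sign: "(-1::real) ^ k = (-1) ^ i * (-1) ^ (k - i)"
      by (simp add: power_add[symmetric])
    show "sqrt_coeff i * sqrt_coeff (k - i) = (-1) ^ k * (((1/2) gchoose i) * ((1/2) gchoose (k - i)))"
      unfolding sqrt_coeff_def sign by (simp only: ac_simps)
  qed simp
  also have "\<dots> = (-1) ^ k * (1 gchoose k)"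
    by (simp add: sum_distrib_left[symmetric] gbinomial_Vandermonde)
  also have "(1::real) gchoose k = of_nat (1 choose k)"
    by (metis binomial_gbinomial of_nat_1)
  also have "(-1) ^ k * real (1 choose k) = (if k = 0 then 1 else if k = 1 then -1 else 0)"
    by (cases k) (auto simp: binomial_eq_0)
  finally show ?thesis .
qed

lemma bop_power_contraction:
  assumes "\<And>x. norm (bop_apply B x) \<le> norm x"
  shows "norm (bop_apply (B ^ n) x) \<le> norm x"
proof (induction n)
  case (Suc n)
  then show ?case using assms[of "bop_apply (B ^ n) x"] by simp
qed simp

lemma bop_power_self_adjoint:
  assumes "\<And>x y. cinner (bop_apply B x) y = cinner x (bop_apply B y)"
  shows "cinner (bop_apply (B ^ n) x) y = cinner x (bop_apply (B ^ n) y)"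
proof (induction n arbitrary: y)
  case (Suc n)
  have "bop_apply (B ^ Suc n) y = bop_apply (B ^ n) (bop_apply B y)"
    by (simp only: power_Suc2 apply_times_op)
  then show ?case by (simp add: assms Suc)
qed simp

text \<open>Substituting \<open>B\<close> into the binomial series gives \<open>R\<close>. It is positive since
\<open>Re (B\<^sup>n x | x) \<le> \<parallel>x\<parallel>\<^sup>2\<close>, the coefficients after the first are nonpositive, and their total
sum is nonnegative. It squares to \<open>1 - B\<close> by Vandermonde's convolution.\<close>

lemma sqrt_one_minus_contraction:
  fixes B :: "'a::complex_hilbert bop"
  assumes contr: "\<And>x. norm (bop_apply B x) \<le> norm x"
    and sa: "\<And>x y. cinner (bop_apply B x) y = cinner x (bop_apply B y)"
  obtains R where "positive_op R" "R * R = 1 - B" "\<And>C. C * B = B * C \<Longrightarrow> C * R = R * C"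
proof -
  define f where "f x n = sqrt_coeff n *\<^sub>R bop_apply (B ^ n) x" for x n
  have nf: "norm (f x n) \<le> \<bar>sqrt_coeff n\<bar> * norm x" for x n
    unfolding f_def by (simp add: mult_left_mono bop_power_contraction contr)
  have sb: "(\<lambda>n. \<bar>sqrt_coeff n\<bar> * norm x) summable_on UNIV" for x :: 'a
    by (intro summable_on_cmult_left sqrt_coeff_abs_summable)
  have abs: "(\<lambda>n. norm (f x n)) summable_on UNIV" for x
    by (rule summable_on_comparison_test[OF sb[of x]]) (auto simp: nf)
  have summ: "f x summable_on UNIV" for x
    by (rule abs_summable_summable[OF abs])
  obtain R where R: "bop_apply R = (\<lambda>x. \<Sum>\<^sub>\<infinity>n. f x n)"
  proof (rule bop_construct[of "\<lambda>x. \<Sum>\<^sub>\<infinity>n. f x n" "\<Sum>\<^sub>\<infinity>n. \<bar>sqrt_coeff n\<bar>"])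
    show "(\<Sum>\<^sub>\<infinity>n. f (x + y) n) = (\<Sum>\<^sub>\<infinity>n. f x n) + (\<Sum>\<^sub>\<infinity>n. f y n)" for x y
    proof -
      have "f (x + y) = (\<lambda>n. f x n + f y n)"
        by (simp add: f_def fun_eq_iff scaleR_add_right)
      then show ?thesis by (simp add: infsum_add summ)
    qed
    show "(\<Sum>\<^sub>\<infinity>n. f (c *\<^sub>C x) n) = c *\<^sub>C (\<Sum>\<^sub>\<infinity>n. f x n)" for c x
    proof -
      have "(\<Sum>\<^sub>\<infinity>n. bop_apply (c *\<^sub>C 1) (f x n)) = bop_apply (c *\<^sub>C 1) (\<Sum>\<^sub>\<infinity>n. f x n)"
        by (rule bop_infsum[OF summ])
      then show ?thesis by (simp add: f_def scaleR_scaleC mult.commute)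
    qed
    show "norm (\<Sum>\<^sub>\<infinity>n. f x n) \<le> (\<Sum>\<^sub>\<infinity>n. \<bar>sqrt_coeff n\<bar>) * norm x" for x
    proof -
      have "norm (\<Sum>\<^sub>\<infinity>n. f x n) \<le> (\<Sum>\<^sub>\<infinity>n. norm (f x n))"
        by (rule norm_infsum_bound[OF abs])
      also have "\<dots> \<le> (\<Sum>\<^sub>\<infinity>n. \<bar>sqrt_coeff n\<bar> * norm x)"
        by (rule infsum_mono[OF abs sb nf])
      finally show ?thesis by (simp add: infsum_cmult_left')
    qed
  qed blast
  have "positive_op R"
    unfolding positive_op_iff
  proof (intro allI conjI)
    fix x
    have hs: "((\<lambda>n. cinner (f x n) x) has_sum cinner (bop_apply R x) x) UNIV"
      unfolding R by (rule has_sum_bounded_linear[OF bounded_linear_cinner_left has_sum_infsum[OF summ]])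
    have "(\<lambda>n. Im (cinner (f x n) x)) = (\<lambda>n. 0)"
    proof
      fix n
      have "cinner (bop_apply (B ^ n) x) x = cnj (cinner (bop_apply (B ^ n) x) x)"
        by (metis bop_power_self_adjoint[OF sa] cinner_commute)
      then have "Im (cinner (bop_apply (B ^ n) x) x) = 0" by (simp add: complex_eq_iff)
      then show "Im (cinner (f x n) x) = 0" by (simp add: f_def cinner_scaleR_left)
    qed
    with has_sum_Im[OF hs] show "Im (cinner (bop_apply R x) x) = 0"
      by (metis has_sum_0 has_sum_unique)
    have "sqrt_coeff summable_on UNIV"
      by (rule abs_summable_summable) (simp add: sqrt_coeff_abs_summable)
    then have sm: "((\<lambda>n. sqrt_coeff n * (norm x)\<^sup>2) has_sum (\<Sum>\<^sub>\<infinity>n. sqrt_coeff n) * (norm x)\<^sup>2) UNIV"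
      by (intro has_sum_cmult_left has_sum_infsum)
    have le: "sqrt_coeff n * (norm x)\<^sup>2 \<le> Re (cinner (f x n) x)" for n
    proof (cases n)
      case 0
      then show ?thesis by (simp add: f_def sqrt_coeff_0 Re_cinner_self)
    next
      case (Suc k)
      have "Re (cinner (bop_apply (B ^ n) x) x) \<le> norm (bop_apply (B ^ n) x) * norm x"
        using complex_Re_le_cmod cinner_Cauchy_Schwarz by (rule order_trans)
      also have "\<dots> \<le> (norm x)\<^sup>2"
        unfolding power2_eq_square by (intro mult_right_mono bop_power_contraction contr) simp
      finally have "sqrt_coeff n * (norm x)\<^sup>2 \<le> sqrt_coeff n * Re (cinner (bop_apply (B ^ n) x) x)"
        using sqrt_coeff_partial_sums(2)[of k] Suc by (intro mult_left_mono_neg) auto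
      then show ?thesis by (simp add: f_def cinner_scaleR_left)
    qed
    have "(\<Sum>\<^sub>\<infinity>n. sqrt_coeff n) * (norm x)\<^sup>2 \<le> Re (cinner (bop_apply R x) x)"
      by (rule has_sum_mono[OF sm has_sum_Re[OF hs] le])
    then show "0 \<le> Re (cinner (bop_apply R x) x)"
      using mult_nonneg_nonneg[OF sqrt_coeff_sum_nonneg, of "(norm x)\<^sup>2"] by simp
  qed
  moreover have "R * R = 1 - B"
  proof (rule bop_eqI)
    fix x
    \<comment> \<open>The double series is summed row by row to give \<open>R (R x)\<close>, and along the antidiagonals \<open>m + n = k\<close> to give \<open>1 - B\<close>.\<close>
    define g where "g = (\<lambda>(m, n). (sqrt_coeff m * sqrt_coeff n) *\<^sub>R bop_apply (B ^ (m + n)) x)"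
    have gb: "norm (g p) \<le> (\<bar>sqrt_coeff (fst p)\<bar> * norm x) * \<bar>sqrt_coeff (snd p)\<bar>" for p
      by (cases p) (use mult_left_mono[OF bop_power_contraction[OF contr], of "\<bar>sqrt_coeff (fst p)\<bar> * \<bar>sqrt_coeff (snd p)\<bar>"]
          in \<open>simp add: g_def abs_mult ac_simps\<close>)
    have "(\<lambda>p. norm ((\<lambda>(m, n). (\<bar>sqrt_coeff m\<bar> * norm x) * \<bar>sqrt_coeff n\<bar>) p)) summable_on UNIV \<times> UNIV"
      unfolding Infinite_Sum.abs_summable_on_Sigma_iff
      using sb[of x] sqrt_coeff_abs_summable
      by (auto simp: abs_mult infsum_cmult_right' mult.assoc
          intro!: summable_on_cmult_left summable_on_cmult_right)
    then have "(\<lambda>p. norm (g p)) summable_on UNIV \<times> UNIV"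
      by (rule Infinite_Sum.abs_summable_on_comparison_test) (use gb in \<open>auto simp: abs_mult split: prod.splits\<close>)
    then have gs: "g summable_on UNIV \<times> UNIV" by (rule abs_summable_summable)
    have "bop_apply R (bop_apply R x) = (\<Sum>\<^sub>\<infinity>m. \<Sum>\<^sub>\<infinity>n. g (m, n))"
    proof -
      have "f (bop_apply R x) m = (\<Sum>\<^sub>\<infinity>n. g (m, n))" for m
      proof -
        have "(\<Sum>\<^sub>\<infinity>n. bop_apply (of_real (sqrt_coeff m) *\<^sub>C B ^ m) (f x n))
            = bop_apply (of_real (sqrt_coeff m) *\<^sub>C B ^ m) (\<Sum>\<^sub>\<infinity>n. f x n)"
          by (rule bop_infsum[OF summ])
        also have "(\<lambda>n. bop_apply (of_real (sqrt_coeff m) *\<^sub>C B ^ m) (f x n)) = (\<lambda>n. g (m, n))"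
          by (rule ext) (simp add: f_def g_def power_add scaleR_scaleC)
        finally show ?thesis
          unfolding R f_def[of "infsum (f x) UNIV"] by (simp add: scaleR_scaleC)
      qed
      then show ?thesis by (subst R) (rule infsum_cong, simp)
    qed
    also have "\<dots> = infsum g (UNIV \<times> UNIV)"
      using infsum_Sigma'_banach[of "\<lambda>m n. g (m, n)" UNIV "\<lambda>_. UNIV"] gs by simp
    also have "\<dots> = infsum (\<lambda>(k, m). g (m, k - m)) (SIGMA k:UNIV. {..k})"
      by (rule infsum_reindex_bij_witness[of _ "\<lambda>(k, m). (m, k - m)" "\<lambda>(m, n). (m + n, m)"]) auto
    also have "\<dots> = (\<Sum>\<^sub>\<infinity>k. \<Sum>\<^sub>\<infinity>m\<in>{..k}. g (m, k - m))"
    proof (rule infsum_Sigma'_banach[symmetric])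
      show "(\<lambda>(k, m). g (m, k - m)) summable_on (SIGMA k:UNIV. {..k})"
        by (rule summable_on_reindex_bij_witness[THEN iffD1, OF _ _ _ _ _ gs,
              of "\<lambda>(k, m). (m, k - m)" "\<lambda>(m, n). (m + n, m)"]) auto
    qed
    also have "\<dots> = (\<Sum>\<^sub>\<infinity>k. (if k = 0 then 1 else if k = 1 then -1 else 0) *\<^sub>R bop_apply (B ^ k) x)"
    proof (rule infsum_cong)
      fix k
      have "(\<Sum>\<^sub>\<infinity>m\<in>{..k}. g (m, k - m)) = (\<Sum>m\<le>k. (sqrt_coeff m * sqrt_coeff (k - m)) *\<^sub>R bop_apply (B ^ k) x)"
        by (simp add: g_def)
      then show "(\<Sum>\<^sub>\<infinity>m\<in>{..k}. g (m, k - m)) = (if k = 0 then 1 else if k = 1 then -1 else 0) *\<^sub>R bop_apply (B ^ k) x"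
        by (simp only: scaleR_left.sum[symmetric] sqrt_coeff_convolution)
    qed
    also have "\<dots> = (\<Sum>\<^sub>\<infinity>k\<in>{0, 1::nat}. (if k = 0 then 1 else if k = 1 then -1 else 0) *\<^sub>R bop_apply (B ^ k) x)"
      by (rule infsum_cong_neutral) auto
    also have "\<dots> = x - bop_apply B x" by simp
    finally show "bop_apply (R * R) x = bop_apply (1 - B) x" by simp
  qed
  moreover have "C * R = R * C" if C: "C * B = B * C" for C
  proof (rule bop_eqI)
    fix x
    have "bop_apply C (bop_apply (B ^ n) x) = bop_apply (B ^ n) (bop_apply C x)" for n
      using power_commuting_commutes[OF C[symmetric], of n] by (metis apply_times_op)
    then have "(\<lambda>n. bop_apply C (f x n)) = f (bop_apply C x)"
      by (simp add: f_def fun_eq_iff)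
    moreover have "(\<Sum>\<^sub>\<infinity>n. bop_apply C (f x n)) = bop_apply C (\<Sum>\<^sub>\<infinity>n. f x n)"
      by (rule bop_infsum[OF summ])
    ultimately show "bop_apply (C * R) x = bop_apply (R * C) x" by (simp add: R)
  qed
  ultimately show thesis by (rule that)
qed

text \<open>After scaling so that \<open>0 \<le> A \<le> 1\<close>, the operator \<open>1 - A\<close> is a self-adjoint contraction.\<close>

lemma positive_sqrt_exists:
  assumes A: "positive_op A"
  obtains P where "positive_op P" "P * P = A" "\<And>C. C * A = A * C \<Longrightarrow> C * P = P * C"
proof -
  obtain c where c: "c > 0" "\<And>x. norm (bop_apply A x) \<le> c * norm x"
    using bop_bound[of A] by blast
  define B where "B = 1 - of_real (1 / c) *\<^sub>C A"
  have Bx: "bop_apply B x = x - (1 / c) *\<^sub>R bop_apply A x" for x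
    by (simp add: B_def scaleR_scaleC)
  have contr: "norm (bop_apply B x) \<le> norm x" for x
  proof (rule power2_le_imp_le)
    have "(norm (bop_apply B x))\<^sup>2 = (norm x)\<^sup>2 - 2 / c * Re (cinner (bop_apply A x) x)
        + (1 / c)\<^sup>2 * (norm (bop_apply A x))\<^sup>2"
      unfolding Bx norm_diff_square
      by (simp add: cinner_scaleR_right Re_cinner_commute[of x] power_mult_distrib power_divide)
    also have "(1 / c)\<^sup>2 * (norm (bop_apply A x))\<^sup>2 \<le> (1 / c)\<^sup>2 * (c * Re (cinner (bop_apply A x) x))"
      by (intro mult_left_mono positive_op_norm_square_le A c) simp
    also have "\<dots> = 1 / c * Re (cinner (bop_apply A x) x)"
      using c(1) by (simp add: power2_eq_square)
    finally have "(norm (bop_apply B x))\<^sup>2 \<le> (norm x)\<^sup>2 - 1 / c * Re (cinner (bop_apply A x) x)"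
      by (simp add: field_simps)
    moreover have "0 \<le> 1 / c * Re (cinner (bop_apply A x) x)"
      using A c(1) by (simp add: positive_op_iff)
    ultimately show "(norm (bop_apply B x))\<^sup>2 \<le> (norm x)\<^sup>2" by linarith
  qed simp
  have sa: "cinner (bop_apply B x) y = cinner x (bop_apply B y)" for x y
    by (simp add: Bx cinner_diff_left cinner_diff_right cinner_scaleR_left cinner_scaleR_right
        positive_op_self_adjoint[OF A])
  obtain R where R: "positive_op R" "R * R = 1 - B" "\<And>C. C * B = B * C \<Longrightarrow> C * R = R * C"
    using sqrt_one_minus_contraction[OF contr sa] by blast
  define P where "P = of_real (sqrt c) *\<^sub>C R"
  have "positive_op P"
    using R(1) c(1) by (simp add: P_def positive_op_iff cinner_scaleC_left)
  moreover have "P * P = A"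
  proof (rule bop_eqI)
    fix x
    have "bop_apply (P * P) x = of_real c *\<^sub>C bop_apply (R * R) x"
      using c(1) by (simp add: P_def of_real_mult[symmetric] del: of_real_mult)
    also have "\<dots> = bop_apply A x"
      using c(1) by (simp add: R(2) B_def of_real_mult[symmetric] del: of_real_divide)
    finally show "bop_apply (P * P) x = bop_apply A x" .
  qed
  moreover have "C * P = P * C" if C: "C * A = A * C" for C
  proof -
    have "bop_apply C (bop_apply A x) = bop_apply A (bop_apply C x)" for x
      using C by (metis apply_times_op)
    then have "C * B = B * C" by (intro bop_eqI) (simp add: B_def)
    then have "C * R = R * C" by (rule R(3))
    then have "bop_apply C (bop_apply R x) = bop_apply R (bop_apply C x)" for x
      by (metis apply_times_op)
    then show ?thesis by (intro bop_eqI) (simp add: P_def)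
  qed
  ultimately show thesis by (rule that)
qed

lemma positive_op_eq_zeroI:
  assumes A: "positive_op A" and "Re (cinner (bop_apply A x) x) \<le> 0"
  shows "bop_apply A x = 0"
proof -
  obtain c where c: "c > 0" "\<And>x. norm (bop_apply A x) \<le> c * norm x"
    using bop_bound[of A] by blast
  have "c * Re (cinner (bop_apply A x) x) \<le> 0"
    using assms(2) c(1) by (simp add: mult_nonneg_nonpos)
  then have "(norm (bop_apply A x))\<^sup>2 \<le> 0"
    using positive_op_norm_square_le[OF A c, of x] by linarith
  then show ?thesis by simp
qed

text \<open>Two commuting roots \<open>P\<close> and \<open>R\<close> satisfy \<open>(P + R) (P - R) = 0\<close>, which by positivity forces both to
vanish on the range of \<open>P - R\<close>. Arbitrary roots are compared with the one constructed above, which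
commutes with everything that commutes with its square.\<close>

lemma positive_sqrt_unique:
  assumes "positive_op P" "positive_op R" and eq: "P * P = R * R"
  shows "P = R"
proof -
  have unique: "P = R" if P: "positive_op P" and R: "positive_op R" and eq: "P * P = R * R"
    and comm: "R * P = P * R" for P R :: "'a bop"
  proof (rule bop_eqI)
    fix x
    let ?y = "bop_apply (P - R) x"
    have "(P + R) * (P - R) = 0"
      by (simp add: ring_distribs eq comm)
    then have z: "bop_apply P ?y + bop_apply R ?y = 0"
      by (metis apply_add_op apply_times_op apply_zero_op)
    have "Re (cinner (bop_apply P ?y) ?y) + Re (cinner (bop_apply R ?y) ?y) = 0"
      using arg_cong[OF z, of "\<lambda>v. Re (cinner v ?y)"] by (simp add: cinner_add_left)
    moreover have "Re (cinner (bop_apply P ?y) ?y) \<ge> 0" "Re (cinner (bop_apply R ?y) ?y) \<ge> 0"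
      using P R unfolding positive_op_iff by blast+
    ultimately have "Re (cinner (bop_apply P ?y) ?y) \<le> 0" "Re (cinner (bop_apply R ?y) ?y) \<le> 0"
      by linarith+
    then have "bop_apply P ?y = 0" "bop_apply R ?y = 0"
      using positive_op_eq_zeroI P R by blast+
    then have "bop_apply (P - R) ?y = 0" by simp
    moreover have "cinner ?y ?y = cinner x (bop_apply (P - R) ?y)"
      using positive_op_self_adjoint[OF P] positive_op_self_adjoint[OF R]
      by (simp add: cinner_diff_left cinner_diff_right)
    ultimately have "?y = 0" by (metis cinner_eq_zero_iff cinner_zero_right)
    then show "bop_apply P x = bop_apply R x" by simp
  qed
  have "positive_op (P * P)"
    unfolding positive_op_iff
    by (simp add: positive_op_self_adjoint[OF assms(1)] cinner_self)
  then obtain Q where Q: "positive_op Q" "Q * Q = P * P" "\<And>C. C * (P * P) = (P * P) * C \<Longrightarrow> C * Q = Q * C"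
    using positive_sqrt_exists by blast
  have "Q = P"
    by (rule unique[OF Q(1) assms(1) Q(2)]) (rule Q(3), simp add: mult.assoc)
  moreover have "Q = R"
    by (rule unique[OF Q(1) assms(2)]) (use Q in \<open>simp_all add: eq mult.assoc\<close>)
  ultimately show ?thesis by simp
qed

lemma abs_op: "positive_op (abs_op T)" "abs_op T * abs_op T = adj T * T"
proof -
  have "positive_op (adj T * T)"
    unfolding positive_op_iff by (simp add: adj_eq' cinner_self)
  then obtain P where P: "positive_op P" "P * P = adj T * T"
    using positive_sqrt_exists by blast
  have "positive_op (abs_op T) \<and> abs_op T * abs_op T = adj T * T"
    unfolding abs_op_def
    by (rule theI[of _ P]) (use P in \<open>auto intro: positive_sqrt_unique\<close>)
  then show "positive_op (abs_op T)" "abs_op T * abs_op T = adj T * T" by auto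
qed

lemma norm_abs_op: "norm (bop_apply (abs_op T) x) = norm (bop_apply T x)"
proof -
  have "cinner (bop_apply (abs_op T) x) (bop_apply (abs_op T) x) = cinner x (bop_apply (abs_op T * abs_op T) x)"
    by (simp add: positive_op_self_adjoint[OF abs_op(1)])
  also have "\<dots> = cinner (bop_apply T x) (bop_apply T x)"
    by (simp add: abs_op(2) adj_eq)
  finally have "complex_of_real ((norm (bop_apply (abs_op T) x))\<^sup>2) = complex_of_real ((norm (bop_apply T x))\<^sup>2)"
    by (simp only: cinner_self)
  then show ?thesis by (simp only: of_real_eq_iff power2_eq_iff_nonneg norm_ge_zero)
qed

text \<open>Since \<open>T\<close> and its absolute value have equal norms at every vector, Douglas' lemma applies in both
directions. The contractions need not be partial isometries.\<close>

lemma polar_decomposition: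
  obtains V where "V * abs_op T = T" "\<And>x. norm (bop_apply V x) \<le> norm x"
  using douglas_factorization[of T "abs_op T"] norm_abs_op[of T] by (metis order_refl)

lemma abs_op_left_multiple:
  obtains W where "W * T = abs_op T" "\<And>x. norm (bop_apply W x) \<le> norm x"
  using douglas_factorization[of "abs_op T" T] norm_abs_op[of T] by (metis order_refl)

section \<open>Orthonormal bases\<close>

lemma onb_exists: "\<exists>E :: 'a::complex_hilbert set. is_onb E"
proof -
  define \<A> :: "'a set set" where
    "\<A> = {E. \<forall>e\<in>E. \<forall>f\<in>E. cinner e f = (if e = f then 1 else 0)}"
  have "\<exists>E\<in>\<A>. \<forall>F\<in>\<A>. E \<subseteq> F \<longrightarrow> F = E"
  proof (rule subset_Zorn_nonempty)
    have "{} \<in> \<A>" by (simp add: \<A>_def)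
    then show "\<A> \<noteq> {}" by blast
    fix \<C> assume C: "\<C> \<noteq> {}" "subset.chain \<A> \<C>"
    show "\<Union>\<C> \<in> \<A>"
      unfolding \<A>_def
    proof (intro CollectI ballI)
      fix e f assume "e \<in> \<Union>\<C>" "f \<in> \<Union>\<C>"
      then obtain X Y where "X \<in> \<C>" "Y \<in> \<C>" "e \<in> X" "f \<in> Y" by blast
      moreover from this have "X \<subseteq> Y \<or> Y \<subseteq> X"
        using C(2) by (meson subset_chain_def)
      ultimately obtain Z where "Z \<in> \<C>" "e \<in> Z" "f \<in> Z" by blast
      moreover from this have "Z \<in> \<A>" using C(2) by (meson subset_chain_def subsetD)
      ultimately show "cinner e f = (if e = f then 1 else 0)" by (auto simp: \<A>_def)
    qed
  qed
  then obtain E where E: "E \<in> \<A>" "\<And>F. F \<in> \<A> \<Longrightarrow> E \<subseteq> F \<Longrightarrow> F = E" by blast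
  have "x = 0" if x: "\<forall>e\<in>E. cinner x e = 0" for x
  proof (rule ccontr)
    assume "x \<noteq> 0"
    define u where "u = (1 / norm x) *\<^sub>R x"
    have u: "cinner u u = 1" using \<open>x \<noteq> 0\<close> by (simp add: u_def cinner_self)
    have ue: "cinner u e = 0" if "e \<in> E" for e
      using x that by (simp add: u_def cinner_scaleR_left)
    have eu: "cinner e u = 0" if "e \<in> E" for e
      using ue[OF that] by (metis cinner_commute complex_cnj_zero)
    have "insert u E \<in> \<A>"
      using E(1) u ue eu by (auto simp: \<A>_def)
    then have "u \<in> E" using E(2) by blast
    then show False using ue[of u] u by simp
  qed
  then have "is_onb E" using E(1) by (auto simp: is_onb_def \<A>_def)
  then show ?thesis by blast
qed

text \<open>Vectors orthogonal to the basis vanish, so finite linear combinations are dense; the coefficients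
\<open>(x|e)\<close> give the best approximation of \<open>x\<close> from each finite subset of the basis.\<close>

lemma onb_expansion:
  fixes E :: "'a::complex_hilbert set"
  assumes E: "is_onb E"
  shows "((\<lambda>e. cinner x e *\<^sub>C e) has_sum x) E"
proof -
  have on: "cinner e f = (if e = f then 1 else 0)" if "e \<in> E" "f \<in> E" for e f
    using E that by (simp add: is_onb_def)
  have L: "cvs.subspace (cvs.span E)" by (rule cvs.subspace_span)
  obtain P where P: "\<And>x. bop_apply P x \<in> closure (cvs.span E)"
    "\<And>l x. l \<in> cvs.span E \<Longrightarrow> cinner l (bop_apply P x) = cinner l x"
    using orthogonal_projection[OF L] by metis
  have "cinner (x - bop_apply P x) e = 0" if "e \<in> E" for e
  proof -
    have "cinner e (x - bop_apply P x) = 0"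
      by (simp add: cinner_diff_right P(2) cvs.span_base that)
    then show ?thesis by (metis cinner_commute complex_cnj_zero)
  qed
  then have "x - bop_apply P x = 0" using E unfolding is_onb_def by blast
  then have x: "x \<in> closure (cvs.span E)" using P(1)[of x] by simp
  have best: "norm (x - (\<Sum>e\<in>F. cinner x e *\<^sub>C e)) \<le> norm (x - (\<Sum>e\<in>F. r e *\<^sub>C e))"
    if F: "finite F" "F \<subseteq> E" for F r
  proof -
    define p where "p = (\<Sum>e\<in>F. cinner x e *\<^sub>C e)"
    define d where "d = (\<Sum>e\<in>F. (cinner x e - r e) *\<^sub>C e)"
    have "cinner p e = cinner x e" if "e \<in> F" for e
    proof -
      have "cinner p e = (\<Sum>f\<in>F. if f = e then cinner x e else 0)"
        unfolding p_def cinner_sum_left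
        by (rule sum.cong) (use F that on in \<open>auto simp: cinner_scaleC_left subset_iff\<close>)
      then show ?thesis using F that by simp
    qed
    then have "cinner e (x - p) = 0" if "e \<in> F" for e
      using that by (subst cinner_commute) (simp add: cinner_diff_left)
    then have orth: "cinner d (x - p) = 0"
      by (simp add: d_def cinner_sum_left cinner_scaleC_left)
    have "x - (\<Sum>e\<in>F. r e *\<^sub>C e) = (x - p) + d"
      by (simp add: p_def d_def cvs.scale_left_diff_distrib sum_subtractf)
    then have "(norm (x - (\<Sum>e\<in>F. r e *\<^sub>C e)))\<^sup>2 = (norm (x - p))\<^sup>2 + (norm d)\<^sup>2"
      by (simp only: norm_add_square Re_cinner_commute[of "x - p"] orth) simp
    then have "(norm (x - p))\<^sup>2 \<le> (norm (x - (\<Sum>e\<in>F. r e *\<^sub>C e)))\<^sup>2" by simp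
    then show ?thesis unfolding p_def by (rule power2_le_imp_le) simp
  qed
  show ?thesis
    unfolding has_sum_def
  proof (rule tendstoI)
    fix \<epsilon> :: real assume "\<epsilon> > 0"
    then obtain l where "l \<in> cvs.span E" and l: "dist l x < \<epsilon>"
      using x closure_approachable by blast
    then obtain F r where F: "finite F" "F \<subseteq> E" and lr: "l = (\<Sum>e\<in>F. r e *\<^sub>C e)"
      unfolding cvs.span_explicit by blast
    show "\<forall>\<^sub>F G in finite_subsets_at_top E. dist (\<Sum>e\<in>G. cinner x e *\<^sub>C e) x < \<epsilon>"
      unfolding eventually_finite_subsets_at_top
    proof (intro exI[of _ F] conjI allI impI F)
      fix G assume G: "finite G \<and> F \<subseteq> G \<and> G \<subseteq> E"
      have "l = (\<Sum>e\<in>G. (if e \<in> F then r e else 0) *\<^sub>C e)"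
        unfolding lr by (rule sum.mono_neutral_cong_left) (use G in auto)
      then have "norm (x - (\<Sum>e\<in>G. cinner x e *\<^sub>C e)) \<le> norm (x - l)"
        using best[of G "\<lambda>e. if e \<in> F then r e else 0"] G by simp
      then show "dist (\<Sum>e\<in>G. cinner x e *\<^sub>C e) x < \<epsilon>"
        using l by (simp add: dist_norm norm_minus_commute)
    qed
  qed
qed

lemma parseval:
  assumes "is_onb E"
  shows "((\<lambda>e. cinner x e * cinner e y) has_sum cinner x y) E"
  using has_sum_bounded_linear[OF bounded_linear_cinner_left onb_expansion[OF assms], of x y]
  by (simp add: cinner_scaleC_left)

lemma parseval_norm:
  assumes "is_onb E"
  shows "((\<lambda>e. (cmod (cinner x e))\<^sup>2) has_sum (norm x)\<^sup>2) E"
proof -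
  have "cinner x e * cinner e x = of_real ((cmod (cinner x e))\<^sup>2)" for e
    by (metis cinner_commute complex_norm_square)
  then have "((\<lambda>e. complex_of_real ((cmod (cinner x e))\<^sup>2)) has_sum of_real ((norm x)\<^sup>2)) E"
    using parseval[OF assms, of x x] by (simp add: cinner_self del: of_real_power)
  then show ?thesis by (simp only: has_sum_of_real_iff)
qed

lemma cmod_cinner_commute: "cmod (cinner x y) = cmod (cinner y x)"
  by (metis cinner_commute complex_mod_cnj)

lemma cauchy_schwarz_infsum:
  fixes a b :: "'i \<Rightarrow> real"
  assumes a: "(\<lambda>i. (a i)\<^sup>2) summable_on I" and b: "(\<lambda>i. (b i)\<^sup>2) summable_on I"
  shows "(\<lambda>i. \<bar>a i * b i\<bar>) summable_on I" (is ?S)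
    and "(\<Sum>\<^sub>\<infinity>i\<in>I. \<bar>a i * b i\<bar>) \<le> sqrt (\<Sum>\<^sub>\<infinity>i\<in>I. (a i)\<^sup>2) * sqrt (\<Sum>\<^sub>\<infinity>i\<in>I. (b i)\<^sup>2)"
proof -
  have fin: "(\<Sum>i\<in>F. \<bar>a i * b i\<bar>) \<le> sqrt (\<Sum>\<^sub>\<infinity>i\<in>I. (a i)\<^sup>2) * sqrt (\<Sum>\<^sub>\<infinity>i\<in>I. (b i)\<^sup>2)"
    if F: "finite F" "F \<subseteq> I" for F
  proof -
    have "(\<Sum>i\<in>F. \<bar>a i * b i\<bar>) \<le> L2_set a F * L2_set b F"
      using L2_set_mult_ineq[of a b F] by (simp add: abs_mult)
    also have "\<dots> \<le> sqrt (\<Sum>\<^sub>\<infinity>i\<in>I. (a i)\<^sup>2) * sqrt (\<Sum>\<^sub>\<infinity>i\<in>I. (b i)\<^sup>2)"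
      unfolding L2_set_def
      by (intro mult_mono real_sqrt_le_mono finite_sum_le_infsum a b F) (auto simp: sum_nonneg infsum_nonneg)
    finally show ?thesis .
  qed
  show ?S
    by (rule nonneg_bdd_above_summable_on) (use fin in \<open>auto intro!: bdd_aboveI\<close>)
  then show "(\<Sum>\<^sub>\<infinity>i\<in>I. \<bar>a i * b i\<bar>) \<le> sqrt (\<Sum>\<^sub>\<infinity>i\<in>I. (a i)\<^sup>2) * sqrt (\<Sum>\<^sub>\<infinity>i\<in>I. (b i)\<^sup>2)"
    by (rule infsum_le_finite_sums) (fact fin)
qed

section \<open>Trace class operators as sums of rank-one operators\<close>

definition l2_family :: "('i \<Rightarrow> 'a::real_normed_vector) \<Rightarrow> bool" where
  "l2_family x \<longleftrightarrow> (\<lambda>i. (norm (x i))\<^sup>2) summable_on UNIV"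

text \<open>\<open>T = \<Sum>\<^sub>i x\<^sub>i \<boxtimes> y\<^sub>i\<close> in the weak sense. The index type is left arbitrary so that expansions can be
concatenated by passing to a sum type.\<close>

definition represents :: "('i \<Rightarrow> 'a::complex_hilbert) \<Rightarrow> ('i \<Rightarrow> 'a) \<Rightarrow> 'a bop \<Rightarrow> bool" where
  "represents x y T \<longleftrightarrow> l2_family x \<and> l2_family y \<and>
     (\<forall>u v. ((\<lambda>i. cinner u (y i) * cinner (x i) v) has_sum cinner (bop_apply T u) v) UNIV)"

lemma representsD:
  assumes "represents x y T"
  shows "l2_family x" "l2_family y"
    "((\<lambda>i. cinner u (y i) * cinner (x i) v) has_sum cinner (bop_apply T u) v) UNIV"
  using assms by (auto simp: represents_def)

lemma l2_family_apply:
  assumes "l2_family x"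
  shows "l2_family (\<lambda>i. bop_apply A (x i))"
proof -
  obtain c where c: "c > 0" "\<And>x. norm (bop_apply A x) \<le> c * norm x"
    using bop_bound[of A] by blast
  have "(\<lambda>i. c\<^sup>2 * (norm (x i))\<^sup>2) summable_on UNIV"
    using assms unfolding l2_family_def by (rule summable_on_cmult_right)
  moreover have "(norm (bop_apply A (x i)))\<^sup>2 \<le> c\<^sup>2 * (norm (x i))\<^sup>2" for i
    using power_mono[OF c(2) norm_ge_zero, of "x i" 2] by (simp add: power_mult_distrib)
  ultimately show ?thesis
    unfolding l2_family_def by (rule summable_on_comparison_test) auto
qed

lemma l2_families_prod_summable:
  assumes "l2_family x" "l2_family y"
  shows "(\<lambda>i. norm (x i) * norm (y i)) summable_on UNIV"
  using cauchy_schwarz_infsum(1)[of "\<lambda>i. norm (x i)" UNIV "\<lambda>i. norm (y i)"] assms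
  by (simp add: l2_family_def)

lemma represents_mult_left:
  assumes "represents x y T"
  shows "represents (\<lambda>i. bop_apply A (x i)) y (A * T)"
  using assms by (simp add: represents_def l2_family_apply adj_eq[of A])

lemma represents_mult_right:
  assumes "represents x y T"
  shows "represents x (\<lambda>i. bop_apply (adj A) (y i)) (T * A)"
  using assms by (simp add: represents_def l2_family_apply adj_eq[of A, symmetric])

lemma has_sum_sum_type:
  fixes f :: "'i + 'j \<Rightarrow> 'b::topological_comm_monoid_add"
  assumes "((\<lambda>i. f (Inl i)) has_sum a) UNIV" "((\<lambda>j. f (Inr j)) has_sum b) UNIV"
  shows "(f has_sum a + b) UNIV"
proof -
  have "(f has_sum a + b) (range Inl \<union> range Inr)"
  proof (rule has_sum_Un_disjoint)
    show "(f has_sum a) (range Inl)"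
      using assms(1) has_sum_reindex[of Inl UNIV f a] by (simp add: comp_def)
    show "(f has_sum b) (range Inr)"
      using assms(2) has_sum_reindex[of Inr UNIV f b] by (simp add: comp_def)
  qed auto
  then show ?thesis by (simp add: UNIV_sum)
qed

lemma l2_family_case_sum:
  assumes "l2_family x" "l2_family y"
  shows "l2_family (case_sum x y)"
proof -
  obtain a b where "((\<lambda>i. (norm (x i))\<^sup>2) has_sum a) UNIV" "((\<lambda>i. (norm (y i))\<^sup>2) has_sum b) UNIV"
    using assms unfolding l2_family_def summable_on_def by blast
  then have "((\<lambda>k. (norm (case_sum x y k))\<^sup>2) has_sum a + b) UNIV"
    by (intro has_sum_sum_type) simp_all
  then show ?thesis unfolding l2_family_def by (rule has_sum_imp_summable)
qed

lemma represents_add: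
  assumes "represents x y S" "represents x' y' T"
  shows "represents (case_sum x x') (case_sum y y') (S + T)"
  using assms
  by (auto simp: represents_def l2_family_case_sum cinner_add_left intro!: has_sum_sum_type)

lemma represents_rank_one: "represents (\<lambda>_::unit. x) (\<lambda>_. y) (rank_one x y)"
  by (simp add: represents_def l2_family_def cinner_scaleC_left has_sum_finite_iff)

text \<open>Both sides are the sum of \<open>(e|y\<^sub>i) (x\<^sub>i|e)\<close> over all pairs \<open>(i, e)\<close>: over \<open>i\<close> first it gives
\<open>(T e|e)\<close>, over \<open>e\<close> first it gives \<open>(x\<^sub>i|y\<^sub>i)\<close> by Parseval. The double sum converges absolutely by
the Cauchy-Schwarz inequality.\<close>

lemma represents_trace_has_sum:
  assumes T: "represents x y T" and E: "is_onb E"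
  shows "((\<lambda>e. cinner (bop_apply T e) e) has_sum (\<Sum>\<^sub>\<infinity>i. cinner (x i) (y i))) E"
proof -
  define f where "f = (\<lambda>(i, e). cinner e (y i) * cinner (x i) e)"
  have inner: "(\<lambda>e. norm (f (i, e))) summable_on E"
    "(\<Sum>\<^sub>\<infinity>e\<in>E. norm (f (i, e))) \<le> norm (x i) * norm (y i)" for i
  proof -
    have p: "((\<lambda>e. (cmod (cinner e (y i)))\<^sup>2) has_sum (norm (y i))\<^sup>2) E"
      "((\<lambda>e. (cmod (cinner (x i) e))\<^sup>2) has_sum (norm (x i))\<^sup>2) E"
      using parseval_norm[OF E, of "y i"] parseval_norm[OF E, of "x i"]
      by (simp_all add: cmod_cinner_commute[of "y i"])
    note cs = cauchy_schwarz_infsum[OF p[THEN has_sum_imp_summable]]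
    show "(\<lambda>e. norm (f (i, e))) summable_on E"
      using cs(1) by (simp add: f_def norm_mult)
    show "(\<Sum>\<^sub>\<infinity>e\<in>E. norm (f (i, e))) \<le> norm (x i) * norm (y i)"
      using cs(2) by (simp add: f_def norm_mult p[THEN infsumI] mult.commute)
  qed
  have "(\<lambda>p. norm (f p)) summable_on (UNIV \<times> E)"
    unfolding Infinite_Sum.abs_summable_on_Sigma_iff
  proof (intro conjI ballI inner(1))
    show "(\<lambda>i. norm (\<Sum>\<^sub>\<infinity>e\<in>E. norm (f (i, e)))) summable_on UNIV"
      by (rule summable_on_comparison_test[OF l2_families_prod_summable[OF representsD(1,2)[OF T]]])
        (use inner in \<open>auto simp: infsum_nonneg\<close>)
  qed
  then obtain S where S: "(f has_sum S) (UNIV \<times> E)"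
    using abs_summable_summable summable_on_def by blast
  have "((\<lambda>i. cinner (x i) (y i)) has_sum S) UNIV"
  proof (rule has_sum_SigmaD[OF S])
    show "((\<lambda>e. f (i, e)) has_sum cinner (x i) (y i)) E" for i
      using parseval[OF E, of "x i" "y i"]
      by (simp add: f_def mult.commute[of "cinner (x i) _"])
  qed
  then have "(\<Sum>\<^sub>\<infinity>i. cinner (x i) (y i)) = S" by (rule infsumI)
  moreover have "((\<lambda>e. cinner (bop_apply T e) e) has_sum S) E"
    by (rule has_sum_SigmaD[OF S[unfolded has_sum_swap[of f]]])
      (use representsD(3)[OF T] in \<open>simp add: f_def\<close>)
  ultimately show ?thesis by simp
qed

lemma represents_trace:
  assumes "represents x y T"
  shows "trace T = (\<Sum>\<^sub>\<infinity>i. cinner (x i) (y i))"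
  unfolding trace_def
  by (rule infsumI[OF represents_trace_has_sum[OF assms someI_ex[OF onb_exists]]])

text \<open>The absolute value of \<open>T\<close> is a left multiple \<open>W T\<close> and so inherits an expansion.\<close>

lemma represents_trace_class:
  fixes T :: "'a::complex_hilbert bop"
  assumes T: "represents x y T"
  shows "T \<in> trace_class"
proof -
  obtain W where W: "W * T = abs_op T" using abs_op_left_multiple by blast
  obtain E :: "'a set" where E: "is_onb E" using onb_exists by blast
  have "(\<lambda>e. cinner (bop_apply (abs_op T) e) e) summable_on E"
    using represents_trace_has_sum[OF represents_mult_left[OF T, of W] E]
    unfolding W by (rule has_sum_imp_summable)
  with E show ?thesis by (auto simp: trace_class_def)
qed

text \<open>With \<open>T = V |T|\<close> and \<open>Q\<close> the square root of \<open>|T|\<close>, Parseval's identity expands \<open>T = (V Q) Q\<close> as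
\<open>\<Sum>\<^sub>e V Q e \<boxtimes> Q e\<close>, and \<open>\<Sum>\<^sub>e \<parallel>Q e\<parallel>\<^sup>2 = \<Sum>\<^sub>e (|T| e|e)\<close> is finite. Vectors outside the basis index
zero terms.\<close>

lemma trace_class_represents:
  fixes T :: "'a::complex_hilbert bop"
  assumes "T \<in> trace_class"
  obtains x y :: "'a \<Rightarrow> 'a" where "represents x y T"
proof -
  obtain E where E: "is_onb E" and sE: "(\<lambda>e. cinner (bop_apply (abs_op T) e) e) summable_on E"
    using assms by (auto simp: trace_class_def)
  obtain V where V: "V * abs_op T = T" using polar_decomposition by blast
  obtain Q where Q: "positive_op Q" "Q * Q = abs_op T"
    using positive_sqrt_exists[OF abs_op(1)] by blast
  note Qsa = positive_op_self_adjoint[OF Q(1)]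
  define y where "y e = (if e \<in> E then bop_apply Q e else 0)" for e
  define x where "x e = bop_apply V (y e)" for e
  have "cinner (bop_apply (abs_op T) e) e = of_real ((norm (bop_apply Q e))\<^sup>2)" for e
    by (simp add: Q(2)[symmetric] Qsa cinner_self del: of_real_power)
  then have "(\<lambda>e. (norm (bop_apply Q e))\<^sup>2) summable_on E"
    using summable_on_Re[OF sE] by (simp del: of_real_power)
  then have "(\<lambda>e. (norm (y e))\<^sup>2) summable_on UNIV"
    by (subst summable_on_cong_neutral[where T = E and g = "\<lambda>e. (norm (bop_apply Q e))\<^sup>2"])
      (auto simp: y_def)
  then have ly: "l2_family y" by (simp add: l2_family_def)
  then have lx: "l2_family x" unfolding x_def by (rule l2_family_apply)
  have "((\<lambda>e. cinner u (y e) * cinner (x e) v) has_sum cinner (bop_apply T u) v) UNIV" for u v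
  proof -
    have "((\<lambda>e. cinner (bop_apply Q u) e * cinner e (bop_apply Q (bop_apply (adj V) v)))
        has_sum cinner (bop_apply Q u) (bop_apply Q (bop_apply (adj V) v))) E"
      by (rule parseval[OF E])
    also have "cinner (bop_apply Q u) (bop_apply Q (bop_apply (adj V) v))
        = cinner (bop_apply (V * (Q * Q)) u) v"
      by (simp add: adj_eq positive_op_adj[OF Q(1)])
    also have "V * (Q * Q) = T" by (simp add: Q V)
    finally show ?thesis
      by (subst has_sum_cong_neutral[where T = E
            and g = "\<lambda>e. cinner (bop_apply Q u) e * cinner e (bop_apply Q (bop_apply (adj V) v))"])
        (auto simp: y_def x_def adj_eq positive_op_adj[OF Q(1)])
  qed
  with lx ly have "represents x y T" by (simp add: represents_def)
  then show thesis by (rule that)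
qed

lemma represents_norm_le:
  assumes T: "represents x y T"
  shows "cmod (cinner (bop_apply T u) v) \<le> (\<Sum>\<^sub>\<infinity>i. norm (x i) * norm (y i)) * (norm u * norm v)"
proof -
  note s = l2_families_prod_summable[OF representsD(1,2)[OF T]]
  have b: "norm (cinner u (y i) * cinner (x i) v) \<le> norm (x i) * norm (y i) * (norm u * norm v)" for i
    using mult_mono[OF cinner_Cauchy_Schwarz[of u "y i"] cinner_Cauchy_Schwarz[of "x i" v]]
    by (simp add: norm_mult ac_simps)
  show ?thesis
    using norm_infsum_le[OF representsD(3)[OF T] has_sum_cmult_left[OF has_sum_infsum[OF s]] b] by simp
qed

lemma represents_trace_norm_le:
  assumes T: "represents x y T"
  shows "trace_norm T \<le> (\<Sum>\<^sub>\<infinity>i. norm (x i) * norm (y i))"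
proof -
  obtain W where W: "W * T = abs_op T" "\<And>x. norm (bop_apply W x) \<le> norm x"
    using abs_op_left_multiple by blast
  note r = represents_mult_left[OF T, of W]
  note s = l2_families_prod_summable[OF representsD(1,2)[OF T]]
  have b: "norm (cinner (bop_apply W (x i)) (y i)) \<le> norm (x i) * norm (y i)" for i
    using cinner_Cauchy_Schwarz[of "bop_apply W (x i)" "y i"] mult_right_mono[OF W(2) norm_ge_zero, of "x i" "y i"]
    by linarith
  have "(\<lambda>i. norm (cinner (bop_apply W (x i)) (y i))) summable_on UNIV"
    by (rule summable_on_comparison_test[OF s]) (use b in auto)
  then have "((\<lambda>i. cinner (bop_apply W (x i)) (y i)) has_sum trace (abs_op T)) UNIV"
    using represents_trace[OF r] abs_summable_summable W(1) by (metis has_sum_infsum)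
  from norm_infsum_le[OF this has_sum_infsum[OF s] b]
  show ?thesis
    unfolding trace_norm_def using complex_Re_le_cmod order_trans by blast
qed

lemma trace_class_rank_one [simp]: "rank_one x y \<in> trace_class"
  by (rule represents_trace_class[OF represents_rank_one])

lemma trace_class_add: "S \<in> trace_class \<Longrightarrow> T \<in> trace_class \<Longrightarrow> S + T \<in> trace_class"
  by (metis represents_add represents_trace_class trace_class_represents)

lemma trace_class_mult_left: "T \<in> trace_class \<Longrightarrow> A * T \<in> trace_class"
  by (metis represents_mult_left represents_trace_class trace_class_represents)

lemma trace_class_mult_right: "T \<in> trace_class \<Longrightarrow> T * A \<in> trace_class"
  by (metis represents_mult_right represents_trace_class trace_class_represents)

lemma trace_class_scaleC: "T \<in> trace_class \<Longrightarrow> c *\<^sub>C T \<in> trace_class"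
proof -
  assume "T \<in> trace_class"
  then have "(c *\<^sub>C 1) * T \<in> trace_class" by (rule trace_class_mult_left)
  also have "(c *\<^sub>C 1) * T = c *\<^sub>C T" by (rule bop_eqI) simp
  finally show ?thesis .
qed

lemma trace_class_zero [simp]: "0 \<in> trace_class"
  using trace_class_scaleC[OF trace_class_rank_one, of 0 0 0] by (simp add: cvs.scale_zero_left)

lemma trace_class_sum: "(\<And>i. i \<in> I \<Longrightarrow> f i \<in> trace_class) \<Longrightarrow> (\<Sum>i\<in>I. f i) \<in> trace_class"
  by (induction I rule: infinite_finite_induct) (simp_all add: trace_class_add)

lemma trace_add:
  assumes "S \<in> trace_class" "T \<in> trace_class"
  shows "trace (S + T) = trace S + trace T"
proof -
  have "(\<lambda>e. cinner (bop_apply T e) e) summable_on (SOME E. is_onb E)" if "T \<in> trace_class" for T :: "'a bop"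
    using that represents_trace_has_sum[OF _ someI_ex[OF onb_exists]] has_sum_imp_summable
    by (metis trace_class_represents)
  then show ?thesis
    using assms by (simp add: trace_def cinner_add_left infsum_add)
qed

lemma trace_scaleC: "trace (c *\<^sub>C T) = c * trace T"
  by (simp add: trace_def cinner_scaleC_left infsum_cmult_right')

lemma trace_zero [simp]: "trace 0 = 0"
  by (simp add: trace_def)

lemma trace_sum:
  "(\<And>i. i \<in> I \<Longrightarrow> f i \<in> trace_class) \<Longrightarrow> trace (\<Sum>i\<in>I. f i) = (\<Sum>i\<in>I. trace (f i))"
  by (induction I rule: infinite_finite_induct) (simp_all add: trace_class_sum trace_add)

lemma trace_diff:
  assumes "S \<in> trace_class" "T \<in> trace_class"
  shows "trace (S - T) = trace S - trace T"
proof -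
  have "S - T = S + (- 1) *\<^sub>C T" by (rule bop_eqI) (simp add: cvs.scale_minus_left)
  moreover have "(- 1) *\<^sub>C T \<in> trace_class" by (rule trace_class_scaleC[OF assms(2)])
  ultimately show ?thesis using assms by (simp only: trace_add trace_scaleC) simp
qed

lemma trace_mult_commute:
  assumes "T \<in> trace_class"
  shows "trace (A * T) = trace (T * A)"
proof -
  obtain x y :: "'a \<Rightarrow> 'a" where T: "represents x y T" using assms by (rule trace_class_represents)
  show ?thesis
    using represents_trace[OF represents_mult_left[OF T, of A]]
      represents_trace[OF represents_mult_right[OF T, of A]]
    by (simp add: adj_eq)
qed

lemma trace_mult_rank_one: "trace (A * rank_one x y) = cinner (bop_apply A x) y"
  using represents_trace[OF represents_mult_left[OF represents_rank_one], of A x y] by simp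

lemma trace_rank_one_mult: "trace (rank_one x y * A) = cinner (bop_apply A x) y"
  by (metis trace_class_rank_one trace_mult_commute trace_mult_rank_one)

text \<open>Testing against \<open>u \<boxtimes> v\<close> recovers the matrix coefficients of an operator from its traces.\<close>

lemma trace_ext:
  assumes "\<And>A. trace (A * S) = trace (A * T)"
  shows "S = T"
  by (rule bop_eqI_cinner) (metis assms trace_rank_one_mult)

section \<open>The Hilbert space of square-summable families\<close>

lemma l2_family_add:
  assumes "l2_family x" "l2_family y"
  shows "l2_family (\<lambda>i. x i + y i)"
proof -
  have "(\<lambda>i. 2 * (norm (x i))\<^sup>2 + 2 * (norm (y i))\<^sup>2) summable_on UNIV"
    using assms unfolding l2_family_def by (intro summable_on_add summable_on_cmult_right)
  moreover have "(norm (x i + y i))\<^sup>2 \<le> 2 * (norm (x i))\<^sup>2 + 2 * (norm (y i))\<^sup>2" for i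
  proof -
    have "(norm (x i + y i))\<^sup>2 \<le> (norm (x i) + norm (y i))\<^sup>2"
      by (intro power_mono norm_triangle_ineq) simp
    also have "\<dots> \<le> 2 * (norm (x i))\<^sup>2 + 2 * (norm (y i))\<^sup>2"
      using zero_le_power2[of "norm (x i) - norm (y i)"] by (simp add: power2_sum power2_diff)
    finally show ?thesis .
  qed
  ultimately show ?thesis
    unfolding l2_family_def by (rule summable_on_comparison_test) auto
qed

lemma l2_family_scaleC:
  fixes x :: "'i \<Rightarrow> 'a::complex_hilbert"
  shows "l2_family x \<Longrightarrow> l2_family (\<lambda>i. c *\<^sub>C x i)"
  using l2_family_apply[of x "c *\<^sub>C 1"] by simp

lemma l2_family_finite_support:
  assumes "finite {i. x i \<noteq> 0}"
  shows "l2_family x"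
  unfolding l2_family_def
  by (rule finite_nonzero_values_imp_summable_on) (use assms in auto)

lemma l2_family_cinner_summable:
  assumes "l2_family x" "l2_family y"
  shows "(\<lambda>i. cinner (x i) (y i)) summable_on UNIV"
proof (rule abs_summable_summable)
  show "(\<lambda>i. norm (cinner (x i) (y i))) summable_on UNIV"
    by (rule summable_on_comparison_test[OF l2_families_prod_summable[OF assms]])
      (simp_all add: cinner_Cauchy_Schwarz)
qed

text \<open>The Hilbert sum of copies of one Hilbert space, on which the amplifications of operators act
diagonally.\<close>

typedef (overloaded) ('i, 'a) ell2 = "{x :: 'i \<Rightarrow> 'a::complex_hilbert. l2_family x}"
  morphisms ell2_apply Ell2
  by (rule exI[of _ "\<lambda>_. 0"]) (simp add: l2_family_def)

setup_lifting type_definition_ell2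

lemma l2_family_ell2 [simp]: "l2_family (ell2_apply x)"
  using ell2_apply by simp

lemma ell2_eqI: "(\<And>i. ell2_apply x i = ell2_apply y i) \<Longrightarrow> x = y"
  by transfer auto

instantiation ell2 :: (type, complex_hilbert) complex_vector
begin

lift_definition zero_ell2 :: "('a, 'b) ell2" is "\<lambda>_. 0"
  by (simp add: l2_family_def)

lift_definition plus_ell2 :: "('a, 'b) ell2 \<Rightarrow> ('a, 'b) ell2 \<Rightarrow> ('a, 'b) ell2" is "\<lambda>x y i. x i + y i"
  by (rule l2_family_add)

lift_definition uminus_ell2 :: "('a, 'b) ell2 \<Rightarrow> ('a, 'b) ell2" is "\<lambda>x i. - x i"
  by (simp add: l2_family_def)

lift_definition minus_ell2 :: "('a, 'b) ell2 \<Rightarrow> ('a, 'b) ell2 \<Rightarrow> ('a, 'b) ell2" is "\<lambda>x y i. x i - y i"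
proof -
  fix x y :: "'a \<Rightarrow> 'b" assume "l2_family x" "l2_family y"
  then have "l2_family (\<lambda>i. x i + - y i)" by (intro l2_family_add) (simp_all add: l2_family_def)
  then show "l2_family (\<lambda>i. x i - y i)" by simp
qed

lift_definition scaleC_ell2 :: "complex \<Rightarrow> ('a, 'b) ell2 \<Rightarrow> ('a, 'b) ell2" is "\<lambda>c x i. c *\<^sub>C x i"
  by (rule l2_family_scaleC)

definition scaleR_ell2 :: "real \<Rightarrow> ('a, 'b) ell2 \<Rightarrow> ('a, 'b) ell2" where
  "scaleR_ell2 r x = complex_of_real r *\<^sub>C x"

instance
proof
  fix x y z :: "('a, 'b) ell2" and c d :: complex and r s :: real
  show "x + y + z = x + (y + z)" by transfer (simp add: algebra_simps)
  show "x + y = y + x" by transfer (simp add: algebra_simps)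
  show "0 + x = x" by transfer simp
  show "- x + x = 0" by transfer simp
  show "x - y = x + - y" by transfer simp
  show "c *\<^sub>C (x + y) = c *\<^sub>C x + c *\<^sub>C y" by transfer (simp add: scaleC_add_right)
  show "(c + d) *\<^sub>C x = c *\<^sub>C x + d *\<^sub>C x" by transfer (simp add: scaleC_add_left)
  show "c *\<^sub>C d *\<^sub>C x = (c * d) *\<^sub>C x" by transfer simp
  show "1 *\<^sub>C x = x" by transfer simp
  show "r *\<^sub>R x = complex_of_real r *\<^sub>C x" by (rule scaleR_ell2_def)
  show "r *\<^sub>R (x + y) = r *\<^sub>R x + r *\<^sub>R y"
    unfolding scaleR_ell2_def by transfer (simp add: scaleC_add_right)
  show "(r + s) *\<^sub>R x = r *\<^sub>R x + s *\<^sub>R x"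
    unfolding scaleR_ell2_def by transfer (simp add: scaleC_add_left)
  show "r *\<^sub>R s *\<^sub>R x = (r * s) *\<^sub>R x"
    unfolding scaleR_ell2_def by transfer simp
  show "1 *\<^sub>R x = x"
    unfolding scaleR_ell2_def by transfer simp
qed

end

lemma ell2_apply_simps [simp]:
  "ell2_apply 0 i = 0"
  "ell2_apply (x + y) i = ell2_apply x i + ell2_apply y i"
  "ell2_apply (x - y) i = ell2_apply x i - ell2_apply y i"
  "ell2_apply (- x) i = - ell2_apply x i"
  "ell2_apply (c *\<^sub>C x) i = c *\<^sub>C ell2_apply x i"
  by (transfer, simp)+

lemma ell2_apply_scaleR [simp]: "ell2_apply (r *\<^sub>R x) i = r *\<^sub>R ell2_apply x i"
  by (simp add: scaleR_scaleC)

lemma ell2_norm_square_summable: "(\<lambda>i. (norm (ell2_apply x i))\<^sup>2) summable_on UNIV"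
  using l2_family_ell2[of x] by (simp add: l2_family_def)

instantiation ell2 :: (type, complex_hilbert) real_normed_vector
begin

definition norm_ell2 :: "('a, 'b) ell2 \<Rightarrow> real" where
  "norm_ell2 x = sqrt (\<Sum>\<^sub>\<infinity>i. (norm (ell2_apply x i))\<^sup>2)"
definition dist_ell2 :: "('a, 'b) ell2 \<Rightarrow> ('a, 'b) ell2 \<Rightarrow> real" where
  "dist_ell2 x y = norm (x - y)"
definition sgn_ell2 :: "('a, 'b) ell2 \<Rightarrow> ('a, 'b) ell2" where
  "sgn_ell2 x = inverse (norm x) *\<^sub>R x"
definition uniformity_ell2 :: "(('a, 'b) ell2 \<times> ('a, 'b) ell2) filter" where
  "uniformity_ell2 = (INF e\<in>{0 <..}. principal {(x, y). dist x y < e})"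
definition open_ell2 :: "('a, 'b) ell2 set \<Rightarrow> bool" where
  "open_ell2 U = (\<forall>x\<in>U. \<forall>\<^sub>F (x', y) in uniformity. x' = x \<longrightarrow> y \<in> U)"

instance
proof
  fix x y :: "('a, 'b) ell2" and r :: real
  show "dist x y = norm (x - y)" by (rule dist_ell2_def)
  show "sgn x = inverse (norm x) *\<^sub>R x" by (rule sgn_ell2_def)
  show "(uniformity :: (('a, 'b) ell2 \<times> ('a, 'b) ell2) filter) = (INF e\<in>{0 <..}. principal {(x, y). dist x y < e})"
    by (rule uniformity_ell2_def)
  show "open U = (\<forall>x\<in>U. \<forall>\<^sub>F (x', y) in uniformity. x' = x \<longrightarrow> y \<in> U)" for U :: "('a, 'b) ell2 set"
    by (rule open_ell2_def)
  have sq: "(norm x)\<^sup>2 = (\<Sum>\<^sub>\<infinity>i. (norm (ell2_apply x i))\<^sup>2)" for x :: "('a, 'b) ell2"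
    by (simp add: norm_ell2_def infsum_nonneg)
  show "(norm x = 0) = (x = 0)"
  proof
    assume "norm x = 0"
    then have z: "(\<Sum>\<^sub>\<infinity>i. (norm (ell2_apply x i))\<^sup>2) = 0" using sq[of x] by simp
    have "(norm (ell2_apply x i))\<^sup>2 = 0" for i
      by (rule nonneg_infsum_le_0D[OF _ ell2_norm_square_summable[of x]]) (simp_all add: z)
    then show "x = 0" by (intro ell2_eqI) simp
  qed (simp add: norm_ell2_def)
  show "norm (r *\<^sub>R x) = \<bar>r\<bar> * norm x"
    by (simp add: norm_ell2_def power_mult_distrib infsum_cmult_right' real_sqrt_mult)
  show "norm (x + y) \<le> norm x + norm y"
  proof (rule power2_le_imp_le)
    let ?p = "\<lambda>i. norm (ell2_apply x i) * norm (ell2_apply y i)"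
    have p: "?p summable_on UNIV"
      by (intro l2_families_prod_summable) simp_all
    have "(norm (x + y))\<^sup>2 \<le> (\<Sum>\<^sub>\<infinity>i. (norm (ell2_apply x i))\<^sup>2 + 2 * ?p i + (norm (ell2_apply y i))\<^sup>2)"
      unfolding sq
    proof (rule infsum_mono[OF ell2_norm_square_summable])
      show "(\<lambda>i. (norm (ell2_apply x i))\<^sup>2 + 2 * ?p i + (norm (ell2_apply y i))\<^sup>2) summable_on UNIV"
        by (intro summable_on_add summable_on_cmult_right p ell2_norm_square_summable)
      fix i
      have "(norm (ell2_apply x i + ell2_apply y i))\<^sup>2 \<le> (norm (ell2_apply x i) + norm (ell2_apply y i))\<^sup>2"
        by (intro power_mono norm_triangle_ineq) simp
      then show "(norm (ell2_apply (x + y) i))\<^sup>2 \<le> (norm (ell2_apply x i))\<^sup>2 + 2 * ?p i + (norm (ell2_apply y i))\<^sup>2"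
        by (simp add: power2_sum algebra_simps)
    qed
    also have "\<dots> = (norm x)\<^sup>2 + 2 * (\<Sum>\<^sub>\<infinity>i. ?p i) + (norm y)\<^sup>2"
      unfolding sq
      by (simp only: infsum_add summable_on_add summable_on_cmult_right p ell2_norm_square_summable
          infsum_cmult_right')
    also have "(\<Sum>\<^sub>\<infinity>i. ?p i) \<le> norm x * norm y"
      using cauchy_schwarz_infsum(2)[OF ell2_norm_square_summable[of x] ell2_norm_square_summable[of y]]
      by (simp add: norm_ell2_def)
    finally show "(norm (x + y))\<^sup>2 \<le> (norm x + norm y)\<^sup>2"
      by (simp add: power2_sum algebra_simps)
  qed (simp add: norm_ell2_def infsum_nonneg)
qed

end

lemma norm_ell2_square: "(norm x)\<^sup>2 = (\<Sum>\<^sub>\<infinity>i. (norm (ell2_apply x i))\<^sup>2)"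
  by (simp add: norm_ell2_def infsum_nonneg)

lemma ell2_partial_norm_le: "finite F \<Longrightarrow> (\<Sum>i\<in>F. (norm (ell2_apply x i))\<^sup>2) \<le> (norm x)\<^sup>2"
  unfolding norm_ell2_square
  by (intro finite_sum_le_infsum ell2_norm_square_summable) auto

lemma ell2_component_norm_le: "norm (ell2_apply x i) \<le> norm x"
  by (rule power2_le_imp_le) (use ell2_partial_norm_le[of "{i}" x] in auto)

instance ell2 :: (type, complex_hilbert) banach
proof
  fix X :: "nat \<Rightarrow> ('a, 'b) ell2" assume "Cauchy X"
  then have cauchy: "\<exists>N. \<forall>m\<ge>N. \<forall>n\<ge>N. norm (X m - X n) < e" if "e > 0" for e
    using that unfolding Cauchy_def dist_norm by blast
  have "Cauchy (\<lambda>n. ell2_apply (X n) i)" for i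
    unfolding Cauchy_def dist_norm
  proof (intro allI impI)
    fix e :: real assume "e > 0"
    then obtain N where N: "\<And>m n. m \<ge> N \<Longrightarrow> n \<ge> N \<Longrightarrow> norm (X m - X n) < e" using cauchy by blast
    have "norm (ell2_apply (X m) i - ell2_apply (X n) i) < e" if "m \<ge> N" "n \<ge> N" for m n
      using ell2_component_norm_le[of "X m - X n" i] N[OF that] by simp
    then show "\<exists>N. \<forall>m\<ge>N. \<forall>n\<ge>N. norm (ell2_apply (X m) i - ell2_apply (X n) i) < e" by blast
  qed
  then have "\<exists>l. (\<lambda>n. ell2_apply (X n) i) \<longlonglongrightarrow> l" for i
    by (simp add: Cauchy_convergent_iff convergent_def)
  then obtain f where f: "\<And>i. (\<lambda>n. ell2_apply (X n) i) \<longlonglongrightarrow> f i" by metis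
  have tail: "(\<Sum>i\<in>F. (norm (ell2_apply (X n) i - f i))\<^sup>2) \<le> e\<^sup>2"
    if fin: "finite F" and near: "\<And>m. m \<ge> N \<Longrightarrow> norm (X n - X m) < e" for F n N e
  proof (rule tendsto_upperbound)
    show "(\<lambda>m. \<Sum>i\<in>F. (norm (ell2_apply (X n) i - ell2_apply (X m) i))\<^sup>2)
        \<longlonglongrightarrow> (\<Sum>i\<in>F. (norm (ell2_apply (X n) i - f i))\<^sup>2)"
      by (intro tendsto_intros f)
    have "(\<Sum>i\<in>F. (norm (ell2_apply (X n) i - ell2_apply (X m) i))\<^sup>2) \<le> e\<^sup>2" if m: "m \<ge> N" for m
      using order_trans[OF ell2_partial_norm_le[OF fin, of "X n - X m"]
          power_mono[OF less_imp_le[OF near[OF m]] norm_ge_zero, of 2]] by simp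
    then show "\<forall>\<^sub>F m in sequentially. (\<Sum>i\<in>F. (norm (ell2_apply (X n) i - ell2_apply (X m) i))\<^sup>2) \<le> e\<^sup>2"
      unfolding eventually_sequentially by blast
  qed simp
  have tail_l2: "l2_family (\<lambda>i. ell2_apply (X n) i - f i)"
    and tail_norm: "(\<Sum>\<^sub>\<infinity>i. (norm (ell2_apply (X n) i - f i))\<^sup>2) \<le> e\<^sup>2"
    if "\<And>m. m \<ge> N \<Longrightarrow> norm (X n - X m) < e" for n N e
  proof -
    show "l2_family (\<lambda>i. ell2_apply (X n) i - f i)"
      unfolding l2_family_def
      by (rule nonneg_bdd_above_summable_on)
        (use tail[OF _ that] in \<open>auto intro!: bdd_aboveI[where M = "e\<^sup>2"]\<close>)
    then show "(\<Sum>\<^sub>\<infinity>i. (norm (ell2_apply (X n) i - f i))\<^sup>2) \<le> e\<^sup>2"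
      unfolding l2_family_def by (rule infsum_le_finite_sums) (use tail[OF _ that] in auto)
  qed
  obtain N where "\<And>m. m \<ge> N \<Longrightarrow> norm (X N - X m) < 1" using cauchy[of 1] by auto
  then have "l2_family (\<lambda>i. ell2_apply (X N) i - f i)" by (rule tail_l2)
  then have "l2_family (\<lambda>i. ell2_apply (X N) i + (-1) *\<^sub>C (ell2_apply (X N) i - f i))"
    by (intro l2_family_add l2_family_scaleC) simp_all
  then have "l2_family f" by (simp add: cvs.scale_minus_left)
  then have Lf: "ell2_apply (Ell2 f) = f" by (simp add: Ell2_inverse)
  have "X \<longlonglongrightarrow> Ell2 f"
    unfolding LIMSEQ_def
  proof (intro allI impI)
    fix r :: real assume "r > 0"
    then obtain N where N: "\<And>m n. m \<ge> N \<Longrightarrow> n \<ge> N \<Longrightarrow> norm (X m - X n) < r / 2"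
      using cauchy[of "r / 2"] by auto
    have "dist (X n) (Ell2 f) < r" if "n \<ge> N" for n
    proof -
      have "(norm (X n - Ell2 f))\<^sup>2 \<le> (r / 2)\<^sup>2"
        unfolding norm_ell2_square using tail_norm[of N n "r / 2"] N that by (simp add: Lf)
      then have "norm (X n - Ell2 f) \<le> r / 2"
        by (rule power2_le_imp_le) (use \<open>r > 0\<close> in simp)
      then show ?thesis using \<open>r > 0\<close> by (simp add: dist_norm)
    qed
    then show "\<exists>no. \<forall>n\<ge>no. dist (X n) (Ell2 f) < r" by blast
  qed
  then show "convergent X" by (auto simp: convergent_def)
qed

instantiation ell2 :: (type, complex_hilbert) complex_hilbert
begin

definition cinner_ell2 :: "('a, 'b) ell2 \<Rightarrow> ('a, 'b) ell2 \<Rightarrow> complex" where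
  "cinner_ell2 x y = (\<Sum>\<^sub>\<infinity>i. cinner (ell2_apply x i) (ell2_apply y i))"

instance
proof
  fix x y z :: "('a, 'b) ell2" and c :: complex
  show "cinner x y = cnj (cinner y x)"
    unfolding cinner_ell2_def infsum_cnj[symmetric] by (simp flip: cinner_commute)
  show "cinner (x + y) z = cinner x z + cinner y z"
    by (simp add: cinner_ell2_def cinner_add_left infsum_add l2_family_cinner_summable)
  show "cinner (c *\<^sub>C x) y = c * cinner x y"
    by (simp add: cinner_ell2_def cinner_scaleC_left infsum_cmult_right')
  show "cinner x x = complex_of_real ((norm x)\<^sup>2)"
    unfolding norm_ell2_square cinner_ell2_def cinner_self
    by (rule infsumI, rule has_sum_of_real, rule has_sum_infsum, rule ell2_norm_square_summable)
qed

end

lift_definition ell2_single :: "'i \<Rightarrow> 'a::complex_hilbert \<Rightarrow> ('i, 'a) ell2" is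
  "\<lambda>j u i. if i = j then u else 0"
  by (rule l2_family_finite_support) simp

lemma cinner_ell2_single: "cinner (ell2_single j u) x = cinner u (ell2_apply x j)"
proof -
  have "cinner (ell2_single j u) x = (\<Sum>\<^sub>\<infinity>i\<in>{j}. cinner u (ell2_apply x i))"
    unfolding cinner_ell2_def by (rule infsum_cong_neutral) (auto simp: ell2_single.rep_eq)
  then show ?thesis by simp
qed

lemma norm_ell2_single: "norm (ell2_single j u) = norm u"
proof -
  have "cinner (ell2_single j u) (ell2_single j u) = cinner u u"
    by (simp add: cinner_ell2_single ell2_single.rep_eq)
  then have "(norm (ell2_single j u))\<^sup>2 = (norm u)\<^sup>2"
    by (simp only: cinner_self of_real_eq_iff)
  then show ?thesis by simp
qed

text \<open>The vectors supported at one index span a dense subspace; comparing the adjoints componentwise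
uses this without mentioning density.\<close>

lemma ell2_bop_eqI:
  fixes P Q :: "('i, 'a::complex_hilbert) ell2 bop"
  assumes "\<And>j u. bop_apply P (ell2_single j u) = bop_apply Q (ell2_single j u)"
  shows "P = Q"
proof -
  have "adj P = adj Q"
  proof (rule bop_eqI, rule ell2_eqI, rule cinner_ext_right)
    fix x :: "('i, 'a) ell2" and j u
    show "cinner u (ell2_apply (bop_apply (adj P) x) j) = cinner u (ell2_apply (bop_apply (adj Q) x) j)"
      by (simp flip: cinner_ell2_single adj_eq add: assms)
  qed
  then show ?thesis by (metis adj_adj)
qed

section \<open>Amplifications of irreducible semigroups\<close>

lemma amplification_exists:
  "\<exists>\<A> :: ('i, 'a::complex_hilbert) ell2 bop. \<forall>x i. ell2_apply (bop_apply \<A> x) i = bop_apply A (ell2_apply x i)"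
proof -
  define f where "f x = Ell2 (\<lambda>i. bop_apply A (ell2_apply x i))" for x :: "('i, 'a) ell2"
  have f: "ell2_apply (f x) i = bop_apply A (ell2_apply x i)" for x i
    unfolding f_def by (subst Ell2_inverse) (simp_all add: l2_family_apply)
  obtain c where c: "c > 0" "\<And>x. norm (bop_apply A x) \<le> c * norm x" using bop_bound[of A] by blast
  have "norm (f x) \<le> c * norm x" for x
  proof (rule power2_le_imp_le)
    have "(norm (f x))\<^sup>2 \<le> (\<Sum>\<^sub>\<infinity>i. c\<^sup>2 * (norm (ell2_apply x i))\<^sup>2)"
      unfolding norm_ell2_square
    proof (rule infsum_mono[OF ell2_norm_square_summable])
      show "(\<lambda>i. c\<^sup>2 * (norm (ell2_apply x i))\<^sup>2) summable_on UNIV"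
        by (intro summable_on_cmult_right ell2_norm_square_summable)
      show "(norm (ell2_apply (f x) i))\<^sup>2 \<le> c\<^sup>2 * (norm (ell2_apply x i))\<^sup>2" for i
        using power_mono[OF c(2) norm_ge_zero, of "ell2_apply x i" 2] by (simp add: f power_mult_distrib)
    qed
    also have "\<dots> = (c * norm x)\<^sup>2"
      by (simp add: infsum_cmult_right' norm_ell2_square power_mult_distrib)
    finally show "(norm (f x))\<^sup>2 \<le> (c * norm x)\<^sup>2" .
  qed (use c in simp)
  moreover have "f (x + y) = f x + f y" "f (a *\<^sub>C x) = a *\<^sub>C f x" for x y a
    by (rule ell2_eqI, simp add: f)+
  ultimately obtain \<A> where "bop_apply \<A> = f" using bop_construct[of f c] by blast
  then show ?thesis using f by auto
qed

definition amplify :: "'a::complex_hilbert bop \<Rightarrow> ('i, 'a) ell2 bop" where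
  "amplify A = (SOME \<A>. \<forall>x i. ell2_apply (bop_apply \<A> x) i = bop_apply A (ell2_apply x i))"

lemma amplify_apply [simp]:
  fixes x :: "('b, 'a::complex_hilbert) ell2"
  shows "ell2_apply (bop_apply (amplify A) x) i = bop_apply A (ell2_apply x i)"
proof -
  have "\<forall>x i. ell2_apply (bop_apply (amplify A :: ('b, 'a) ell2 bop) x) i = bop_apply A (ell2_apply x i)"
    unfolding amplify_def by (rule someI_ex[OF amplification_exists])
  then show ?thesis by blast
qed

lemma adj_amplify: "adj (amplify A) = amplify (adj A)"
  by (rule adj_unique) (simp add: cinner_ell2_def adj_eq)

lemma amplify_times: "amplify (A * B) = amplify A * amplify B"
  by (rule bop_eqI, rule ell2_eqI) simp

lemma amplify_single: "bop_apply (amplify A) (ell2_single j u) = ell2_single j (bop_apply A u)"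
  by (rule ell2_eqI) (simp add: ell2_single.rep_eq)

text \<open>The entries of the operator matrix of \<open>P\<close> commute with \<open>\<G>\<close>, hence are scalars. A matrix of scalars
commutes with every diagonal amplification.\<close>

lemma commute_amplify_of_entries:
  fixes P :: "('i, 'a::complex_hilbert) ell2 bop"
  assumes P: "\<And>A. A \<in> \<G> \<Longrightarrow> P * amplify A = amplify A * P"
    and scalar: "commutant \<G> \<subseteq> range (\<lambda>c. c *\<^sub>C 1)"
  shows "P * amplify B = amplify B * P"
proof (rule ell2_bop_eqI, rule ell2_eqI)
  fix j i and u :: 'a
  obtain p where p: "bop_apply p = (\<lambda>u. ell2_apply (bop_apply P (ell2_single j u)) i)"
  proof -
    obtain c where c: "c > 0" "\<And>x. norm (bop_apply P x) \<le> c * norm x" using bop_bound[of P] by blast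
    have s: "ell2_single j (u + v) = ell2_single j u + ell2_single j v"
      "ell2_single j (a *\<^sub>C u) = a *\<^sub>C ell2_single j u" for u v :: 'a and a
      by (rule ell2_eqI, simp add: ell2_single.rep_eq)+
    have "norm (ell2_apply (bop_apply P (ell2_single j u)) i) \<le> c * norm u" for u
      using ell2_component_norm_le[of "bop_apply P (ell2_single j u)" i] c(2)[of "ell2_single j u"]
      by (simp add: norm_ell2_single)
    note bound = this
    show thesis
    proof (rule bop_construct[of "\<lambda>u. ell2_apply (bop_apply P (ell2_single j u)) i" c])
      fix p assume "bop_apply p = (\<lambda>u. ell2_apply (bop_apply P (ell2_single j u)) i)"
      then show thesis by (rule that)
    qed (simp_all add: s bound)
  qed
  have "p * A = A * p" if "A \<in> \<G>" for A
  proof (rule bop_eqI)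
    fix u
    have "bop_apply P (bop_apply (amplify A) (ell2_single j u)) = bop_apply (amplify A) (bop_apply P (ell2_single j u))"
      using P[OF that] by (metis apply_times_op)
    then show "bop_apply (p * A) u = bop_apply (A * p) u"
      by (simp add: p amplify_single)
  qed
  then have "p \<in> commutant \<G>" by (simp add: commutant_def)
  then obtain c where "p = c *\<^sub>C 1" using scalar by blast
  then have "bop_apply p (bop_apply B u) = bop_apply B (bop_apply p u)" by simp
  then show "ell2_apply (bop_apply (P * amplify B) (ell2_single j u)) i
      = ell2_apply (bop_apply (amplify B * P) (ell2_single j u)) i"
    by (simp add: p amplify_single)
qed

text \<open>Expanding \<open>T = \<Sum>\<^sub>i x\<^sub>i \<boxtimes> y\<^sub>i\<close>, the functional \<open>A \<mapsto> trace (A T)\<close> becomes the matrix coefficient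
\<open>(A \<xi>|\<eta>)\<close> of the amplification of \<open>A\<close>, with \<open>\<xi> = (x\<^sub>i)\<close> and \<open>\<eta> = (y\<^sub>i)\<close>. The projection onto the
closed span of \<open>\<G> \<xi>\<close> commutes with the amplification of \<open>\<G>\<close> and therefore with that of every
operator \<open>B\<close>. As it fixes \<open>\<xi>\<close>, the vector \<open>B \<xi>\<close> lies in that closed span too, to which \<open>\<eta>\<close>
is orthogonal.\<close>

lemma trace_vanishes_of_irreducible:
  fixes \<G> :: "'a::complex_hilbert bop set"
  assumes one: "1 \<in> \<G>" and mult: "\<And>A B. A \<in> \<G> \<Longrightarrow> B \<in> \<G> \<Longrightarrow> A * B \<in> \<G>"
    and adj: "\<And>A. A \<in> \<G> \<Longrightarrow> adj A \<in> \<G>"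
    and scalar: "commutant \<G> \<subseteq> range (\<lambda>c. c *\<^sub>C 1)"
    and T: "T \<in> trace_class" and vanish: "\<And>A. A \<in> \<G> \<Longrightarrow> trace (A * T) = 0"
  shows "trace (B * T) = 0"
proof -
  obtain x y :: "'a \<Rightarrow> 'a" where xy: "represents x y T" using T by (rule trace_class_represents)
  define \<xi> where "\<xi> = Ell2 x"
  define \<eta> where "\<eta> = Ell2 y"
  have ap: "ell2_apply \<xi> = x" "ell2_apply \<eta> = y"
    using representsD(1,2)[OF xy] by (simp_all add: \<xi>_def \<eta>_def Ell2_inverse)
  have tr: "trace (A * T) = cinner (bop_apply (amplify A) \<xi>) \<eta>" for A
    using represents_trace[OF represents_mult_left[OF xy]] by (simp add: cinner_ell2_def ap)
  define L where "L = cvs.span ((\<lambda>A. bop_apply (amplify A) \<xi>) ` \<G>)"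
  have L: "cvs.subspace L" by (simp add: L_def)
  have inv: "bop_apply (amplify A) l \<in> L" if A: "A \<in> \<G>" and l: "l \<in> L" for A l
    using l unfolding L_def
  proof (induction rule: cvs.span_induct_alt)
    case base
    then show ?case by (simp add: cvs.span_zero)
  next
    case (step c l k)
    then obtain C where "C \<in> \<G>" "l = bop_apply (amplify C) \<xi>" by blast
    then have "bop_apply (amplify A) l \<in> (\<lambda>A. bop_apply (amplify A) \<xi>) ` \<G>"
      using mult[OF A, of C] by (auto simp: amplify_times intro!: image_eqI[of _ _ "A * C"])
    then show ?case
      using step by (simp add: cvs.span_add cvs.span_scale cvs.span_base)
  qed
  obtain P where P: "\<And>x. bop_apply P x \<in> closure L" "\<And>x. x \<in> closure L \<Longrightarrow> bop_apply P x = x"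
    "\<And>A. (\<And>l. l \<in> L \<Longrightarrow> bop_apply A l \<in> L) \<Longrightarrow> (\<And>l. l \<in> L \<Longrightarrow> bop_apply (adj A) l \<in> L) \<Longrightarrow> P * A = A * P"
    using orthogonal_projection[OF L] by metis
  have "P * amplify A = amplify A * P" if "A \<in> \<G>" for A
    by (rule P(3)) (use that inv adj in \<open>simp_all add: adj_amplify\<close>)
  then have comm: "P * amplify B = amplify B * P"
    using scalar by (rule commute_amplify_of_entries)
  have "bop_apply (amplify 1) \<xi> = \<xi>" by (rule ell2_eqI) simp
  then have "\<xi> \<in> L" unfolding L_def using one by (intro cvs.span_base) force
  then have "bop_apply P \<xi> = \<xi>" by (intro P(2)) (use closure_subset in blast)
  then have "bop_apply (amplify B) \<xi> = bop_apply P (bop_apply (amplify B) \<xi>)"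
    using comm by (metis apply_times_op)
  then have "bop_apply (amplify B) \<xi> \<in> closure L" using P(1) by metis
  moreover have "cinner l \<eta> = 0" if "l \<in> L" for l
    using that unfolding L_def
    by (induction rule: cvs.span_induct_alt) (auto simp: cinner_add_left cinner_scaleC_left vanish simp flip: tr)
  ultimately have "cinner (bop_apply (amplify B) \<xi>) \<eta> = 0" by (rule orthogonal_closure[rotated])
  then show ?thesis by (simp add: tr)
qed

section \<open>Normal maps and their preduals\<close>

lemma generated_topology_nbhd:
  fixes g :: "'k \<Rightarrow> 'b \<Rightarrow> complex"
  assumes "openin (topology_generated_by {{A. g k A \<in> U} |k U. k \<in> K \<and> open U}) W" and "A\<^sub>0 \<in> W"
  shows "\<exists>F \<delta>. finite F \<and> F \<subseteq> K \<and> \<delta> > 0 \<and> (\<forall>A. (\<forall>k\<in>F. dist (g k A) (g k A\<^sub>0) < \<delta>) \<longrightarrow> A \<in> W)"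
  using assms unfolding openin_topology_generated_by_iff
proof (induction rule: generate_topology_on.induct)
  case (Int V W)
  then have mem: "A\<^sub>0 \<in> V" "A\<^sub>0 \<in> W" by auto
  obtain F \<delta> where F: "finite F \<and> F \<subseteq> K \<and> \<delta> > 0 \<and> (\<forall>A. (\<forall>k\<in>F. dist (g k A) (g k A\<^sub>0) < \<delta>) \<longrightarrow> A \<in> V)"
    using Int.IH(1)[OF mem(1)] by blast
  obtain G \<epsilon> where G: "finite G \<and> G \<subseteq> K \<and> \<epsilon> > 0 \<and> (\<forall>A. (\<forall>k\<in>G. dist (g k A) (g k A\<^sub>0) < \<epsilon>) \<longrightarrow> A \<in> W)"
    using Int.IH(2)[OF mem(2)] by blast
  show ?case
    by (rule exI[of _ "F \<union> G"], rule exI[of _ "min \<delta> \<epsilon>"]) (use F G in auto)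
next
  case (UN \<W>)
  then obtain W where "W \<in> \<W>" "A\<^sub>0 \<in> W" by blast
  then show ?case using UN.IH[of W] by blast
next
  case (Basis W)
  then obtain k U where W: "W = {A. g k A \<in> U}" "k \<in> K" "open U" by blast
  then obtain \<delta> where "\<delta> > 0" "\<And>z. dist z (g k A\<^sub>0) < \<delta> \<Longrightarrow> z \<in> U"
    using Basis.prems unfolding open_dist by blast
  then show ?case
    using W by (intro exI[of _ "{k}"] exI[of _ \<delta>]) auto
qed simp

lemma sigma_weak_nbhd:
  assumes "openin sigma_weak_topology W" "A\<^sub>0 \<in> W"
  shows "\<exists>F \<delta>. finite F \<and> F \<subseteq> trace_class \<and> \<delta> > 0 \<and>
    (\<forall>A. (\<forall>T\<in>F. dist (trace (A * T)) (trace (A\<^sub>0 * T)) < \<delta>) \<longrightarrow> A \<in> W)"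
  using generated_topology_nbhd[of "\<lambda>T A. trace (A * T)"] assms
  unfolding sigma_weak_topology_def by blast

lemma weak_operator_nbhd:
  fixes W :: "'a::complex_hilbert bop set"
  assumes "openin weak_operator_topology W" "A\<^sub>0 \<in> W"
  shows "\<exists>F \<delta>. finite F \<and> \<delta> > 0 \<and>
    (\<forall>A. (\<forall>(x, y)\<in>F. dist (cinner (bop_apply A x) y) (cinner (bop_apply A\<^sub>0 x) y) < \<delta>) \<longrightarrow> A \<in> W)"
proof -
  have "{{A::'a bop. cinner (bop_apply A x) y \<in> U} |x y U. open U}
      = {{A. cinner (bop_apply A (fst k)) (snd k) \<in> U} |k U. k \<in> UNIV \<and> open U}"
    by auto
  then show ?thesis
    using generated_topology_nbhd[of "\<lambda>k A. cinner (bop_apply A (fst k)) (snd k)" UNIV W A\<^sub>0] assms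
    unfolding weak_operator_topology_def by (simp add: case_prod_unfold)
qed

text \<open>A linear functional that vanishes on the common kernel of finitely many others is a linear
combination of them; here the others are \<open>X \<mapsto> trace (X T)\<close>, and a combination is again of this form.\<close>

lemma functional_in_span_of_traces:
  fixes f :: "'a::complex_hilbert bop \<Rightarrow> complex"
  assumes "finite F" "F \<subseteq> trace_class"
    and "\<And>X Y. f (X + Y) = f X + f Y" "\<And>c X. f (c *\<^sub>C X) = c * f X"
    and "\<And>X. (\<forall>T\<in>F. trace (X * T) = 0) \<Longrightarrow> f X = 0"
  shows "\<exists>S\<in>trace_class. \<forall>X. f X = trace (X * S)"
  using assms
proof (induction F arbitrary: f rule: finite_induct)
  case empty
  then show ?case by (intro bexI[of _ 0]) auto
next
  case (insert T F)
  have T: "T \<in> trace_class" and F: "F \<subseteq> trace_class" using insert.prems(1) by auto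
  have lin: "trace ((X + Y) * S) = trace (X * S) + trace (Y * S)" "trace ((c *\<^sub>C X) * S) = c * trace (X * S)"
    if "S \<in> trace_class" for X Y S :: "'a bop" and c
  proof -
    show "trace ((X + Y) * S) = trace (X * S) + trace (Y * S)"
      using that by (simp add: distrib_right trace_add trace_class_mult_left)
    have "(c *\<^sub>C X) * S = c *\<^sub>C (X * S)" by (rule bop_eqI) simp
    then show "trace ((c *\<^sub>C X) * S) = c * trace (X * S)" by (simp add: trace_scaleC)
  qed
  show ?case
  proof (cases "\<forall>X. (\<forall>S\<in>F. trace (X * S) = 0) \<longrightarrow> trace (X * T) = 0")
    case True
    then show ?thesis
      using insert.IH[OF F insert.prems(2,3)] insert.prems(4) by blast
  next
    case False
    then obtain X\<^sub>0 where X0: "\<And>S. S \<in> F \<Longrightarrow> trace (X\<^sub>0 * S) = 0" "trace (X\<^sub>0 * T) \<noteq> 0" by blast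
    \<comment> \<open>Subtracting this multiple of \<open>X \<mapsto> trace (X T)\<close> makes the functional vanish on the common kernel of \<open>F\<close> alone.\<close>
    define a where "a = f X\<^sub>0 / trace (X\<^sub>0 * T)"
    have "\<exists>S\<in>trace_class. \<forall>X. f X - a * trace (X * T) = trace (X * S)"
    proof (rule insert.IH[OF F])
      fix X assume X: "\<forall>S\<in>F. trace (X * S) = 0"
      define b where "b = - trace (X * T) / trace (X\<^sub>0 * T)"
      have "trace ((X + b *\<^sub>C X\<^sub>0) * S) = 0" if "S \<in> insert T F" for S
      proof -
        have S: "S \<in> trace_class" using that T F by auto
        have "trace ((X + b *\<^sub>C X\<^sub>0) * S) = trace (X * S) + b * trace (X\<^sub>0 * S)"
          by (simp only: lin[OF S])
        then show ?thesis using that X X0 by (auto simp: b_def)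
      qed
      then have "f (X + b *\<^sub>C X\<^sub>0) = 0" by (intro insert.prems(4)) blast
      then have "f X + b * f X\<^sub>0 = 0" by (simp only: insert.prems(2,3))
      then show "f X - a * trace (X * T) = 0"
        using X0(2) by (simp add: a_def b_def field_simps)
    next
      show "f (X + Y) - a * trace ((X + Y) * T) = f X - a * trace (X * T) + (f Y - a * trace (Y * T))" for X Y
        unfolding lin(1)[OF T] insert.prems(2) by algebra
      show "f (c *\<^sub>C X) - a * trace ((c *\<^sub>C X) * T) = c * (f X - a * trace (X * T))" for c X
        unfolding lin(2)[OF T] insert.prems(3) by algebra
    qed
    then obtain S where S: "S \<in> trace_class" "\<And>X. f X - a * trace (X * T) = trace (X * S)" by blast
    have aT: "a *\<^sub>C T \<in> trace_class" by (rule trace_class_scaleC[OF T])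
    have "f X = trace (X * (S + a *\<^sub>C T))" for X
    proof -
      have "X * (S + a *\<^sub>C T) = X * S + a *\<^sub>C (X * T)" by (rule bop_eqI) simp
      then have "trace (X * (S + a *\<^sub>C T)) = trace (X * S) + a * trace (X * T)"
        using S(1) T by (simp add: trace_add trace_class_mult_left trace_class_scaleC trace_scaleC)
      then show ?thesis using S(2)[of X] by (simp add: algebra_simps)
    qed
    then show ?thesis using trace_class_add[OF S(1) aT] by blast
  qed
qed

text \<open>If \<open>\<Phi>\<close> is normal, then \<open>X \<mapsto> trace (\<Phi>(X) T)\<close> is bounded by \<open>1\<close> on a basic neighbourhood of \<open>0\<close>, so by
homogeneity it vanishes on the common kernel of the finitely many functionals that define the
neighbourhood. With this characterization closure properties of normal maps become algebra.\<close>

lemma normal_map_iff_predual: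
  fixes \<Phi> :: "'a::complex_hilbert bop \<Rightarrow> 'a bop"
  shows "normal_map \<Phi> \<longleftrightarrow> clinear \<Phi> \<and> (\<forall>T\<in>trace_class. \<exists>S\<in>trace_class. \<forall>X. trace (\<Phi> X * T) = trace (X * S))"
proof (intro iffI conjI ballI)
  assume \<Phi>: "normal_map \<Phi>"
  then show cl: "clinear \<Phi>" by (simp add: normal_map_def)
  fix T :: "'a bop" assume T: "T \<in> trace_class"
  define f where "f X = trace (\<Phi> X * T)" for X
  have f_add: "f (X + Y) = f X + f Y" for X Y
    using T by (simp add: f_def clinear_add[OF cl] distrib_right trace_add trace_class_mult_left)
  have f_scale: "f (c *\<^sub>C X) = c * f X" for c X
  proof -
    have "(c *\<^sub>C \<Phi> X) * T = c *\<^sub>C (\<Phi> X * T)" by (rule bop_eqI) simp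
    then show ?thesis by (simp add: f_def clinear_scaleC[OF cl] trace_scaleC)
  qed
  have top: "topspace sigma_weak_topology = (UNIV :: 'a bop set)"
  proof -
    have "(UNIV :: 'a bop set) \<in> {{A. trace (A * T) \<in> U} |T U. T \<in> trace_class \<and> open U}"
      by (intro CollectI exI[of _ 0] exI[of _ UNIV]) auto
    then show ?thesis unfolding sigma_weak_topology_def by auto
  qed
  have "openin sigma_weak_topology {A. trace (A * T) \<in> ball 0 1}"
    unfolding sigma_weak_topology_def by (rule topology_generated_by_Basis) (use T in blast)
  then have "openin sigma_weak_topology {X \<in> topspace sigma_weak_topology. \<Phi> X \<in> {A. trace (A * T) \<in> ball 0 1}}"
    using \<Phi> unfolding normal_map_def by (blast intro: openin_continuous_map_preimage)
  then have "openin sigma_weak_topology {X. f X \<in> ball 0 1}"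
    by (simp add: top f_def)
  moreover have "f 0 = 0" using f_scale[of 0 0] by simp
  then have "0 \<in> {X. f X \<in> ball 0 1}" by simp
  ultimately obtain F \<delta> where F: "finite F" "F \<subseteq> trace_class" "\<delta> > 0"
    and nb: "\<And>X. (\<forall>S\<in>F. dist (trace (X * S)) (trace (0 * S)) < \<delta>) \<Longrightarrow> f X \<in> ball 0 1"
    using sigma_weak_nbhd[of "{X. f X \<in> ball 0 1}" 0] by auto
  have "\<exists>S\<in>trace_class. \<forall>X. f X = trace (X * S)"
  proof (rule functional_in_span_of_traces[OF F(1,2) f_add f_scale])
    fix X assume X: "\<forall>S\<in>F. trace (X * S) = 0"
    show "f X = 0"
    proof (rule ccontr)
      assume "f X \<noteq> 0"
      have "trace (((1 / f X) *\<^sub>C X) * S) = 0" if "S \<in> F" for S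
      proof -
        have "((1 / f X) *\<^sub>C X) * S = (1 / f X) *\<^sub>C (X * S)" by (rule bop_eqI) simp
        then show ?thesis using X that by (simp add: trace_scaleC)
      qed
      then have "f ((1 / f X) *\<^sub>C X) \<in> ball 0 1" using F(3) by (intro nb) auto
      then show False using \<open>f X \<noteq> 0\<close> by (simp add: f_scale)
    qed
  qed
  then show "\<exists>S\<in>trace_class. \<forall>X. trace (\<Phi> X * T) = trace (X * S)" by (simp add: f_def)
next
  assume *: "clinear \<Phi> \<and> (\<forall>T\<in>trace_class. \<exists>S\<in>trace_class. \<forall>X. trace (\<Phi> X * T) = trace (X * S))"
  let ?B = "{{A :: 'a bop. trace (A * T) \<in> U} |T U. T \<in> trace_class \<and> open U}"
  have top: "UNIV \<in> ?B"
    by (intro CollectI exI[of _ 0] exI[of _ UNIV]) auto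
  have "continuous_map sigma_weak_topology sigma_weak_topology \<Phi>"
    unfolding sigma_weak_topology_def
  proof (rule continuous_on_generated_topo)
    show "\<Phi> ` topspace (topology_generated_by ?B) \<subseteq> \<Union> ?B" using top by blast
    fix W assume "W \<in> ?B"
    then obtain T U where W: "W = {A. trace (A * T) \<in> U}" "T \<in> trace_class" "open U" by blast
    then obtain S where S: "S \<in> trace_class" "\<And>X. trace (\<Phi> X * T) = trace (X * S)" using * by blast
    have "\<Phi> -` W \<inter> topspace (topology_generated_by ?B) = {A. trace (A * S) \<in> U}"
      using top by (auto simp: W S)
    also have "openin (topology_generated_by ?B) \<dots>"
      by (rule topology_generated_by_Basis) (use S W in blast)
    finally show "openin (topology_generated_by ?B) (\<Phi> -` W \<inter> topspace (topology_generated_by ?B))" .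
  qed
  then show "normal_map \<Phi>" using * by (simp add: normal_map_def)
qed

lemma predual_map:
  assumes "normal_map \<Phi>" "T \<in> trace_class"
  shows "predual_map \<Phi> T \<in> trace_class" "trace (A * predual_map \<Phi> T) = trace (\<Phi> A * T)"
proof -
  obtain S where S: "S \<in> trace_class" "\<And>A. trace (\<Phi> A * T) = trace (A * S)"
    using assms unfolding normal_map_iff_predual by blast
  have "predual_map \<Phi> T = S"
    unfolding predual_map_def
  proof (rule the_equality)
    fix S' assume "S' \<in> trace_class \<and> (\<forall>A. trace (A * S') = trace (\<Phi> A * T))"
    then show "S' = S" by (intro trace_ext) (simp add: S(2))
  qed (simp add: S)
  then show "predual_map \<Phi> T \<in> trace_class" "trace (A * predual_map \<Phi> T) = trace (\<Phi> A * T)"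
    using S by simp_all
qed

lemma predual_map_eqI:
  assumes "normal_map \<Phi>" "T \<in> trace_class" "\<And>A. trace (A * S) = trace (\<Phi> A * T)"
  shows "predual_map \<Phi> T = S"
  by (rule trace_ext) (simp add: predual_map(2)[OF assms(1,2)] assms(3))

lemma normal_map_compose:
  assumes "normal_map \<Phi>" "normal_map \<Psi>"
  shows "normal_map (\<lambda>X. \<Phi> (\<Psi> X))"
  unfolding normal_map_def
proof
  show "clinear (\<lambda>X. \<Phi> (\<Psi> X))"
    using assms unfolding normal_map_def by (intro clinearI) (simp_all add: clinear_add clinear_scaleC)
  show "continuous_map sigma_weak_topology sigma_weak_topology (\<lambda>X. \<Phi> (\<Psi> X))"
    using assms continuous_map_compose[of sigma_weak_topology sigma_weak_topology \<Psi> sigma_weak_topology \<Phi>]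
    unfolding normal_map_def by (simp add: comp_def)
qed

lemma normal_map_sandwich: "normal_map (\<lambda>X. C * X * D)"
  unfolding normal_map_iff_predual
proof (intro conjI ballI)
  show "clinear (\<lambda>X. C * X * D)"
    by (rule clinearI; rule bop_eqI) simp_all
  fix T :: "'a bop" assume T: "T \<in> trace_class"
  have "trace (C * X * D * T) = trace (X * (D * T * C))" for X
    using trace_mult_commute[of "X * (D * T)" C] T
    by (simp add: trace_class_mult_left mult.assoc)
  then show "\<exists>S\<in>trace_class. \<forall>X. trace (C * X * D * T) = trace (X * S)"
    using T by (intro bexI[of _ "D * T * C"]) (simp_all add: trace_class_mult_left trace_class_mult_right)
qed

lemma normal_map_zero: "normal_map (\<lambda>_. 0)"
  using normal_map_sandwich[of 0 0] by simp

lemma normal_map_add: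
  assumes "normal_map \<Phi>" "normal_map \<Psi>"
  shows "normal_map (\<lambda>X. \<Phi> X + \<Psi> X)"
  unfolding normal_map_iff_predual
proof (intro conjI ballI)
  show "clinear (\<lambda>X. \<Phi> X + \<Psi> X)"
    using assms unfolding normal_map_def
    by (intro clinearI) (simp_all add: clinear_add clinear_scaleC scaleC_add_right)
  fix T :: "'a bop" assume T: "T \<in> trace_class"
  note p = predual_map[OF assms(1) T] predual_map[OF assms(2) T]
  show "\<exists>S\<in>trace_class. \<forall>X. trace ((\<Phi> X + \<Psi> X) * T) = trace (X * S)"
    by (intro bexI[of _ "predual_map \<Phi> T + predual_map \<Psi> T"])
      (simp_all add: p T distrib_left distrib_right trace_add trace_class_mult_left trace_class_add)
qed

lemma normal_map_sum:
  "(\<And>i. i \<in> I \<Longrightarrow> normal_map (\<Phi> i)) \<Longrightarrow> normal_map (\<lambda>X. \<Sum>i\<in>I. \<Phi> i X)"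
  by (induction I rule: infinite_finite_induct) (simp_all add: normal_map_zero normal_map_add)

text \<open>The difference of the predual operators of \<open>u \<boxtimes> v\<close> annihilates \<open>\<G>\<close> under the trace pairing.\<close>

lemma normal_maps_eqI:
  fixes \<G> :: "'a::complex_hilbert bop set"
  assumes "normal_map \<Phi>" "normal_map \<Psi>"
    and G: "1 \<in> \<G>" "\<And>A B. A \<in> \<G> \<Longrightarrow> B \<in> \<G> \<Longrightarrow> A * B \<in> \<G>"
      "\<And>A. A \<in> \<G> \<Longrightarrow> adj A \<in> \<G>" "commutant \<G> \<subseteq> range (\<lambda>c. c *\<^sub>C 1)"
    and eq: "\<And>A. A \<in> \<G> \<Longrightarrow> \<Phi> A = \<Psi> A"
  shows "\<Phi> X = \<Psi> X"
proof (rule bop_eqI_cinner)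
  fix u v
  define S where "S = predual_map \<Phi> (rank_one u v)"
  define S' where "S' = predual_map \<Psi> (rank_one u v)"
  note p = predual_map[OF assms(1) trace_class_rank_one[of u v], folded S_def]
    predual_map[OF assms(2) trace_class_rank_one[of u v], folded S'_def]
  have S'n: "- S' = (- 1) *\<^sub>C S'" by (rule bop_eqI) (simp add: cvs.scale_minus_left)
  have D: "S - S' \<in> trace_class"
    using trace_class_add[OF p(1) trace_class_scaleC[OF p(3), of "-1"]]
    unfolding S'n[symmetric] by (simp only: add_uminus_conv_diff)
  have tr: "trace (A * (S - S')) = trace (\<Phi> A * rank_one u v) - trace (\<Psi> A * rank_one u v)" for A
    by (simp add: right_diff_distrib trace_diff trace_class_mult_left p)
  have "trace (X * (S - S')) = 0"
  proof (rule trace_vanishes_of_irreducible[OF G D])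
    show "trace (A * (S - S')) = 0" if "A \<in> \<G>" for A
      unfolding tr eq[OF that] by simp
  qed
  then show "cinner (bop_apply (\<Phi> X) u) v = cinner (bop_apply (\<Psi> X) u) v"
    by (simp add: tr trace_mult_rank_one)
qed

section \<open>Commutants and dense orbits\<close>

lemma commutantI: "(\<And>B. B \<in> N \<Longrightarrow> A * B = B * A) \<Longrightarrow> A \<in> commutant N"
  by (simp add: commutant_def)

lemma commutantD: "A \<in> commutant N \<Longrightarrow> B \<in> N \<Longrightarrow> A * B = B * A"
  by (simp add: commutant_def)

lemma commutant_algebra:
  "1 \<in> commutant N"
  "A \<in> commutant N \<Longrightarrow> B \<in> commutant N \<Longrightarrow> A + B \<in> commutant N"
  "A \<in> commutant N \<Longrightarrow> B \<in> commutant N \<Longrightarrow> A * B \<in> commutant N"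
  "A \<in> commutant N \<Longrightarrow> c *\<^sub>C A \<in> commutant N"
proof -
  show "1 \<in> commutant N" by (simp add: commutant_def)
  show "A + B \<in> commutant N" if "A \<in> commutant N" "B \<in> commutant N"
    using that by (simp add: commutant_def distrib_left distrib_right)
  show "A * B \<in> commutant N" if "A \<in> commutant N" "B \<in> commutant N"
  proof (rule commutantI)
    fix C assume "C \<in> N"
    then have "A * C = C * A" "B * C = C * B" using that commutantD by blast+
    then show "A * B * C = C * (A * B)" by (metis mult.assoc)
  qed
  show "c *\<^sub>C A \<in> commutant N" if "A \<in> commutant N"
  proof (rule commutantI)
    fix B assume "B \<in> N"
    then have "A * B = B * A" using that by (rule commutantD[rotated])
    then show "(c *\<^sub>C A) * B = B * (c *\<^sub>C A)"
      by (intro bop_eqI) (metis apply_scaleC_op apply_times_op bop_scaleC)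
  qed
qed

lemma commutant_adj:
  assumes "\<And>B. B \<in> N \<Longrightarrow> adj B \<in> N" and A: "A \<in> commutant N"
  shows "adj A \<in> commutant N"
proof (rule commutantI)
  fix B assume "B \<in> N"
  then have "A * adj B = adj B * A" using assms by (intro commutantD)
  then have "adj (A * adj B) = adj (adj B * A)" by simp
  then show "adj A * B = B * adj A" by (simp add: adj_times)
qed

text \<open>The projection \<open>P\<close> onto the closure of the orbit commutes with the commutant, so \<open>1 - P\<close> belongs to
\<open>M\<close>. It kills \<open>x\<close> and is therefore zero.\<close>

lemma cyclic_for_commutant:
  assumes M: "von_neumann_algebra M" and sep: "separating_vector M x"
  shows "cyclic_vector (commutant M) x"
proof -
  let ?L = "(\<lambda>A. bop_apply A x) ` commutant M"
  have L: "cvs.subspace ?L"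
    unfolding cvs.subspace_def
  proof (intro conjI ballI allI)
    have "(0::'a bop) \<in> commutant M" by (simp add: commutant_def)
    then show "0 \<in> ?L" by force
    show "u + v \<in> ?L" if "u \<in> ?L" "v \<in> ?L" for u v
      using that commutant_algebra(2)[of _ M] by (auto simp flip: apply_add_op)
    show "c *\<^sub>C u \<in> ?L" if "u \<in> ?L" for c u
      using that commutant_algebra(4)[of _ M] by (auto simp flip: apply_scaleC_op)
  qed
  obtain P where P: "\<And>u. bop_apply P u \<in> closure ?L" "\<And>u. u \<in> closure ?L \<Longrightarrow> bop_apply P u = u"
    "\<And>A. (\<And>l. l \<in> ?L \<Longrightarrow> bop_apply A l \<in> ?L) \<Longrightarrow> (\<And>l. l \<in> ?L \<Longrightarrow> bop_apply (adj A) l \<in> ?L) \<Longrightarrow> P * A = A * P"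
    using orthogonal_projection[OF L] by metis
  have inv: "bop_apply A l \<in> ?L" if "A \<in> commutant M" "l \<in> ?L" for A l
    using that commutant_algebra(3)[of A M] by (auto simp flip: apply_times_op)
  have "P \<in> commutant (commutant M)"
  proof (rule commutantI)
    fix A assume A: "A \<in> commutant M"
    then have "adj A \<in> commutant M"
      using M by (intro commutant_adj) (auto simp: von_neumann_algebra_def)
    then show "P * A = A * P" by (intro P(3) inv A)
  qed
  moreover have "1 + (-1) *\<^sub>C P \<in> commutant (commutant M)"
    by (intro commutant_algebra calculation)
  ultimately have "1 + (-1) *\<^sub>C P \<in> M"
    using M by (simp add: von_neumann_algebra_def)
  moreover have "x \<in> closure ?L"
    using commutant_algebra(1)[of M] closure_subset[of ?L] by force
  then have "bop_apply (1 + (-1) *\<^sub>C P) x = 0" by (simp add: P(2) cvs.scale_minus_left)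
  ultimately have "1 + (-1) *\<^sub>C P = 0" using sep unfolding separating_vector_def by blast
  then have "bop_apply (1 + (-1) *\<^sub>C P) u = 0" for u by simp
  then have "bop_apply P u = u" for u by (simp add: cvs.scale_minus_left)
  then have "u \<in> closure ?L" for u using P(1)[of u] by simp
  then show ?thesis by (auto simp: cyclic_vector_def)
qed

text \<open>Orthogonality to a dense set, used first in the second and then in the first argument.\<close>

lemma dense_form_eqI:
  fixes S T :: "'a::complex_hilbert bop"
  assumes D: "closure D = UNIV" and eq: "\<And>u v. u \<in> D \<Longrightarrow> v \<in> D \<Longrightarrow> cinner (bop_apply S u) v = cinner (bop_apply T u) v"
  shows "S = T"
proof (rule bop_eqI_cinner)
  have dense: "w \<in> closure D" for w using D by (metis UNIV_I)
  fix u v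
  have 1: "cinner (bop_apply S u) v = cinner (bop_apply T u) v" if u: "u \<in> D" for u v
  proof -
    have "cinner l (bop_apply S u - bop_apply T u) = 0" if "l \<in> D" for l
      by (subst cinner_commute) (simp add: cinner_diff_left eq[OF u that])
    then have "cinner v (bop_apply S u - bop_apply T u) = 0"
      by (rule orthogonal_closure[of D]) (simp_all add: dense)
    then have "cinner (bop_apply S u - bop_apply T u) v = 0"
      by (metis cinner_commute complex_cnj_zero)
    then show ?thesis by (simp add: cinner_diff_left)
  qed
  have "cinner l (bop_apply (adj S) v - bop_apply (adj T) v) = 0" if "l \<in> D" for l
    by (simp add: cinner_diff_right 1[OF that] flip: adj_eq)
  then have "cinner u (bop_apply (adj S) v - bop_apply (adj T) v) = 0"
    by (rule orthogonal_closure[of D]) (simp_all add: dense)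
  then show "cinner (bop_apply S u) v = cinner (bop_apply T u) v"
    by (simp add: cinner_diff_right flip: adj_eq)
qed

section \<open>Factors with a cyclic and separating vector\<close>

locale cyclic_separating_factor =
  fixes M :: "'a::complex_hilbert bop set" and x\<^sub>0 :: 'a
  assumes factor: "vn_factor M" and separating: "separating_vector M x\<^sub>0"
    and cyclic: "cyclic_vector M x\<^sub>0"
begin

lemma vN: "von_neumann_algebra M" and M_bicommutant: "commutant (commutant M) = M"
  and M_adj: "A \<in> M \<Longrightarrow> adj A \<in> M"
  using factor by (auto simp: vn_factor_def von_neumann_algebra_def)

lemma M_one: "1 \<in> M" and M_add: "A \<in> M \<Longrightarrow> B \<in> M \<Longrightarrow> A + B \<in> M"
  and M_mult: "A \<in> M \<Longrightarrow> B \<in> M \<Longrightarrow> A * B \<in> M" and M_scaleC: "A \<in> M \<Longrightarrow> c *\<^sub>C A \<in> M"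
  using commutant_algebra[where N = "commutant M"] by (simp_all add: M_bicommutant)

lemma M_zero: "0 \<in> M"
  using M_scaleC[OF M_one, of 0] by (simp add: cvs.scale_zero_left)

lemma M_sum: "(\<And>i. i \<in> I \<Longrightarrow> f i \<in> M) \<Longrightarrow> (\<Sum>i\<in>I. f i) \<in> M"
  by (induction I rule: infinite_finite_induct) (simp_all add: M_zero M_add)

lemma M'_adj: "A \<in> commutant M \<Longrightarrow> adj A \<in> commutant M"
  by (rule commutant_adj[OF M_adj])

definition elementary_products :: "'a bop set" where
  "elementary_products = {A * B |A B. A \<in> commutant M \<and> B \<in> M}"

text \<open>An operator commuting with all these products commutes with \<open>M\<close> and with its commutant, hence lies
in the centre of \<open>M\<close>, which is trivial for a factor.\<close>

lemma elementary_products_irreducible: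
  "1 \<in> elementary_products"
  "X \<in> elementary_products \<Longrightarrow> Y \<in> elementary_products \<Longrightarrow> X * Y \<in> elementary_products"
  "X \<in> elementary_products \<Longrightarrow> adj X \<in> elementary_products"
  "commutant elementary_products \<subseteq> range (\<lambda>c. c *\<^sub>C 1)"
proof -
  have M1: "M \<subseteq> elementary_products" and M'1: "commutant M \<subseteq> elementary_products"
    unfolding elementary_products_def using M_one commutant_algebra(1)[of M] by force+
  show "1 \<in> elementary_products" using M1 M_one by blast
  show "X * Y \<in> elementary_products" if X: "X \<in> elementary_products" and Y: "Y \<in> elementary_products"
  proof -
    obtain A B C D where XY: "X = A * B" "Y = C * D" and "A \<in> commutant M" "B \<in> M" "C \<in> commutant M" "D \<in> M"
      using X Y by (auto simp: elementary_products_def)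
    then have "X * Y = (A * C) * (B * D)" "A * C \<in> commutant M" "B * D \<in> M"
      using commutantD[of C M B] by (simp_all add: commutant_algebra M_mult) (metis mult.assoc)
    then show ?thesis by (auto simp: elementary_products_def)
  qed
  show "adj X \<in> elementary_products" if X: "X \<in> elementary_products"
  proof -
    obtain A B where "X = A * B" "A \<in> commutant M" "B \<in> M"
      using X by (auto simp: elementary_products_def)
    then have "adj X = adj A * adj B" "adj A \<in> commutant M" "adj B \<in> M"
      using commutantD[OF M'_adj M_adj, symmetric] by (simp_all add: adj_times M'_adj M_adj)
    then show ?thesis by (auto simp: elementary_products_def)
  qed
  have "commutant elementary_products \<subseteq> M \<inter> commutant M"
    using M1 M'1 M_bicommutant unfolding commutant_def by blast
  then show "commutant elementary_products \<subseteq> range (\<lambda>c. c *\<^sub>C 1)"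
    using factor unfolding vn_factor_def by blast
qed

lemma normal_maps_eqI_on_products:
  assumes "normal_map \<Phi>" "normal_map \<Psi>"
    and "\<And>A B. A \<in> commutant M \<Longrightarrow> B \<in> M \<Longrightarrow> \<Phi> (A * B) = \<Psi> (A * B)"
  shows "\<Phi> X = \<Psi> X"
  by (rule normal_maps_eqI[OF assms(1,2) elementary_products_irreducible])
    (auto simp: elementary_products_def assms(3))

text \<open>By linearity it is enough to prescribe an extension on single products.\<close>

lemma normal_extension_iff:
  "normal_extension M \<phi> \<Phi> \<longleftrightarrow>
     normal_map \<Phi> \<and> (\<forall>A\<in>commutant M. \<forall>B\<in>M. \<Phi> (A * B) = A * \<phi> B)"
proof (intro iffI conjI ballI)
  assume *: "normal_extension M \<phi> \<Phi>"
  then show "normal_map \<Phi>" by (simp add: normal_extension_def)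
  fix A B assume "A \<in> commutant M" "B \<in> M"
  then have "(A * B, A * \<phi> B) \<in> tilde_graph M \<phi>"
    unfolding tilde_graph_def
    by (intro CollectI exI[of _ "1::nat"] exI[of _ "\<lambda>_. A"] exI[of _ "\<lambda>_. B"]) simp
  with * show "\<Phi> (A * B) = A * \<phi> B" by (auto simp: normal_extension_def)
next
  assume *: "normal_map \<Phi> \<and> (\<forall>A\<in>commutant M. \<forall>B\<in>M. \<Phi> (A * B) = A * \<phi> B)"
  then have cl: "clinear \<Phi>" by (simp add: normal_map_def)
  have "\<Phi> (\<Sum>i<n. A i * B i) = (\<Sum>i<n. A i * \<phi> (B i))"
    if "\<forall>i<n. A i \<in> commutant M \<and> B i \<in> M" for n :: nat and A B
    using that
  proof (induction n)
    case 0
    show ?case using clinear_scaleC[OF cl, of 0 0] by (simp add: cvs.scale_zero_left)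
  next
    case (Suc n)
    then show ?case using * by (simp add: clinear_add[OF cl])
  qed
  then show "normal_extension M \<phi> \<Phi>"
    using * by (auto simp: normal_extension_def tilde_graph_def)
qed

lemma tilde_eq:
  assumes "normal_extension M \<phi> \<Phi>"
  shows "tilde M \<phi> = \<Phi>"
  unfolding tilde_def
proof (rule the_equality[where P = "normal_extension M \<phi>", OF assms], rule ext)
  fix \<Psi> X assume "normal_extension M \<phi> \<Psi>"
  then show "\<Psi> X = \<Phi> X"
    using assms by - (rule normal_maps_eqI_on_products, simp_all add: normal_extension_iff)
qed

lemma tilde_normal: "\<phi> \<in> CB_sigma M \<Longrightarrow> normal_map (tilde M \<phi>)"
  and tilde_product: "\<phi> \<in> CB_sigma M \<Longrightarrow> A \<in> commutant M \<Longrightarrow> B \<in> M \<Longrightarrow> tilde M \<phi> (A * B) = A * \<phi> B"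
  using tilde_eq by (auto simp: CB_sigma_def normal_extension_iff)

text \<open>Both sides are normal in \<open>X\<close>. On a product \<open>C D\<close> they agree because \<open>B\<close> commutes with both \<open>D\<close> and
\<open>\<phi>(D)\<close>.\<close>

lemma tilde_bimodule:
  assumes \<phi>: "\<phi> \<in> CB_sigma M" and A: "A \<in> commutant M" and B: "B \<in> commutant M"
  shows "tilde M \<phi> (A * X * B) = A * tilde M \<phi> X * B"
proof (rule normal_maps_eqI_on_products[of "\<lambda>X. tilde M \<phi> (A * X * B)" "\<lambda>X. A * tilde M \<phi> X * B"])
  show "normal_map (\<lambda>X. tilde M \<phi> (A * X * B))"
    by (rule normal_map_compose[OF tilde_normal[OF \<phi>] normal_map_sandwich])
  show "normal_map (\<lambda>X. A * tilde M \<phi> X * B)"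
    by (rule normal_map_compose[OF normal_map_sandwich tilde_normal[OF \<phi>]])
  fix C D assume C: "C \<in> commutant M" and D: "D \<in> M"
  have "\<phi> D \<in> M" using \<phi> D by (auto simp: CB_sigma_def linear_maps_on_def)
  then have comm: "B * D = D * B" "B * \<phi> D = \<phi> D * B" using B D by (auto intro: commutantD)
  have "A * (C * D) * B = (A * C * B) * D" by (simp add: mult.assoc comm)
  then have "tilde M \<phi> (A * (C * D) * B) = (A * C * B) * \<phi> D"
    by (simp only: tilde_product[OF \<phi> _ D] commutant_algebra A B C)
  also have "\<dots> = A * tilde M \<phi> (C * D) * B"
    by (simp add: tilde_product[OF \<phi> C D] mult.assoc comm)
  finally show "tilde M \<phi> (A * (C * D) * B) = A * tilde M \<phi> (C * D) * B" .
qed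

lemma CB_sigma_eqI:
  assumes "\<phi> \<in> CB_sigma M" "\<psi> \<in> CB_sigma M" "\<And>X. tilde M \<phi> X = tilde M \<psi> X"
  shows "\<phi> = \<psi>"
proof -
  have "\<phi> B = \<psi> B" if "B \<in> M" for B
    using tilde_product[OF assms(1) commutant_algebra(1) that]
      tilde_product[OF assms(2) commutant_algebra(1) that] assms(3) by simp
  then show ?thesis
    using assms(1,2) by (intro PiE_ext[of \<phi> M "\<lambda>_. M" \<psi>]) (auto simp: CB_sigma_def linear_maps_on_def)
qed

lemma commutant_orbit_dense: "closure ((\<lambda>A. bop_apply A x\<^sub>0) ` commutant M) = UNIV"
  using cyclic_for_commutant[OF vN separating] by (simp add: cyclic_vector_def)

subsection \<open>Injectivity\<close>

lemma C_op_inj: "inj_on (C_op M x\<^sub>0) (CB_sigma M)"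
proof (rule inj_onI)
  fix \<phi> \<psi> assume \<phi>: "\<phi> \<in> CB_sigma M" and \<psi>: "\<psi> \<in> CB_sigma M" and "C_op M x\<^sub>0 \<phi> = C_op M x\<^sub>0 \<psi>"
  then have C: "tilde M \<phi> (rank_one x\<^sub>0 x\<^sub>0) = tilde M \<psi> (rank_one x\<^sub>0 x\<^sub>0)" by (simp add: C_op_def)
  let ?D = "(\<lambda>A. bop_apply A x\<^sub>0) ` commutant M"
  have agree: "tilde M \<phi> (rank_one u v) = tilde M \<psi> (rank_one u v)" if uv: "u \<in> ?D" "v \<in> ?D" for u v
  proof -
    obtain A B where A: "A \<in> commutant M" "u = bop_apply A x\<^sub>0" and B: "B \<in> commutant M" "v = bop_apply B x\<^sub>0"
      using uv by blast
    have "rank_one u v = A * rank_one x\<^sub>0 x\<^sub>0 * adj B"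
      by (rule bop_eqI) (simp add: A B adj_eq')
    then show ?thesis
      using tilde_bimodule[OF \<phi> A(1) M'_adj[OF B(1)]] tilde_bimodule[OF \<psi> A(1) M'_adj[OF B(1)]] C by simp
  qed
  show "\<phi> = \<psi>"
  proof (rule CB_sigma_eqI[OF \<phi> \<psi>], rule bop_eqI_cinner)
    fix X s t
    note p = predual_map(2)[OF tilde_normal[OF \<phi>] trace_class_rank_one[of s t]]
      predual_map(2)[OF tilde_normal[OF \<psi>] trace_class_rank_one[of s t]]
    have "predual_map (tilde M \<phi>) (rank_one s t) = predual_map (tilde M \<psi>) (rank_one s t)"
      by (rule dense_form_eqI[OF commutant_orbit_dense]) (simp add: p agree flip: trace_rank_one_mult)
    then show "cinner (bop_apply (tilde M \<phi> X) s) t = cinner (bop_apply (tilde M \<psi> X) s) t"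
      by (simp flip: trace_mult_rank_one p)
  qed
qed

lemma D_op_inj: "inj_on (D_op M x\<^sub>0) (CB_sigma M)"
proof (rule inj_onI)
  fix \<phi> \<psi> assume \<phi>: "\<phi> \<in> CB_sigma M" and \<psi>: "\<psi> \<in> CB_sigma M" and D: "D_op M x\<^sub>0 \<phi> = D_op M x\<^sub>0 \<psi>"
  have D': "cinner (bop_apply (tilde M \<phi> X) x\<^sub>0) x\<^sub>0 = cinner (bop_apply (tilde M \<psi> X) x\<^sub>0) x\<^sub>0" for X
    using predual_map(2)[OF tilde_normal[OF \<phi>] trace_class_rank_one[of x\<^sub>0 x\<^sub>0], of X]
      predual_map(2)[OF tilde_normal[OF \<psi>] trace_class_rank_one[of x\<^sub>0 x\<^sub>0], of X] D
    by (simp add: D_op_def trace_mult_rank_one)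
  show "\<phi> = \<psi>"
  proof (rule CB_sigma_eqI[OF \<phi> \<psi>], rule dense_form_eqI[OF commutant_orbit_dense])
    fix X u v
    assume "u \<in> (\<lambda>A. bop_apply A x\<^sub>0) ` commutant M" "v \<in> (\<lambda>A. bop_apply A x\<^sub>0) ` commutant M"
    then obtain A B where A: "A \<in> commutant M" "u = bop_apply A x\<^sub>0" and B: "B \<in> commutant M" "v = bop_apply B x\<^sub>0"
      by blast
    have "cinner (bop_apply (tilde M \<omega> X) u) v = cinner (bop_apply (tilde M \<omega> (adj B * X * A)) x\<^sub>0) x\<^sub>0"
      if "\<omega> \<in> CB_sigma M" for \<omega>
      by (simp add: tilde_bimodule[OF that M'_adj[OF B(1)] A(1)] A B adj_eq')
    then show "cinner (bop_apply (tilde M \<phi> X) u) v = cinner (bop_apply (tilde M \<psi> X) u) v"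
      using D' \<phi> \<psi> by simp
  qed
qed

subsection \<open>Density of the ranges\<close>

lemma elementary_map:
  assumes C: "\<And>i. i \<in> I \<Longrightarrow> C i \<in> M" and D: "\<And>i. i \<in> I \<Longrightarrow> D i \<in> M"
  defines "\<phi> \<equiv> restrict (\<lambda>B. \<Sum>i\<in>I. C i * B * D i) M"
  shows "\<phi> \<in> CB_sigma M"
    and "C_op M x\<^sub>0 \<phi> = (\<Sum>i\<in>I. rank_one (bop_apply (C i) x\<^sub>0) (bop_apply (adj (D i)) x\<^sub>0))"
    and "D_op M x\<^sub>0 \<phi> = (\<Sum>i\<in>I. rank_one (bop_apply (D i) x\<^sub>0) (bop_apply (adj (C i)) x\<^sub>0))"
proof -
  define \<Phi> where "\<Phi> X = (\<Sum>i\<in>I. C i * X * D i)" for X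
  have normal: "normal_map \<Phi>"
    unfolding \<Phi>_def[abs_def] by (intro normal_map_sum normal_map_sandwich)
  have ext: "normal_extension M \<phi> \<Phi>"
    unfolding normal_extension_iff
  proof (intro conjI ballI normal)
    fix A B assume A: "A \<in> commutant M" and B: "B \<in> M"
    have "C i * (A * B) * D i = A * (C i * B * D i)" if "i \<in> I" for i
      using commutantD[OF A C[OF that]] by (metis mult.assoc)
    then show "\<Phi> (A * B) = A * \<phi> B"
      by (simp add: \<Phi>_def \<phi>_def B sum_distrib_left)
  qed
  have cl: "clinear \<Phi>" using normal by (simp add: normal_map_def)
  have "\<phi> \<in> linear_maps_on M"
    unfolding linear_maps_on_def
    using clinear_add[OF cl] clinear_scaleC[OF cl]
    by (auto simp: \<phi>_def M_add M_scaleC \<Phi>_def intro!: M_sum M_mult C D)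
  with ext show "\<phi> \<in> CB_sigma M" by (auto simp: CB_sigma_def)
  show "C_op M x\<^sub>0 \<phi> = (\<Sum>i\<in>I. rank_one (bop_apply (C i) x\<^sub>0) (bop_apply (adj (D i)) x\<^sub>0))"
    unfolding C_op_def tilde_eq[OF ext] \<Phi>_def
    by (intro sum.cong refl bop_eqI) (simp add: adj_eq)
  show "D_op M x\<^sub>0 \<phi> = (\<Sum>i\<in>I. rank_one (bop_apply (D i) x\<^sub>0) (bop_apply (adj (C i)) x\<^sub>0))"
    unfolding D_op_def tilde_eq[OF ext]
  proof (rule predual_map_eqI[OF normal trace_class_rank_one])
    fix A
    have "trace (A * (\<Sum>i\<in>I. rank_one (bop_apply (D i) x\<^sub>0) (bop_apply (adj (C i)) x\<^sub>0)))
        = (\<Sum>i\<in>I. cinner (bop_apply A (bop_apply (D i) x\<^sub>0)) (bop_apply (adj (C i)) x\<^sub>0))"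
      by (simp add: sum_distrib_left trace_sum trace_class_mult_left trace_mult_rank_one)
    then show "trace (A * (\<Sum>i\<in>I. rank_one (bop_apply (D i) x\<^sub>0) (bop_apply (adj (C i)) x\<^sub>0)))
        = trace (\<Phi> A * rank_one x\<^sub>0 x\<^sub>0)"
      by (simp add: \<Phi>_def trace_mult_rank_one apply_sum_op cinner_sum_left flip: adj_eq)
  qed
qed

text \<open>Truncate an expansion \<open>T = \<Sum>\<^sub>i x\<^sub>i \<boxtimes> y\<^sub>i\<close> to a finite set \<open>F\<close> and replace \<open>x\<^sub>i\<close> and \<open>y\<^sub>i\<close> there by
\<open>p\<^sub>i = c\<^sub>i x\<^sub>0\<close> and \<open>q\<^sub>i = d\<^sub>i x\<^sub>0\<close>. The error has the expansion
\<open>\<Sum>\<^sub>i (p\<^sub>i - x\<^sub>i) \<boxtimes> y\<^sub>i + \<Sum>\<^sub>i p\<^sub>i \<boxtimes> (q\<^sub>i - y\<^sub>i)\<close>, with \<open>p\<close> and \<open>q\<close> zero outside \<open>F\<close>, whose norm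
sum is small. The bound on matrix coefficients serves the weak operator topology.\<close>

lemma finite_rank_approximation:
  fixes T :: "'a bop"
  assumes T: "T \<in> trace_class" and "\<epsilon> > 0"
  shows "\<exists>(F :: 'a set) c d. range c \<subseteq> M \<and> range d \<subseteq> M \<and>
    trace_norm ((\<Sum>i\<in>F. rank_one (bop_apply (c i) x\<^sub>0) (bop_apply (d i) x\<^sub>0)) - T) < \<epsilon> \<and>
    (\<forall>u v. cmod (cinner (bop_apply ((\<Sum>i\<in>F. rank_one (bop_apply (c i) x\<^sub>0) (bop_apply (d i) x\<^sub>0)) - T) u) v)
      \<le> \<epsilon> * (norm u * norm v))"
proof -
  obtain x y :: "'a \<Rightarrow> 'a" where xy: "represents x y T" using T by (rule trace_class_represents)
  note l2 = representsD(1,2)[OF xy]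
  define n where "n i = norm (x i) * norm (y i)" for i
  have n: "n summable_on UNIV" unfolding n_def by (rule l2_families_prod_summable[OF l2])
  obtain F where F: "finite F" "dist (sum n F) (infsum n UNIV) \<le> \<epsilon> / 4"
    using infsum_finite_approximation[OF n, of "\<epsilon> / 4"] \<open>\<epsilon> > 0\<close> by auto
  \<comment> \<open>At each of the \<open>card F\<close> indices two errors below \<open>\<delta>\<close> occur; the tail contributes at most \<open>\<epsilon> / 4\<close>.\<close>
  define \<delta> where "\<delta> = \<epsilon> / (4 * (real (card F) + 1))"
  have "\<delta> > 0" using \<open>\<epsilon> > 0\<close> by (simp add: \<delta>_def)
  have approx: "\<exists>A\<in>M. norm (bop_apply A x\<^sub>0 - z) < r" if "r > 0" for z r
  proof -
    have "z \<in> closure ((\<lambda>A. bop_apply A x\<^sub>0) ` M)" using cyclic by (simp add: cyclic_vector_def)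
    then show ?thesis using that unfolding closure_approachable dist_norm by blast
  qed
  have "\<exists>c. \<forall>i. c i \<in> M \<and> norm (bop_apply (c i) x\<^sub>0 - x i) * norm (y i) < \<delta>"
  proof (rule choice, rule allI)
    fix i
    obtain A where A: "A \<in> M" "norm (bop_apply A x\<^sub>0 - x i) < \<delta> / (norm (y i) + 1)"
      using approx[of "\<delta> / (norm (y i) + 1)" "x i"] \<open>\<delta> > 0\<close> by (auto simp: add_nonneg_pos)
    have "norm (bop_apply A x\<^sub>0 - x i) * norm (y i) \<le> norm (bop_apply A x\<^sub>0 - x i) * (norm (y i) + 1)"
      by (intro mult_left_mono) auto
    also have "\<dots> < \<delta>" using A(2) by (simp add: pos_less_divide_eq add_nonneg_pos)
    finally show "\<exists>A. A \<in> M \<and> norm (bop_apply A x\<^sub>0 - x i) * norm (y i) < \<delta>" using A(1) by blast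
  qed
  then obtain c where c: "\<And>i. c i \<in> M" "\<And>i. norm (bop_apply (c i) x\<^sub>0 - x i) * norm (y i) < \<delta>" by blast
  have "\<exists>d. \<forall>i. d i \<in> M \<and> norm (bop_apply (c i) x\<^sub>0) * norm (bop_apply (d i) x\<^sub>0 - y i) < \<delta>"
  proof (rule choice, rule allI)
    fix i
    let ?k = "norm (bop_apply (c i) x\<^sub>0)"
    obtain A where A: "A \<in> M" "norm (bop_apply A x\<^sub>0 - y i) < \<delta> / (?k + 1)"
      using approx[of "\<delta> / (?k + 1)" "y i"] \<open>\<delta> > 0\<close> by (auto simp: add_nonneg_pos)
    have "?k * norm (bop_apply A x\<^sub>0 - y i) \<le> (?k + 1) * norm (bop_apply A x\<^sub>0 - y i)"
      by (intro mult_right_mono) auto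
    also have "\<dots> < \<delta>" using A(2) by (simp add: pos_less_divide_eq add_nonneg_pos mult.commute)
    finally show "\<exists>A. A \<in> M \<and> ?k * norm (bop_apply A x\<^sub>0 - y i) < \<delta>" using A(1) by blast
  qed
  then obtain d where d: "\<And>i. d i \<in> M"
    "\<And>i. norm (bop_apply (c i) x\<^sub>0) * norm (bop_apply (d i) x\<^sub>0 - y i) < \<delta>" by blast
  define R where "R = (\<Sum>i\<in>F. rank_one (bop_apply (c i) x\<^sub>0) (bop_apply (d i) x\<^sub>0))"
  define p where "p i = (if i \<in> F then bop_apply (c i) x\<^sub>0 else 0)" for i
  define q where "q i = (if i \<in> F then bop_apply (d i) x\<^sub>0 else 0)" for i
  have lp: "l2_family p" "l2_family q"
    by (rule l2_family_finite_support, rule finite_subset[OF _ F(1)], auto simp: p_def q_def split: if_splits)+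
  have minus: "l2_family (\<lambda>i. f i - g i)" if "l2_family f" "l2_family g" for f g :: "'a \<Rightarrow> 'a"
    using l2_family_add[OF that(1) l2_family_scaleC[OF that(2), of "-1"]] by (simp add: cvs.scale_minus_left)
  define X where "X = case_sum (\<lambda>i. p i - x i) p"
  define Y where "Y = case_sum y (\<lambda>i. q i - y i)"
  have rep: "represents X Y (R - T)"
    unfolding represents_def
  proof (intro conjI allI)
    show "l2_family X" "l2_family Y"
      unfolding X_def Y_def by (intro l2_family_case_sum minus lp l2)+
    fix u v
    have s: "(\<lambda>i. cinner u (g i) * cinner (f i) v) summable_on UNIV" if "l2_family f" "l2_family g" for f g :: "'a \<Rightarrow> 'a"
    proof (rule abs_summable_summable, rule summable_on_comparison_test)
      show "(\<lambda>i. norm (f i) * norm (g i) * (norm u * norm v)) summable_on UNIV"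
        by (intro summable_on_cmult_left l2_families_prod_summable that)
      show "norm (cinner u (g i) * cinner (f i) v) \<le> norm (f i) * norm (g i) * (norm u * norm v)" for i
        using mult_mono[OF cinner_Cauchy_Schwarz[of u "g i"] cinner_Cauchy_Schwarz[of "f i" v]]
        by (simp add: norm_mult ac_simps)
    qed simp
    have R: "((\<lambda>i. cinner u (q i) * cinner (p i) v) has_sum cinner (bop_apply R u) v) UNIV"
      by (rule has_sum_finite_neutralI[OF F(1)])
        (auto simp: p_def q_def R_def apply_sum_op cinner_sum_left cinner_scaleC_left)
    \<comment> \<open>The mixed sum \<open>\<Sum>\<^sub>i p\<^sub>i \<boxtimes> y\<^sub>i\<close> enters the two halves of the error with opposite signs.\<close>
    obtain z where z: "((\<lambda>i. cinner u (y i) * cinner (p i) v) has_sum z) UNIV"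
      using s[OF lp(1) l2(2)] summable_on_def by blast
    have "((\<lambda>i. cinner u (y i) * cinner (p i) v + - (cinner u (y i) * cinner (x i) v)) has_sum
        z + - cinner (bop_apply T u) v) UNIV"
      by (intro has_sum_add z has_sum_uminusI representsD(3)[OF xy])
    moreover have "((\<lambda>i. cinner u (q i) * cinner (p i) v + - (cinner u (y i) * cinner (p i) v)) has_sum
        cinner (bop_apply R u) v + - z) UNIV"
      by (intro has_sum_add z has_sum_uminusI R)
    ultimately have "((\<lambda>i. cinner u (Y i) * cinner (X i) v) has_sum
        (z + - cinner (bop_apply T u) v) + (cinner (bop_apply R u) v + - z)) UNIV"
      by (intro has_sum_sum_type)
        (simp_all add: X_def Y_def cinner_diff_left cinner_diff_right algebra_simps)
    then show "((\<lambda>i. cinner u (Y i) * cinner (X i) v) has_sum cinner (bop_apply (R - T) u) v) UNIV"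
      by (simp add: cinner_diff_left)
  qed
  have small: "(\<Sum>\<^sub>\<infinity>i. norm (X i) * norm (Y i)) < \<epsilon>"
  proof -
    define h where "h i = norm (p i - x i) * norm (y i) + norm (p i) * norm (q i - y i)" for i
    have a: "(\<lambda>i. norm (p i - x i) * norm (y i)) summable_on UNIV"
      "(\<lambda>i. norm (p i) * norm (q i - y i)) summable_on UNIV"
      by (intro l2_families_prod_summable minus lp l2)+
    have "((\<lambda>i. norm (X i) * norm (Y i)) has_sum
        (\<Sum>\<^sub>\<infinity>i. norm (p i - x i) * norm (y i)) + (\<Sum>\<^sub>\<infinity>i. norm (p i) * norm (q i - y i))) UNIV"
      by (intro has_sum_sum_type) (simp_all add: X_def Y_def a)
    then have "(\<Sum>\<^sub>\<infinity>i. norm (X i) * norm (Y i)) = infsum h UNIV"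
      unfolding h_def by (simp add: infsumI infsum_add[OF a])
    also have "\<dots> \<le> infsum n UNIV + (\<Sum>i\<in>F. 2 * \<delta> - n i)"
    proof (rule has_sum_mono)
      show "(h has_sum infsum h UNIV) UNIV"
        unfolding h_def by (intro has_sum_infsum summable_on_add a)
      show "((\<lambda>i. n i + (if i \<in> F then 2 * \<delta> - n i else 0)) has_sum
          infsum n UNIV + (\<Sum>i\<in>F. 2 * \<delta> - n i)) UNIV"
        by (intro has_sum_add has_sum_infsum n has_sum_finite_neutralI[OF F(1)]) auto
      show "h i \<le> n i + (if i \<in> F then 2 * \<delta> - n i else 0)" for i
        using c(2)[of i] d(2)[of i] by (auto simp: h_def p_def q_def n_def)
    qed
    also have "\<dots> = (infsum n UNIV - sum n F) + 2 * (real (card F) * \<delta>)"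
      by (simp add: sum_subtractf)
    also have "\<dots> < \<epsilon>"
    proof -
      have "infsum n UNIV - sum n F \<le> \<epsilon> / 4" using F(2) unfolding dist_real_def by linarith
      moreover have "real (card F) * \<delta> < \<epsilon> / 4"
        using \<open>\<epsilon> > 0\<close> by (simp add: \<delta>_def field_simps)
      ultimately show ?thesis using \<open>\<epsilon> > 0\<close> by argo
    qed
    finally show ?thesis .
  qed
  show ?thesis
  proof (rule exI[of _ F], rule exI[of _ c], rule exI[of _ d], intro conjI allI)
    show "trace_norm ((\<Sum>i\<in>F. rank_one (bop_apply (c i) x\<^sub>0) (bop_apply (d i) x\<^sub>0)) - T) < \<epsilon>"
      using represents_trace_norm_le[OF rep] small unfolding R_def by linarith
    show "cmod (cinner (bop_apply ((\<Sum>i\<in>F. rank_one (bop_apply (c i) x\<^sub>0) (bop_apply (d i) x\<^sub>0)) - T) u) v)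
      \<le> \<epsilon> * (norm u * norm v)" for u v
      using represents_norm_le[OF rep, of u v] mult_right_mono[OF less_imp_le[OF small], of "norm u * norm v"]
      unfolding R_def by simp
  qed (use c d in auto)
qed

lemma D_op_trace_class: "D_op M x\<^sub>0 ` CB_sigma M \<subseteq> trace_class"
  unfolding D_op_def using predual_map(1)[OF tilde_normal trace_class_rank_one] by blast

lemma D_op_dense:
  assumes "T \<in> trace_class" "\<epsilon> > 0"
  shows "\<exists>\<phi>\<in>CB_sigma M. trace_norm (D_op M x\<^sub>0 \<phi> - T) < \<epsilon>"
proof -
  obtain F :: "'a set" and c d where F: "range c \<subseteq> M" "range d \<subseteq> M"
    "trace_norm ((\<Sum>i\<in>F. rank_one (bop_apply (c i) x\<^sub>0) (bop_apply (d i) x\<^sub>0)) - T) < \<epsilon>"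
    using finite_rank_approximation[OF assms] by blast
  show ?thesis
    using F by (intro bexI[OF _ elementary_map(1)[of F "\<lambda>i. adj (d i)" c]])
      (auto simp: M_adj image_subset_iff elementary_map(3))
qed

text \<open>The finite partial sums \<open>\<Sum>\<^sub>e A e \<boxtimes> e\<close> over an orthonormal basis converge weakly to \<open>A\<close>, and each of
them is approximated by elements of the range in the sense of \<open>finite_rank_approximation\<close>.\<close>

lemma C_op_dense: "weak_operator_topology closure_of (C_op M x\<^sub>0 ` CB_sigma M) = UNIV"
proof -
  have "A \<in> weak_operator_topology closure_of (C_op M x\<^sub>0 ` CB_sigma M)" for A
    unfolding in_closure_of
  proof (intro conjI allI impI)
    have "UNIV \<in> {{A::'a bop. cinner (bop_apply A x) y \<in> U} |x y U. open U}"
      by (rule CollectI, rule exI[of _ 0], rule exI[of _ 0], rule exI[of _ UNIV]) auto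
    then show "A \<in> topspace weak_operator_topology"
      unfolding weak_operator_topology_def by auto
    fix W assume "A \<in> W \<and> openin weak_operator_topology W"
    then obtain K \<delta> where K: "finite K" "\<delta> > 0"
      "\<And>B. (\<And>x y. (x, y) \<in> K \<Longrightarrow> dist (cinner (bop_apply B x) y) (cinner (bop_apply A x) y) < \<delta>) \<Longrightarrow> B \<in> W"
    proof -
      obtain K \<delta> where nb: "finite K \<and> \<delta> > 0 \<and> (\<forall>B. (\<forall>(x, y)\<in>K. dist (cinner (bop_apply B x) y) (cinner (bop_apply A x) y) < \<delta>) \<longrightarrow> B \<in> W)"
        using weak_operator_nbhd[of W A] \<open>A \<in> W \<and> _\<close> by blast
      show thesis
      proof (rule that[of K \<delta>])
        show "B \<in> W" if "\<And>x y. (x, y) \<in> K \<Longrightarrow> dist (cinner (bop_apply B x) y) (cinner (bop_apply A x) y) < \<delta>" for B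
          using nb that by blast
      qed (use nb in auto)
    qed
    obtain E :: "'a set" where E: "is_onb E" using onb_exists by blast
    have "\<forall>\<^sub>F G in finite_subsets_at_top E.
        dist (\<Sum>e\<in>G. cinner (fst k) e * cinner (bop_apply A e) (snd k)) (cinner (bop_apply A (fst k)) (snd k)) < \<delta> / 2" for k
    proof -
      have "((\<lambda>e. cinner (fst k) e * cinner (bop_apply A e) (snd k)) has_sum cinner (bop_apply A (fst k)) (snd k)) E"
        using parseval[OF E, of "fst k" "bop_apply (adj A) (snd k)"] by (simp flip: adj_eq)
      then show ?thesis
        unfolding has_sum_def using K(2) by (intro tendstoD) auto
    qed
    then have "\<forall>\<^sub>F G in finite_subsets_at_top E. \<forall>k\<in>K.
        dist (\<Sum>e\<in>G. cinner (fst k) e * cinner (bop_apply A e) (snd k)) (cinner (bop_apply A (fst k)) (snd k)) < \<delta> / 2"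
      by (intro eventually_ball_finite K(1)) blast
    from eventually_happens'[OF finite_subsets_at_top_neq_bot this]
    obtain G where G: "\<And>k. k \<in> K \<Longrightarrow>
        dist (\<Sum>e\<in>G. cinner (fst k) e * cinner (bop_apply A e) (snd k)) (cinner (bop_apply A (fst k)) (snd k)) < \<delta> / 2"
      by blast
    define R where "R = (\<Sum>e\<in>G. rank_one (bop_apply A e) e)"
    have "R \<in> trace_class" unfolding R_def by (rule trace_class_sum) simp
    define b where "b = (\<Sum>k\<in>K. norm (fst k) * norm (snd k))"
    have "b \<ge> 0" by (simp add: b_def sum_nonneg)
    define \<epsilon> where "\<epsilon> = \<delta> / (2 * (b + 1))"
    have "\<epsilon> > 0" using K(2) \<open>b \<ge> 0\<close> by (simp add: \<epsilon>_def)
    obtain F :: "'a set" and c d where F: "range c \<subseteq> M" "range d \<subseteq> M"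
      "\<And>u v. cmod (cinner (bop_apply ((\<Sum>i\<in>F. rank_one (bop_apply (c i) x\<^sub>0) (bop_apply (d i) x\<^sub>0)) - R) u) v)
        \<le> \<epsilon> * (norm u * norm v)"
      using finite_rank_approximation[OF \<open>R \<in> trace_class\<close> \<open>\<epsilon> > 0\<close>] by blast
    define S where "S = (\<Sum>i\<in>F. rank_one (bop_apply (c i) x\<^sub>0) (bop_apply (d i) x\<^sub>0))"
    have "S \<in> W"
    proof (rule K(3))
      fix x y assume xy: "(x, y) \<in> K"
      have "dist (cinner (bop_apply S x) y) (cinner (bop_apply R x) y) \<le> \<epsilon> * (norm x * norm y)"
        using F(3)[of x y] by (simp add: S_def dist_norm cinner_diff_left)
      also have "\<dots> \<le> \<epsilon> * b"
        using member_le_sum[OF xy _ K(1), of "\<lambda>k. norm (fst k) * norm (snd k)"] \<open>\<epsilon> > 0\<close>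
        by (intro mult_left_mono) (simp_all add: b_def)
      also have "\<dots> \<le> \<delta> / 2"
        using K(2) \<open>b \<ge> 0\<close> by (simp add: \<epsilon>_def field_simps)
      finally have 1: "dist (cinner (bop_apply S x) y) (cinner (bop_apply R x) y) \<le> \<delta> / 2" .
      have "dist (cinner (bop_apply R x) y) (cinner (bop_apply A x) y) < \<delta> / 2"
        using G[OF xy] by (simp add: R_def apply_sum_op cinner_sum_left cinner_scaleC_left)
      with 1 show "dist (cinner (bop_apply S x) y) (cinner (bop_apply A x) y) < \<delta>"
        using dist_triangle[of "cinner (bop_apply S x) y" "cinner (bop_apply A x) y" "cinner (bop_apply R x) y"]
        by argo
    qed
    moreover have "S \<in> C_op M x\<^sub>0 ` CB_sigma M"
      using F(1,2) unfolding S_def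
      by (intro image_eqI[OF _ elementary_map(1)[of F c "\<lambda>i. adj (d i)"]])
        (auto simp: M_adj image_subset_iff elementary_map(2))
    ultimately show "\<exists>S. S \<in> C_op M x\<^sub>0 ` CB_sigma M \<and> S \<in> W" by blast
  qed
  then show ?thesis by blast
qed

end

theorem theorem2p2:
  fixes M :: "'a::complex_hilbert bop set" and x\<^sub>0 :: 'a
  assumes "separable_space (euclidean :: 'a topology)"
    and "vn_factor M"
    and "norm x\<^sub>0 = 1"
    and "separating_vector M x\<^sub>0"
    and "cyclic_vector M x\<^sub>0"
  shows "inj_on (C_op M x\<^sub>0) (CB_sigma M)
    \<and> inj_on (D_op M x\<^sub>0) (CB_sigma M)
    \<and> weak_operator_topology closure_of (C_op M x\<^sub>0 ` CB_sigma M) = UNIV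
    \<and> D_op M x\<^sub>0 ` CB_sigma M \<subseteq> trace_class
    \<and> (\<forall>T\<in>trace_class. \<forall>\<epsilon>>0. \<exists>\<phi>\<in>CB_sigma M. trace_norm (D_op M x\<^sub>0 \<phi> - T) < \<epsilon>)"
proof -
  interpret cyclic_separating_factor M x\<^sub>0
    using assms by unfold_locales
  show ?thesis
    using C_op_inj D_op_inj C_op_dense D_op_trace_class D_op_dense by blast
qed

end
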